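(* Let $Y\subset\mathbb{R}^2$ and let $f: Y\to\mathbb{R}^2$ be a continuous map. Suppose that: (1) for some $n\geq 1$ there exists an $f$-outflanking $n$ steps arc $A\subset Y$ from $x=u_0$ to $u=u_n=f^n(x)$, where $u_k=f^k(x)$, and there exists a disc $E\subset Y$ such that $A\cup f(A)\subset\operatorname{Int}E$; (2) letting $y\in(u_{n-1},u_n]_A$ be the $f$-outflanking point of $A$, there exists a connected open neighborhood $U_{n-1}$ of $u_{n-1}$ in $\operatorname{Int}E$ such that $f|_{U_{n-1}}$ is an orientation preserving injection, and $f|_{(u_{n-1},y)_A}$ is exclusive in $E$, that is, $$f\big(E-(u_{n-1},y)_A\big)\cap f\big((u_{n-1},y)_A\big)=\emptyset.$$ Then $f$ has a fixed point in $\operatorname{Int}E$.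
   Context: A disc is a space homeomorphic to the closed unit disc in $\mathbb{R}^2$; an arc is a space homeomorphic to $[0,1]$, with endpoint set $\partial A$. $\operatorname{Int}E$ is the topological interior in $\mathbb{R}^2$; $S-T$ is set difference. For an arc $A$ and $a,b\in A$, $[a,b]_A$ is the smallest connected subset of $A$ containing $\{a,b\}$; $(a,b]_A=[b,a)_A=[a,b]_A-\{a\}$ and $(a,b)_A=[a,b]_A-\{a,b\}$. A natural order on $A$ is one induced by a homeomorphism $\lambda:A\to[0,1]$ via $a\prec b$ iff $\lambda(a)<\lambda(b)$. $\mathbb{N}_k=\{1,\dots,k\}$. Iterates of $f:Y\to\mathbb{R}^2$: $f^0(z)=z$ for $z\in Y$, and $f^k(z)=f(f^{k-1}(z))$ whenever $f^{k-1}(z)$ is defined and lies in $Y$. $n$ steps arcs: Let $A\subset Y$ be an arc with endpoints $x$ and $u$, and write $u_k=f^k(x)$ whenever defined. If $u=u_1=f(x)$, then $A$ is a one step arc of $f$ from $x$ to $u$. If for some $n\ge2$ we have $u=u_n=f^n(x)$, $\{u_1,\dots,u_{n-1}\}\subset A-\partial A$, $u_0\prec u_1\prec\cdots\prec u_{n-1}\prec u_n$ for some natural order $\prec$ on $A$, and $f([u_{k-1},u_k]_A)=[u_k,u_{k+1}]_A$ for all $k\in\mathbb{N}_{n-1}$, then $A$ is an $n$ steps arc of $f$ from $x$ to $u$. $f$-outflanking arcs: For $n\ge1$, let $A$ be an $n$ steps arc of $f$ from $x=u_0$ to $u=u_n=f^n(x)$. If there exist $y\in(u_{n-1},u_n]_A$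 and $v\in[x,y)_A$ such that $f|_{[u_{n-1},y]_A}$ is injective, $v=f(y)$, $f((u_{n-1},y)_A)\cap A=\emptyset$ and $f([y,u]_A)\cap[y,u]_A=\emptyset$, then $A$ is called an $f$-outflanking $n$ steps arc, $y$ is called the $f$-outflanking point of $A$ and $v$ the $f$-outflanked point of $A$. Orientation: a homeomorphism of $\mathbb{R}^2$ is orientation preserving if its extension to $\mathbb{R}^2\cup\{\infty\}$ fixing $\infty$ induces the identity on $H_2(\mathbb{R}^2\cup\{\infty\},\mathbb{Z})$. A continuous injection $\xi:D\to\mathbb{R}^2$ of a disc $D\subset\mathbb{R}^2$ extends to a homeomorphism of $\mathbb{R}^2$ (Schoenflies); $\xi$ is orientation preserving if such an extension is (independent of the extension). If $U\subset Y$ is connected and open in $\mathbb{R}^2$ and $f|_U$ is injective, then $f|_U$ is orientation preserving if $f|_D$ is orientation preserving for a disc $D\subset U$ (independent of $D$). *)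

theory Defs
  imports "HOL-Analysis.Analysis" "HOL-Homology.Homology"
begin

type_synonym plane = "real ^ 2"

definition is_disc :: "plane set \<Rightarrow> bool" where
  "is_disc D \<longleftrightarrow> D homeomorphic cball (0 :: plane) 1"

definition is_arc :: "plane set \<Rightarrow> bool" where
  "is_arc A \<longleftrightarrow> A homeomorphic {0..1 :: real}"

definition arc_ends :: "plane set \<Rightarrow> plane set" where
  "arc_ends A = {p. \<exists>h k. homeomorphism {0..1 :: real} A h k \<and> (p = h 0 \<or> p = h 1)}"

(* [a,b]_A is the least, with respect to inclusion, of the connected subsets of A containing a and b;
   it exists whenever A is an arc and a, b are points of A. *)
definition arc_cc :: "plane set \<Rightarrow> plane \<Rightarrow> plane \<Rightarrow> plane set" where
  "arc_cc A a b = (LEAST C. connected C \<and> C \<subseteq> A \<and> {a, b} \<subseteq> C)"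

definition arc_oc :: "plane set \<Rightarrow> plane \<Rightarrow> plane \<Rightarrow> plane set" where
  "arc_oc A a b = arc_cc A a b - {a}"

definition arc_co :: "plane set \<Rightarrow> plane \<Rightarrow> plane \<Rightarrow> plane set" where
  "arc_co A a b = arc_cc A a b - {b}"

definition arc_oo :: "plane set \<Rightarrow> plane \<Rightarrow> plane \<Rightarrow> plane set" where
  "arc_oo A a b = arc_cc A a b - {a, b}"

definition natural_order :: "plane set \<Rightarrow> (plane \<Rightarrow> plane \<Rightarrow> bool) \<Rightarrow> bool" where
  "natural_order A prec \<longleftrightarrow>
     (\<exists>l k. homeomorphism A {0..1 :: real} l k \<and> (\<forall>a\<in>A. \<forall>b\<in>A. prec a b \<longleftrightarrow> l a < l b))"

(* A map f : Y \<rightarrow> R^2 is represented by a total function whose values outside Y are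
   irrelevant.  The k-th iterate of the partial map is defined at z precisely if all earlier
   iterates lie in Y, and it is then (f ^^ k) z. *)
definition iterate_defined :: "plane set \<Rightarrow> (plane \<Rightarrow> plane) \<Rightarrow> nat \<Rightarrow> plane \<Rightarrow> bool" where
  "iterate_defined Y f k z \<longleftrightarrow> z \<in> Y \<and> (\<forall>j<k. (f ^^ j) z \<in> Y)"

definition n_steps_arc ::
  "plane set \<Rightarrow> (plane \<Rightarrow> plane) \<Rightarrow> nat \<Rightarrow> plane set \<Rightarrow> plane \<Rightarrow> plane \<Rightarrow> bool" where
  "n_steps_arc Y f n A x u \<longleftrightarrow>
     A \<subseteq> Y \<and> is_arc A \<and> arc_ends A = {x, u} \<and>
     (n = 1 \<and> u = f x \<or>
      n \<ge> 2 \<and> iterate_defined Y f n x \<and> u = (f ^^ n) x \<and>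
      (\<forall>k\<in>{1..n - 1}. (f ^^ k) x \<in> A - arc_ends A) \<and>
      (\<exists>prec. natural_order A prec \<and> (\<forall>k<n. prec ((f ^^ k) x) ((f ^^ Suc k) x))) \<and>
      (\<forall>k\<in>{1..n - 1}. f ` arc_cc A ((f ^^ (k - 1)) x) ((f ^^ k) x)
                     = arc_cc A ((f ^^ k) x) ((f ^^ (k + 1)) x)))"

definition outflanking_points ::
  "plane set \<Rightarrow> (plane \<Rightarrow> plane) \<Rightarrow> nat \<Rightarrow> plane set \<Rightarrow> plane \<Rightarrow> plane \<Rightarrow> plane \<Rightarrow> plane \<Rightarrow> bool" where
  "outflanking_points Y f n A x u y v \<longleftrightarrow>
     n \<ge> 1 \<and> n_steps_arc Y f n A x u \<and>
     (let w = (f ^^ (n - 1)) x in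
        y \<in> arc_oc A w u \<and> v \<in> arc_co A x y \<and>
        inj_on f (arc_cc A w y) \<and> v = f y \<and>
        f ` arc_oo A w y \<inter> A = {} \<and>
        f ` arc_cc A y u \<inter> arc_cc A y u = {})"

definition outflanking_arc ::
  "plane set \<Rightarrow> (plane \<Rightarrow> plane) \<Rightarrow> nat \<Rightarrow> plane set \<Rightarrow> plane \<Rightarrow> plane \<Rightarrow> bool" where
  "outflanking_arc Y f n A x u \<longleftrightarrow> (\<exists>y v. outflanking_points Y f n A x u y v)"

(* The point y below is unique: it is the first point after f^(n-1)(x) on A which f maps back into A. *)
definition outflanking_point ::
  "plane set \<Rightarrow> (plane \<Rightarrow> plane) \<Rightarrow> nat \<Rightarrow> plane set \<Rightarrow> plane \<Rightarrow> plane \<Rightarrow> plane \<Rightarrow> bool" where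
  "outflanking_point Y f n A x u y \<longleftrightarrow> (\<exists>v. outflanking_points Y f n A x u y v)"

(* The sphere R^2 \<union> {\<infinity>} is the one-point compactification of the plane, with None as the point at
   infinity; map_option h is the extension of h fixing it.  The homology groups of HOL-Homology
   are singular homology groups with integer coefficients. *)
definition orientation_preserving_homeo :: "(plane \<Rightarrow> plane) \<Rightarrow> bool" where
  "orientation_preserving_homeo h \<longleftrightarrow>
     (\<exists>g. homeomorphism UNIV UNIV h g) \<and>
     (let S = Alexandroff_compactification (euclidean :: plane topology) in
        \<forall>c \<in> carrier (homology_group 2 S). hom_induced 2 S {} S {} (map_option h) c = c)"

(* Whether an extension of xi preserves orientation does not depend on the extension. *)
definition orientation_preserving_on_disc :: "plane set \<Rightarrow> (plane \<Rightarrow> plane) \<Rightarrow> bool" where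
  "orientation_preserving_on_disc D xi \<longleftrightarrow>
     (\<exists>h. (\<forall>z\<in>D. h z = xi z) \<and> orientation_preserving_homeo h)"

(* Intended for U open and connected and f continuous and injective on U; the choice of D is then
   immaterial. *)
definition orientation_preserving_on_open :: "plane set \<Rightarrow> (plane \<Rightarrow> plane) \<Rightarrow> bool" where
  "orientation_preserving_on_open U f \<longleftrightarrow>
     (\<exists>D. is_disc D \<and> D \<subseteq> U \<and> orientation_preserving_on_disc D f)"

definition exclusive_in :: "(plane \<Rightarrow> plane) \<Rightarrow> plane set \<Rightarrow> plane set \<Rightarrow> bool" where
  "exclusive_in f S E \<longleftrightarrow> f ` (E - S) \<inter> f ` S = {}"

end

theory Submission
  imports Defs "HOL-Complex_Analysis.Complex_Analysis"
begin

text \<open>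
  Let \<open>w = f\<^sup>n\<^sup>-\<^sup>1(x)\<close>. The arc from \<open>v\<close> to \<open>u\<close> in \<open>A\<close>, followed by the image of the arc from \<open>w\<close> to \<open>y\<close>,
  is a Jordan curve \<open>J\<close>; let \<open>\<Delta>\<close> be the closed domain bounded by it. Near the part of the arc from \<open>w\<close>
  to \<open>y\<close> that lies on \<open>J\<close>, the map \<open>f\<close> sends \<open>\<Delta>\<close> into \<open>\<Delta>\<close>: winding numbers show that \<open>f\<close> preserves the
  two sides of the arc at its points near \<open>w\<close>, where \<open>f\<close> is an orientation preserving injection, and
  exclusiveness propagates this along the arc, because no point near the arc but off it is mapped into \<open>J\<close>.
  So \<open>f\<close> can leave \<open>\<Delta>\<close> only through the remaining boundary arc, and collapsing the outside of \<open>\<Delta>\<close> onto that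
  arc turns \<open>f\<close> into a continuous self-map of \<open>\<Delta>\<close>. Brouwer's theorem gives a fixed point of the self-map, and
  the collapse can be chosen so that it creates none on the arc.
\<close>

section \<open>Brouwer's theorem for Jordan domains\<close>

text \<open>Three obstacles shape the proof. Orientation is defined by homology of the sphere but is
  needed as a winding number. A homeomorphism of the plane has local degree 1 or -1, and one of
  degree -1 is properly homotopic to complex conjugation, which does not act as the identity on the
  second homology group. Injectivity on an open set is known only near w. Further along the arc
  \<open>f\<close> need not be injective off the arc, so no local degree is at hand there; what can
  be followed along the arc is the difference of the winding numbers of two Jordan curves, at a
  point and at its image. Finally, v may lie beyond w. Then the arc near w is not on J, and an
  auxiliary Jordan curve through a longer stretch of the arc has to carry the comparison. Moreover
  the images of the arc from w to v then lie on J, while nothing is known about how \<open>f\<close>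
  maps \<Delta> near their preimages. This is why the boundary arc of the collapse may have to reach
  beyond u.\<close>

lemma compact_subset_connected_compact:
  fixes K T :: "'a::euclidean_space set"
  assumes "compact K" "open T" "connected T" "K \<subseteq> T"
  obtains C where "compact C" "connected C" "K \<subseteq> C" "C \<subseteq> T"
proof (cases "K = {}")
  case True
  then show ?thesis using that[of "{}"] by auto
next
  case False
  then obtain x0 where x0: "x0 \<in> T" using assms by auto
  have "\<exists>r>0. cball x r \<subseteq> T" if "x \<in> K" for x
    using assms that open_contains_cball by blast
  then obtain r where r: "\<And>x. x \<in> K \<Longrightarrow> r x > 0 \<and> cball x (r x) \<subseteq> T" by metis
  obtain F where F: "F \<subseteq> K" "finite F" "K \<subseteq> (\<Union>x\<in>F. ball x (r x))"
  proof (rule compactE_image[OF \<open>compact K\<close>, of K "\<lambda>x. ball x (r x)"])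
    show "K \<subseteq> (\<Union>x\<in>K. ball x (r x))" using r by force
  qed auto
  have "\<exists>p. path p \<and> path_image p \<subseteq> T \<and> pathstart p = x0 \<and> pathfinish p = x" if "x \<in> K" for x
    using assms that x0 connected_open_path_connected[of T] unfolding path_connected_def by blast
  then obtain p where p: "\<And>x. x \<in> K \<Longrightarrow> path (p x) \<and> path_image (p x) \<subseteq> T \<and> pathstart (p x) = x0 \<and> pathfinish (p x) = x"
    by metis
  \<comment> \<open>Paths from one base point to the centres of finitely many closed balls make
    their union connected.\<close>
  let ?C = "\<Union>x\<in>F. path_image (p x) \<union> cball x (r x)"
  show ?thesis
  proof
    show "compact ?C" using F p by (intro compact_UN) (auto intro!: compact_Un)
    have con: "connected (path_image (p x) \<union> cball x (r x))" if "x \<in> F" for x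
    proof (rule connected_Un)
      show "connected (path_image (p x))" using p that F by (auto intro: connected_path_image)
      have "x \<in> path_image (p x)" using p that F by (metis pathfinish_in_path_image subsetD)
      then show "path_image (p x) \<inter> cball x (r x) \<noteq> {}" using r that F
        by (metis IntI centre_in_cball empty_iff less_eq_real_def subsetD)
    qed auto
    have "x0 \<in> path_image (p x) \<union> cball x (r x)" if "x \<in> F" for x
      using p that F by (metis UnI1 pathstart_in_path_image subsetD)
    then have ne: "(\<Inter>x\<in>F. path_image (p x) \<union> cball x (r x)) \<noteq> {}" by blast
    show "connected ?C"
      by (rule connected_Union[OF _ ne]) (use con in blast)
    have "(\<Union>x\<in>F. ball x (r x)) \<subseteq> ?C" by (intro UN_mono) auto
    then show "K \<subseteq> ?C" using F(3) by (rule order_trans[rotated])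
    show "?C \<subseteq> T" using F(1) r p by (intro UN_least Un_least) (meson subsetD)+
  qed
qed

text \<open>The complement of \<open>V\<close> is connected by construction: the points of a large
  disc outside \<open>N\<close> and its bounding circle are joined by a compact connected set inside
  \<open>- S\<close>, and the exterior of the disc is added. A component of the complement of this
  closed connected set is bounded and has connected complement, so it is simply connected.\<close>

lemma simply_connected_neighbourhood:
  fixes S N :: "complex set"
  assumes "compact S" "connected S" "S \<noteq> {}" "connected (- S)" "open N" "S \<subseteq> N"
  obtains V where "open V" "simply_connected V" "S \<subseteq> V" "V \<subseteq> N"
proof -
  obtain R where R: "R > 0" "S \<subseteq> ball 0 R"
    using assms(1) compact_imp_bounded bounded_subset_ballD by blast
  let ?K = "(cball 0 R - N) \<union> sphere 0 R"
  have "compact ?K" using assms by (auto intro!: compact_Un compact_diff)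
  moreover have "?K \<subseteq> - S" using R assms by auto
  moreover have "open (- S)" using assms compact_imp_closed by blast
  ultimately obtain C where C: "compact C" "connected C" "?K \<subseteq> C" "C \<subseteq> - S"
    using compact_subset_connected_compact assms by metis
  define C' where "C' = C \<union> - ball 0 R"
  have "connected (- ball (0::complex) R)"
    by (simp add: connected_complement_bounded_convex)
  moreover have "C \<inter> - ball 0 R \<noteq> {}"
  proof -
    have "of_real R \<in> sphere (0::complex) R" using R by auto
    then have "of_real R \<in> C" using C(3) by blast
    moreover have "of_real R \<in> - ball (0::complex) R" by simp
    ultimately show ?thesis by blast
  qed
  ultimately have conC': "connected C'" unfolding C'_def using C connected_Un by blast
  have cloC': "closed C'" unfolding C'_def using C compact_imp_closed by (intro closed_Un) auto
  have SC': "S \<subseteq> - C'" using C R unfolding C'_def by auto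
  have C'N: "- C' \<subseteq> N"
  proof
    fix z assume z: "z \<in> - C'"
    then have "z \<in> cball 0 R" unfolding C'_def by auto
    then show "z \<in> N" using z C(3) unfolding C'_def by blast
  qed
  obtain x where x: "x \<in> S" using assms by auto
  define V where "V = connected_component_set (- C') x"
  have Vcomp: "V \<in> components (- C')" unfolding V_def using x SC' by (auto simp: components_def)
  have SV: "S \<subseteq> V" unfolding V_def using x SC' assms by (simp add: connected_component_maximal)
  have VN: "V \<subseteq> - C'" using Vcomp in_components_subset by blast
  have "open V" using Vcomp cloC' open_components by blast
  have "connected (- V)" using component_complement_connected conC' Vcomp by blast
  moreover have "connected V" using Vcomp in_components_connected by blast
  moreover have "bounded V" using VN unfolding C'_def by (metis Compl_Un bounded_ball bounded_subset double_complement inf_le2)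
  ultimately have "simply_connected V" using simply_connected_iff_simple \<open>open V\<close> by blast
  then show ?thesis using that \<open>open V\<close> SV VN C'N by blast
qed

text \<open>A retract of a neighbourhood is a retract of a smaller simply connected one, which is
  homeomorphic to an open disc. So \<open>S\<close> is a contractible ANR, hence an AR and a retract
  of a ball, where Brouwer's theorem applies.\<close>

lemma brouwer_compact_ANR_plane:
  fixes S :: "complex set"
  assumes "compact S" "connected S" "S \<noteq> {}" "connected (- S)" "ANR S"
    and f: "continuous_on S f" "f ` S \<subseteq> S"
  obtains x where "x \<in> S" "f x = x"
proof -
  obtain N where N: "open N" "S retract_of N"
    using ANR_imp_absolute_neighbourhood_retract_UNIV[OF \<open>ANR S\<close> homeomorphic_refl] assms compact_imp_closed by blast
  then obtain V where V: "open V" "simply_connected V" "S \<subseteq> V" "V \<subseteq> N"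
    using simply_connected_neighbourhood[of S N] assms retract_of_imp_subset by metis
  have SV: "S retract_of V" using N V retract_of_subset by blast
  have "V \<noteq> {}" using V assms by auto
  then have hom: "V homeomorphic ball (0::complex) 1"
    using V simply_connected_eq_homeomorphic_to_disc by blast
  then have "contractible V"
    using homeomorphic_contractible_eq convex_imp_contractible convex_ball by blast
  then have "contractible S" using SV retract_of_contractible by blast
  then have "AR S" using AR_ANR assms by blast
  obtain R where R: "S \<subseteq> cball 0 R" "R > 0"
    using assms(1) compact_imp_bounded bounded_subset_ballD ball_subset_cball by (meson order_trans)
  then have "S retract_of cball 0 R"
    using \<open>AR S\<close> AR_imp_retract assms(1) closed_subset compact_imp_closed by blast
  then obtain r where r: "retraction (cball 0 R) S r" by (auto simp: retract_of_def)
  have "continuous_on (cball 0 R) (f \<circ> r)"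
    using r f unfolding retraction_def
    by (metis continuous_on_compose continuous_on_subset image_subset_iff_funcset)
  moreover have im: "(f \<circ> r) ` cball 0 R \<subseteq> S"
    using r f unfolding retraction_def by fastforce
  ultimately obtain x where x: "x \<in> cball 0 R" "(f \<circ> r) x = x"
    using brouwer_ball[of R 0 "f \<circ> r"] R by blast
  then have "x \<in> S" using im by (metis imageI subsetD)
  then have "r x = x" using r by (simp add: retraction_def)
  then show ?thesis using that[OF \<open>x \<in> S\<close>] x by simp
qed

text \<open>The domain is treated as an ANR rather than as a disc: it and the closure of the outside
  are closed sets with union the plane and intersection the curve, and both of these are
  ANRs.\<close>

lemma brouwer_Jordan_domain:
  fixes \<gamma> :: "real \<Rightarrow> complex"
  assumes "simple_path \<gamma>" "pathfinish \<gamma> = pathstart \<gamma>"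
  defines "S \<equiv> path_image \<gamma> \<union> inside (path_image \<gamma>)"
  assumes f: "continuous_on S f" "f ` S \<subseteq> S"
  obtains x where "x \<in> S" "f x = x"
proof -
  let ?J = "path_image \<gamma>"
  note J = Jordan_inside_outside[OF assms(1,2)]
  have clo: "closed S" unfolding S_def
    using assms(1) closed_path_image_Un_inside simple_path_imp_path by blast
  have S_out: "S = - outside ?J" unfolding S_def
    by (metis Un_commute Compl_Un outside_inside union_with_inside)
  have "connected S"
  proof -
    have "S = closure (inside ?J)" using J unfolding S_def
      by (metis closure_Un_frontier sup_commute)
    then show ?thesis using J connected_imp_connected_closure by metis
  qed
  moreover have "compact S" unfolding S_def using assms(1) clo S_def J compact_eq_bounded_closed
    by (metis bounded_Un bounded_simple_path_image)
  moreover have "S \<noteq> {}" unfolding S_def by simp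
  moreover have "connected (- S)" using S_out J by simp
  moreover have "ANR S"
  proof (rule ANR_from_Un_Int)
    show "closed S" by fact
    show "closed (?J \<union> outside ?J)" using assms(1)
      using J by (metis closure_Un_frontier closed_closure sup_commute)
    have "S \<union> (?J \<union> outside ?J) = UNIV" using S_out by auto
    then show "ANR (S \<union> (?J \<union> outside ?J))" by simp
    have eq: "S \<inter> (?J \<union> outside ?J) = ?J" unfolding S_def
      using inside_Int_outside[of ?J] outside_no_overlap[of ?J] by blast
    have "ANR (sphere (0::complex) 1)" by (rule ANR_sphere)
    then show "ANR (S \<inter> (?J \<union> outside ?J))" unfolding eq
      using homeomorphic_ANR_iff_ANR homeomorphic_simple_path_image_circle assms(1,2) zero_less_one by metis
  qed
  ultimately show ?thesis using brouwer_compact_ANR_plane f that by metis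
qed

section \<open>Local degree\<close>

lemma continuous_Ints_constant:
  fixes f :: "'a::topological_space \<Rightarrow> complex"
  assumes "connected S" "continuous_on S f" "\<And>x. x \<in> S \<Longrightarrow> f x \<in> \<int>"
  shows "f constant_on S"
proof (rule continuous_discrete_range_constant[OF assms(1,2)])
  fix x assume x: "x \<in> S"
  have "1 \<le> norm (f y - f x)" if y: "y \<in> S" "f y \<noteq> f x" for y
  proof -
    obtain a b :: int where ab: "f y = of_int a" "f x = of_int b"
      using assms(3) x y by (metis Ints_cases)
    then have "f y - f x = of_int (a - b)" by simp
    moreover have "a \<noteq> b" using ab y by auto
    then have "1 \<le> \<bar>a - b\<bar>" by simp
    ultimately show ?thesis by (metis norm_of_int of_int_1_le_iff of_int_abs)
  qed
  then show "\<exists>e>0. \<forall>y. y \<in> S \<and> f y \<noteq> f x \<longrightarrow> e \<le> norm (f y - f x)"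
    by (metis zero_less_one)
qed

lemma exp_eq_Ints:
  fixes w z :: complex
  assumes "exp w = exp z"
  shows "(w - z) / (2 * of_real pi * \<i>) \<in> \<int>"
proof -
  obtain n :: int where "w = z + (of_int (2 * n) * pi) * \<i>" using assms exp_eq by blast
  then have "(w - z) / (2 * of_real pi * \<i>) = of_int n" by (simp add: field_simps)
  then show ?thesis by simp
qed

text \<open>Two logarithms of the same path differ continuously by integer multiples of 2 pi i,
  hence by a constant, so each of them computes the winding number.\<close>

lemma winding_number_exp_lift:
  assumes q: "path q" and p: "\<And>t. t \<in> {0..1} \<Longrightarrow> p t = \<zeta> + exp (q t)"
  shows "winding_number p \<zeta> = (q 1 - q 0) / (2 * of_real pi * \<i>)"
proof -
  have cont: "continuous_on {0..1} (\<lambda>t. \<zeta> + exp (q t))"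
    using q unfolding path_def by (intro continuous_intros)
  then have "path p" unfolding path_def using p continuous_on_cong[of "{0..1}" "{0..1}" p "\<lambda>t. \<zeta> + exp (q t)"] by simp
  moreover have "\<zeta> \<notin> path_image p" unfolding path_image_def using p by auto
  ultimately obtain q' where q': "path q'"
      "pathfinish q' - pathstart q' = 2 * of_real pi * \<i> * winding_number p \<zeta>"
      "\<And>t. t \<in> {0..1} \<Longrightarrow> p t = \<zeta> + exp (q' t)"
    using winding_number_as_continuous_log by metis
  have "(\<lambda>t. (q t - q' t) / (2 * of_real pi * \<i>)) constant_on {0..1}"
  proof (rule continuous_Ints_constant)
    show "continuous_on {0..1} (\<lambda>t. (q t - q' t) / (2 * of_real pi * \<i>))"
      using q q'(1) unfolding path_def by (intro continuous_intros) auto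
  qed (use p q'(3) in \<open>auto intro!: exp_eq_Ints\<close>)
  then have "(q 1 - q' 1) / (2 * of_real pi * \<i>) = (q 0 - q' 0) / (2 * of_real pi * \<i>)"
    unfolding constant_on_def by force
  then have "q 1 - q' 1 = q 0 - q' 0" by simp
  then have "q 1 - q 0 = 2 * of_real pi * \<i> * winding_number p \<zeta>"
    using q'(2) by (simp add: pathfinish_def pathstart_def algebra_simps)
  then show ?thesis by simp
qed

lemma exp_add_2pi_int: "exp (\<zeta> + 2 * of_real pi * \<i> * of_int k) = exp \<zeta>"
  by (metis exp_plus_2pin mult.commute mult.left_commute mult.assoc of_int_mult of_int_numeral)

text \<open>The integer \<open>m\<close> is the local degree of \<open>f\<close> at \<open>p\<close>: lifting both sides through
  \<open>\<zeta> \<mapsto> p + exp \<zeta>\<close> turns one turn around \<open>p\<close> into \<open>m\<close> turns around \<open>f p\<close>.\<close>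

lemma punctured_lift:
  fixes f :: "complex \<Rightarrow> complex"
  assumes H: "convex H" "\<And>\<zeta> s. \<zeta> \<in> H \<Longrightarrow> \<zeta> + of_real s * \<i> \<in> H"
    and f: "continuous_on ((\<lambda>\<zeta>. p + exp \<zeta>) ` H) f" "\<And>\<zeta>. \<zeta> \<in> H \<Longrightarrow> f (p + exp \<zeta>) \<noteq> f p"
  shows "\<exists>Q m. continuous_on H Q \<and> (\<forall>\<zeta>\<in>H. f (p + exp \<zeta>) = f p + exp (Q \<zeta>)) \<and>
    (\<forall>\<zeta>\<in>H. \<forall>k::int. Q (\<zeta> + 2 * of_real pi * \<i> * of_int k) = Q \<zeta> + 2 * of_real pi * \<i> * of_int (k * m)) \<and>
    (\<forall>r>0. of_real (ln r) \<in> H \<longrightarrow> winding_number (f \<circ> circlepath p r) (f p) = of_int m)"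
proof -
  have "continuous_on H (\<lambda>\<zeta>. f (p + exp \<zeta>))"
    by (rule continuous_on_compose2[OF f(1)]) (auto intro!: continuous_intros)
  then have "continuous_on H (\<lambda>\<zeta>. f (p + exp \<zeta>) - f p)" by (intro continuous_intros)
  then obtain Q where Q: "continuous_on H Q" "\<And>\<zeta>. \<zeta> \<in> H \<Longrightarrow> f (p + exp \<zeta>) - f p = exp (Q \<zeta>)"
    using continuous_logarithm_on_contractible convex_imp_contractible[OF H(1)] f(2)
    by (metis (no_types, lifting) right_minus_eq)
  then have Qeq: "\<And>\<zeta>. \<zeta> \<in> H \<Longrightarrow> f (p + exp \<zeta>) = f p + exp (Q \<zeta>)"
    by (metis add.commute diff_add_cancel)
  have shift: "\<zeta> + 2 * of_real pi * \<i> * of_int k \<in> H" if "\<zeta> \<in> H" for \<zeta> k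
    using H(2)[OF that, of "2 * pi * of_int k"] by (simp add: mult_ac)
  \<comment> \<open>The increment of \<open>Q\<close> over one turn is continuous and integral in
    units of 2 pi i, hence the same everywhere on the connected set \<open>H\<close>. This common
    value is \<open>m\<close>.\<close>
  have "(\<lambda>\<zeta>. (Q (\<zeta> + 2 * of_real pi * \<i>) - Q \<zeta>) / (2 * of_real pi * \<i>)) constant_on H"
  proof (rule continuous_Ints_constant)
    show "connected H" using H convex_connected by blast
    show "continuous_on H (\<lambda>\<zeta>. (Q (\<zeta> + 2 * of_real pi * \<i>) - Q \<zeta>) / (2 * of_real pi * \<i>))"
      using shift[of _ 1] by (intro continuous_intros continuous_on_compose2[OF Q(1)] Q(1)) auto
    show "(Q (\<zeta> + 2 * of_real pi * \<i>) - Q \<zeta>) / (2 * of_real pi * \<i>) \<in> \<int>" if "\<zeta> \<in> H" for \<zeta>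
    proof (rule exp_eq_Ints)
      show "exp (Q (\<zeta> + 2 * of_real pi * \<i>)) = exp (Q \<zeta>)"
        using Q(2)[OF that] Q(2)[OF shift[OF that, of 1]] exp_add_2pi_int[of \<zeta> 1] by simp
    qed
  qed
  then obtain c where c: "\<And>\<zeta>. \<zeta> \<in> H \<Longrightarrow> (Q (\<zeta> + 2 * of_real pi * \<i>) - Q \<zeta>) / (2 * of_real pi * \<i>) = c"
    unfolding constant_on_def by blast
  have "\<exists>m::int. \<forall>\<zeta>\<in>H. Q (\<zeta> + 2 * of_real pi * \<i>) = Q \<zeta> + 2 * of_real pi * \<i> * of_int m"
  proof (cases "H = {}")
    case False
    then obtain \<zeta>0 where z0: "\<zeta>0 \<in> H" by auto
    have "exp (Q (\<zeta>0 + 2 * of_real pi * \<i>)) = exp (Q \<zeta>0)"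
      using Q(2)[OF z0] Q(2)[OF shift[OF z0, of 1]] exp_add_2pi_int[of \<zeta>0 1] by simp
    then have "c \<in> \<int>" using c[OF z0] exp_eq_Ints by metis
    then obtain m where "c = of_int m" by (metis Ints_cases)
    then show ?thesis using c by (intro exI[of _ m]) (auto simp: field_simps)
  qed auto
  then obtain m :: int where m: "\<And>\<zeta>. \<zeta> \<in> H \<Longrightarrow> Q (\<zeta> + 2 * of_real pi * \<i>) = Q \<zeta> + 2 * of_real pi * \<i> * of_int m"
    by blast
  have mk: "Q (\<zeta> + 2 * of_real pi * \<i> * of_int k) = Q \<zeta> + 2 * of_real pi * \<i> * of_int (k * m)"
    if z: "\<zeta> \<in> H" for \<zeta> k
  proof (induction k rule: int_induct[where k = 0])
    case base
    show ?case by simp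
  next
    case (step1 i)
    show ?case using m[OF shift[OF z, of i]] step1 by (simp add: algebra_simps)
  next
    case (step2 i)
    show ?case using m[OF shift[OF z, of "i - 1"]] step2 by (simp add: algebra_simps)
  qed
  have wn: "winding_number (f \<circ> circlepath p r) (f p) = of_int m" if r: "r > 0" "of_real (ln r) \<in> H" for r
  proof -
    \<comment> \<open>The vertical segment above \<open>ln r\<close> consists of logarithms of one
      turn on the circle of radius \<open>r\<close>.\<close>
    define q where "q = (\<lambda>t::real. Q (of_real (ln r) + 2 * of_real pi * \<i> * of_real t))"
    have inH: "of_real (ln r) + 2 * of_real pi * \<i> * of_real t \<in> H" for t :: real
      using H(2)[OF r(2), of "2 * pi * t"] by (simp add: mult_ac)
    have "path q" unfolding path_def q_def
      by (intro continuous_on_compose2[OF Q(1)] continuous_intros) (use inH in auto)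
    moreover have "(f \<circ> circlepath p r) t = f p + exp (q t)" for t
    proof -
      have "exp (of_real (ln r) + 2 * of_real pi * \<i> * of_real t) = of_real r * exp (2 * of_real pi * \<i> * of_real t)"
        using r(1) by (simp add: exp_add exp_of_real)
      then show ?thesis using Qeq[OF inH[of t]] by (simp add: circlepath q_def)
    qed
    ultimately have "winding_number (f \<circ> circlepath p r) (f p) = (q 1 - q 0) / (2 * of_real pi * \<i>)"
      using winding_number_exp_lift by blast
    also have "\<dots> = of_int m" using m[OF r(2)] by (simp add: q_def)
    finally show ?thesis .
  qed
  show ?thesis using Q(1) Qeq mk wn by blast
qed

text \<open>The half-plane \<open>H\<close> consists of the logarithms of the points of the
  punctured ball, translated to 0.\<close>

lemma punctured_ball_lift:
  fixes f :: "complex \<Rightarrow> complex"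
  assumes "continuous_on (ball p R) f" "\<And>z. z \<in> ball p R \<Longrightarrow> z \<noteq> p \<Longrightarrow> f z \<noteq> f p" "R > 0"
  defines "H \<equiv> {\<zeta>. Re \<zeta> < ln R}"
  shows "\<exists>Q m. continuous_on H Q \<and> (\<forall>\<zeta>\<in>H. f (p + exp \<zeta>) = f p + exp (Q \<zeta>)) \<and>
    (\<forall>\<zeta>\<in>H. \<forall>k::int. Q (\<zeta> + 2 * of_real pi * \<i> * of_int k) = Q \<zeta> + 2 * of_real pi * \<i> * of_int (k * m)) \<and>
    (\<forall>r. 0 < r \<and> r < R \<longrightarrow> winding_number (f \<circ> circlepath p r) (f p) = of_int m)"
proof -
  have "exp (Re \<zeta>) < R" if "\<zeta> \<in> H" for \<zeta>
    using that \<open>R > 0\<close> unfolding H_def by (metis mem_Collect_eq exp_less_mono exp_ln)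
  then have inb: "p + exp \<zeta> \<in> ball p R" if "\<zeta> \<in> H" for \<zeta>
    using that by (simp add: dist_norm)
  have h1: "convex H" unfolding H_def by (rule convex_halfspace_Re_lt)
  have h2: "\<And>\<zeta> s. \<zeta> \<in> H \<Longrightarrow> \<zeta> + of_real s * \<i> \<in> H" by (simp add: H_def)
  have h3: "continuous_on ((\<lambda>\<zeta>. p + exp \<zeta>) ` H) f"
    using assms(1) inb by (auto intro: continuous_on_subset)
  have h4: "\<And>\<zeta>. \<zeta> \<in> H \<Longrightarrow> f (p + exp \<zeta>) \<noteq> f p"
    using assms(2) inb by simp
  have "of_real (ln r) \<in> H" if "0 < r" "r < R" for r using that by (simp add: H_def)
  then show ?thesis using punctured_lift[OF h1 h2 h3 h4] by meson
qed

text \<open>A loop lifts to a path \<open>q\<close> whose ends differ by its winding number in units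
  of 2 pi i. As the local degree is 1, \<open>Q\<close> preserves this difference.\<close>

lemma winding_number_compose_loop:
  fixes f :: "complex \<Rightarrow> complex"
  assumes f: "continuous_on (ball p R) f" "\<And>z. z \<in> ball p R \<Longrightarrow> z \<noteq> p \<Longrightarrow> f z \<noteq> f p"
    and r: "0 < r" "r < R" "winding_number (f \<circ> circlepath p r) (f p) = 1"
    and \<gamma>: "path \<gamma>" "pathfinish \<gamma> = pathstart \<gamma>" "path_image \<gamma> \<subseteq> ball p R - {p}"
  shows "winding_number (f \<circ> \<gamma>) (f p) = winding_number \<gamma> p"
proof -
  have "R > 0" using r by simp
  obtain Q m where Q: "continuous_on {\<zeta>. Re \<zeta> < ln R} Q"
    "\<And>\<zeta>. \<zeta> \<in> {\<zeta>. Re \<zeta> < ln R} \<Longrightarrow> f (p + exp \<zeta>) = f p + exp (Q \<zeta>)"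
    "\<And>\<zeta> k. \<zeta> \<in> {\<zeta>. Re \<zeta> < ln R} \<Longrightarrow> Q (\<zeta> + 2 * of_real pi * \<i> * of_int k) = Q \<zeta> + 2 * of_real pi * \<i> * of_int (k * m)"
    "\<And>r. \<lbrakk>0 < r; r < R\<rbrakk> \<Longrightarrow> winding_number (f \<circ> circlepath p r) (f p) = of_int m"
    using punctured_ball_lift[OF f \<open>R > 0\<close>] by blast
  have "m = 1" using Q(4)[OF r(1,2)] r(3) by (metis of_int_1 of_int_eq_iff)
  have "p \<notin> path_image \<gamma>" using \<gamma> by auto
  then obtain q where q: "path q" "pathfinish q - pathstart q = 2 * of_real pi * \<i> * winding_number \<gamma> p"
    "\<And>t. t \<in> {0..1} \<Longrightarrow> \<gamma> t = p + exp (q t)"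
    using winding_number_as_continuous_log[OF \<gamma>(1)] by metis
  obtain k where k: "winding_number \<gamma> p = of_int k"
    using integer_winding_number[OF \<gamma>(1,2) \<open>p \<notin> path_image \<gamma>\<close>] by (metis Ints_cases)
  have q01: "q 1 = q 0 + 2 * of_real pi * \<i> * of_int k"
    using q(2) k by (simp add: pathfinish_def pathstart_def algebra_simps)
  have Re_q: "Re (q t) < ln R" if t: "t \<in> {0..1}" for t
  proof -
    have "\<gamma> t \<in> ball p R" using \<gamma>(3) t unfolding path_image_def by blast
    then have "exp (Re (q t)) < R" using q(3)[OF t] by (simp add: dist_norm)
    then show ?thesis using \<open>R > 0\<close> by (metis exp_gt_zero ln_exp ln_less_cancel_iff)
  qed
  have "path (Q \<circ> q)" unfolding path_def
    by (rule continuous_on_compose) (use q(1) Re_q in \<open>auto simp: path_def intro: continuous_on_subset[OF Q(1)]\<close>)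
  moreover have "(f \<circ> \<gamma>) t = f p + exp ((Q \<circ> q) t)" if "t \<in> {0..1}" for t
    using q(3)[OF that] Q(2)[of "q t"] Re_q[OF that] by simp
  ultimately have "winding_number (f \<circ> \<gamma>) (f p) = ((Q \<circ> q) 1 - (Q \<circ> q) 0) / (2 * of_real pi * \<i>)"
    using winding_number_exp_lift by blast
  also have "\<dots> = of_int k" using Q(3)[of "q 0" k] Re_q[of 0] q01 \<open>m = 1\<close> by simp
  finally show ?thesis using k by simp
qed

text \<open>The larger closed ball is compact in the open set \<open>U\<close>, so a slightly larger
  open ball still fits, and a single lift over it serves both radii.\<close>

lemma local_degree_radius_independent:
  fixes f :: "complex \<Rightarrow> complex"
  assumes f: "continuous_on U f" "inj_on f U" and U: "open U"
    and r: "0 < r" "cball p r \<subseteq> U" and s: "0 < s" "cball p s \<subseteq> U"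
  shows "winding_number (f \<circ> circlepath p r) (f p) = winding_number (f \<circ> circlepath p s) (f p)"
proof -
  define t where "t = max r s"
  have t: "t > 0" "cball p t \<subseteq> U" "r \<le> t" "s \<le> t" unfolding t_def using r s by (auto simp: max_def)
  obtain e where e: "e > 0" "(\<Union>x\<in>cball p t. ball x e) \<subseteq> U"
    using compact_subset_open_imp_ball_epsilon_subset[of "cball p t" U] t U by auto
  have sub: "ball p (t + e) \<subseteq> U"
  proof
    fix z assume z: "z \<in> ball p (t + e)"
    show "z \<in> U"
    proof (cases "dist p z \<le> t")
      case True then show ?thesis using t by auto
    next
      case False
      \<comment> \<open>The point at distance \<open>t\<close> from \<open>p\<close> on the ray
        towards \<open>z\<close>, hence the point of the closed ball nearest to
        \<open>z\<close>.\<close>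
      define x where "x = p + (t / dist p z) *\<^sub>R (z - p)"
      have "dist p z > 0" using False t by linarith
      have "dist p x = t" using t \<open>dist p z > 0\<close> by (simp add: x_def dist_norm norm_minus_commute)
      moreover have "dist x z = dist p z - t"
      proof -
        have "z - x = (1 - t / dist p z) *\<^sub>R (z - p)" by (simp add: x_def algebra_simps)
        then have "norm (z - x) = \<bar>1 - t / dist p z\<bar> * norm (z - p)" by (metis norm_scaleR)
        moreover have "1 - t / dist p z \<ge> 0" using False \<open>dist p z > 0\<close> by simp
        ultimately have "dist x z = (1 - t / dist p z) * dist p z"
          by (simp add: dist_norm norm_minus_commute)
        then show ?thesis using \<open>dist p z > 0\<close> by (simp add: algebra_simps)
      qed
      ultimately have "x \<in> cball p t" "z \<in> ball x e" using z by auto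
      then show ?thesis using e(2) by blast
    qed
  qed
  have h1: "continuous_on (ball p (t + e)) f" using f sub continuous_on_subset by blast
  have h2: "\<And>z. z \<in> ball p (t + e) \<Longrightarrow> z \<noteq> p \<Longrightarrow> f z \<noteq> f p"
    using f(2) sub t(1) \<open>e > 0\<close> by (metis add_pos_pos centre_in_ball inj_on_def subsetD)
  have h3: "t + e > 0" using t e by simp
  obtain m :: int where "\<And>r. \<lbrakk>0 < r; r < t + e\<rbrakk> \<Longrightarrow> winding_number (f \<circ> circlepath p r) (f p) = of_int m"
    using punctured_ball_lift[OF h1 h2 h3] by blast
  then show ?thesis using r s t e by simp
qed

text \<open>Move the centre along a short segment with circles of fixed radius around it. By
  injectivity the image of a circle never meets the image of its centre, so the image loops,
  translated to 0, are homotopic in the punctured plane.\<close>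

lemma local_degree_constant:
  fixes f :: "complex \<Rightarrow> complex"
  assumes f: "continuous_on U f" "inj_on f U" and U: "open U" "connected U"
    and r: "0 < r" "cball p r \<subseteq> U" and s: "0 < s" "cball q s \<subseteq> U"
    and deg: "winding_number (f \<circ> circlepath p r) (f p) = 1"
  shows "winding_number (f \<circ> circlepath q s) (f q) = 1"
proof -
  define P where "P = (\<lambda>p. \<forall>r>0. cball p r \<subseteq> U \<longrightarrow> winding_number (f \<circ> circlepath p r) (f p) = 1)"
  have PI: "P x" if "r > 0" "cball x r \<subseteq> U" "winding_number (f \<circ> circlepath x r) (f x) = 1" for x r
    unfolding P_def using that local_degree_radius_independent[OF f U(1)] by metis
  have "P q"
  proof (rule connected_induction_simple[OF U(2), of p q P])
    show "p \<in> U" "q \<in> U" using r s by auto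
    show "P p" using PI r deg by blast
    fix a assume "a \<in> U"
    then obtain e where e: "e > 0" "ball a e \<subseteq> U" using U(1) open_contains_ball by blast
    define \<rho> where "\<rho> = e / 3"
    have \<rho>: "\<rho> > 0" "ball a (3 * \<rho>) \<subseteq> U" using e by (auto simp: \<rho>_def)
    have key: "P y" if xy: "x \<in> ball a \<rho>" "y \<in> ball a \<rho>" and Px: "P x" for x y
    proof -
      have sub: "cball z \<rho> \<subseteq> U" if "z \<in> ball a \<rho>" for z
      proof
        fix w assume "w \<in> cball z \<rho>"
        then have "dist a w < 3 * \<rho>" using that \<rho>(1) dist_triangle[of a w z] by auto
        then show "w \<in> U" using \<rho> by auto
      qed
      define c where "c = (\<lambda>t::real. (1 - t) *\<^sub>R x + t *\<^sub>R y)"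
      have cin: "c t \<in> ball a \<rho>" if "t \<in> {0..1}" for t
        unfolding c_def using xy that convex_ball[of a \<rho>] by (intro convexD) auto
      define h where "h = (\<lambda>(t, s). f (circlepath (c t) \<rho> s) - f (c t))"
      have hU: "circlepath (c t) \<rho> s \<in> U" "c t \<in> U" "circlepath (c t) \<rho> s \<noteq> c t" if "t \<in> {0..1}" "s \<in> {0..1}" for t s
      proof -
        have "dist (c t) (circlepath (c t) \<rho> s) = \<rho>"
          using \<rho>(1) by (simp add: circlepath dist_norm norm_mult)
        then show "circlepath (c t) \<rho> s \<in> U" "circlepath (c t) \<rho> s \<noteq> c t" "c t \<in> U"
          using sub[OF cin[OF that(1)]] \<rho>(1) by auto
      qed
      have "homotopic_loops (- {0}) (\<lambda>s. f (circlepath x \<rho> s) - f x) (\<lambda>s. f (circlepath y \<rho> s) - f y)"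
        unfolding homotopic_loops
      proof (intro exI[of _ h] conjI ballI)
        have "continuous_on ({0..1} \<times> {0..1}) (\<lambda>z. circlepath (c (fst z)) \<rho> (snd z))"
          unfolding circlepath c_def by (intro continuous_intros)
        moreover have "continuous_on ({0..1} \<times> {0..1}) (\<lambda>z::real\<times>real. c (fst z))"
          unfolding c_def by (intro continuous_intros)
        ultimately show "continuous_on ({0..1} \<times> {0..1}) h"
          unfolding h_def case_prod_unfold
          by (intro continuous_intros continuous_on_compose2[OF f(1)]) (use hU in auto)
        show "h \<in> {0..1} \<times> {0..1} \<rightarrow> - {0}"
        proof
          fix w :: "real \<times> real" assume "w \<in> {0..1} \<times> {0..1}"
          then obtain t s where w: "w = (t, s)" "t \<in> {0..1}" "s \<in> {0..1}" by auto
          then have "f (circlepath (c t) \<rho> s) \<noteq> f (c t)"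
            using hU[OF w(2,3)] inj_onD[OF f(2)] by metis
          then show "h w \<in> - {0}" by (simp add: h_def w(1))
        qed
        show "pathfinish (h \<circ> Pair t) = pathstart (h \<circ> Pair t)" for t
          by (simp add: h_def pathfinish_def pathstart_def circlepath)
      qed (auto simp: h_def c_def)
      then have "winding_number (\<lambda>s. f (circlepath x \<rho> s) - f x) 0 = winding_number (\<lambda>s. f (circlepath y \<rho> s) - f y) 0"
        by (rule winding_number_homotopic_loops)
      then have "winding_number (f \<circ> circlepath x \<rho>) (f x) = winding_number (f \<circ> circlepath y \<rho>) (f y)"
        using winding_number_offset[of "f \<circ> circlepath x \<rho>" "f x"] winding_number_offset[of "f \<circ> circlepath y \<rho>" "f y"]
        by simp
      then show ?thesis using Px sub[OF xy(1)] sub[OF xy(2)] \<rho>(1) PI[of \<rho> y] unfolding P_def by metis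
    qed
    show "\<exists>T. openin (top_of_set U) T \<and> a \<in> T \<and> (\<forall>x\<in>T. \<forall>y\<in>T. P x \<longrightarrow> P y)"
    proof (intro exI[of _ "ball a \<rho>"] conjI)
      have "ball a \<rho> \<subseteq> U" using subset_ball[of \<rho> "3 * \<rho>" a] \<rho> by simp
      then show "openin (top_of_set U) (ball a \<rho>)" by (simp add: U(1) openin_open_eq)
      show "a \<in> ball a \<rho>" using \<rho> by simp
      show "\<forall>x\<in>ball a \<rho>. \<forall>y\<in>ball a \<rho>. P x \<longrightarrow> P y" using key by blast
    qed
  qed
  then show ?thesis using s unfolding P_def by blast
qed

section \<open>The reflection of the sphere\<close>

abbreviation sphere_of :: "'a::topological_space itself \<Rightarrow> 'a option topology" where
  "sphere_of _ \<equiv> Alexandroff_compactification (euclidean :: 'a topology)"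

text \<open>Escape to infinity uniformly in time makes the preimage of a compact set compact, which
  gives continuity at the point at infinity. It is needed for the closed sets of the
  compactification that miss infinity; the others are complements of open sets of the space
  itself.\<close>

lemma Alexandroff_homotopy:
  fixes H :: "real \<times> 'a::euclidean_space \<Rightarrow> 'a"
  assumes contH: "continuous_on ({0..1} \<times> UNIV) H"
    and proper: "\<And>B. \<exists>R. \<forall>t\<in>{0..1}. \<forall>z. norm z > R \<longrightarrow> norm (H (t, z)) > B"
  shows "homotopic_with (\<lambda>_. True) (sphere_of TYPE('a)) (sphere_of TYPE('a))
           (map_option (\<lambda>z. H (0, z))) (map_option (\<lambda>z. H (1, z)))"
proof -
  let ?S = "sphere_of TYPE('a)"
  let ?I = "top_of_set {0..1::real}"
  let ?h = "\<lambda>(t, o'). map_option (\<lambda>z. H (t, z)) o'"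
  let ?j = "\<lambda>(t::real, z::'a). (t, Some z)"
  have Haus: "Hausdorff_space (prod_topology ?I ?S)"
    by (simp add: Hausdorff_space_prod_topology Hausdorff_space_Alexandroff_compactification
        locally_compact_space_euclidean Hausdorff_space_subtopology)
  have "continuous_map (prod_topology ?I ?S) ?S ?h"
    unfolding continuous_map_closedin
  proof (intro conjI allI impI)
    show "?h \<in> topspace (prod_topology ?I ?S) \<rightarrow> topspace ?S"
      by (auto simp: map_option_case split: option.splits)
    fix C assume "closedin ?S C"
    then consider K where "compact K" "C = Some ` K"
      | U where "open U" "C = topspace ?S - Some ` U"
      by (auto simp: closedin_Alexandroff_compactification)
    then show "closedin (prod_topology ?I ?S) {x \<in> topspace (prod_topology ?I ?S). ?h x \<in> C}"
    proof cases
      case 1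
      define L where "L = {x \<in> {0..1} \<times> UNIV. H x \<in> K}"
      have "closed L"
        using continuous_closed_preimage[OF contH closed_Times[OF closed_atLeastAtMost closed_UNIV] compact_imp_closed[OF \<open>compact K\<close>]]
        unfolding L_def by (simp add: vimage_def Int_def)
      obtain B where B: "\<And>z. z \<in> K \<Longrightarrow> norm z \<le> B" using \<open>compact K\<close> compact_imp_bounded bounded_iff by metis
      obtain R where R: "\<forall>t\<in>{0..1}. \<forall>z. norm z > R \<longrightarrow> norm (H (t, z)) > B" using proper by blast
      have "L \<subseteq> {0..1} \<times> cball 0 R"
        unfolding L_def using R B by (auto simp: not_le[symmetric]) (meson linorder_not_less atLeastAtMost_iff)
      then have "L = L \<inter> ({0..1} \<times> cball 0 R)" by blast
      moreover have "compact ({0..1::real} \<times> cball (0::'a) R)" by (intro compact_Times) auto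
      ultimately have "compact L" using \<open>closed L\<close> by (metis closed_Int_compact)
      moreover have "L \<subseteq> {0..1} \<times> UNIV" unfolding L_def by auto
      ultimately have "compactin (prod_topology ?I euclidean) L"
        by (simp add: prod_topology_subtopology compactin_subtopology)
      moreover have "continuous_map (prod_topology ?I euclidean) (prod_topology ?I ?S) ?j"
        by (intro continuous_map_prod_top[THEN iffD2]) (auto simp: continuous_map_Some)
      ultimately have cpt: "compactin (prod_topology ?I ?S) (?j ` L)"
        using image_compactin by blast
      have eq: "?j ` L = {x \<in> topspace (prod_topology ?I ?S). ?h x \<in> C}"
        unfolding L_def 1 by force
      show ?thesis using compactin_imp_closedin[OF Haus cpt] unfolding eq .
    next
      case 2
      define W where "W = {x \<in> {0..1} \<times> UNIV. H x \<in> U}"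
      have W: "openin (prod_topology ?I euclidean) W"
        using continuous_openin_preimage_gen[OF contH \<open>open U\<close>] unfolding W_def
        by (simp add: prod_topology_subtopology vimage_def Int_def)
      have opW: "openin (prod_topology ?I ?S) (?j ` W)"
        unfolding openin_prod_topology_alt
      proof (intro allI impI)
        fix t o' assume "(t, o') \<in> ?j ` W"
        then obtain z where z: "o' = Some z" "(t, z) \<in> W" by auto
        then obtain A B where AB: "openin ?I A" "openin euclidean B" "t \<in> A" "z \<in> B" "A \<times> B \<subseteq> W"
          using W unfolding openin_prod_topology_alt by metis
        have "A \<times> Some ` B \<subseteq> ?j ` W" using AB(5) by force
        then show "\<exists>U V. openin ?I U \<and> openin ?S V \<and> t \<in> U \<and> o' \<in> V \<and> U \<times> V \<subseteq> ?j ` W"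
          using AB z by (intro exI[of _ A] exI[of _ "Some ` B"]) auto
      qed
      have eq: "{x \<in> topspace (prod_topology ?I ?S). ?h x \<in> C} = topspace (prod_topology ?I ?S) - ?j ` W"
        unfolding 2 W_def by (auto simp: map_option_case image_iff split: option.splits)
      show ?thesis unfolding eq by (rule closedin_diff[OF closedin_topspace opW])
    qed
  qed
  then show ?thesis unfolding homotopic_with_def by (intro exI[of _ ?h]) auto
qed

lemma continuous_map_Alexandroff_real:
  fixes \<phi> :: "'a::euclidean_space option \<Rightarrow> real"
  assumes cont: "continuous_on UNIV (\<lambda>z. \<phi> (Some z))"
    and lim: "((\<lambda>z. \<phi> (Some z)) \<longlongrightarrow> \<phi> None) at_infinity"
  shows "continuous_map (sphere_of TYPE('a)) euclideanreal \<phi>"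
  unfolding continuous_map_def
proof (intro conjI allI impI)
  fix V :: "real set" assume "openin euclidean V"
  then have V: "open V" by simp
  have op: "open {z. \<phi> (Some z) \<in> V}"
    using continuous_open_preimage[OF cont open_UNIV V] by (simp add: vimage_def)
  show "openin (sphere_of TYPE('a)) {x \<in> topspace (sphere_of TYPE('a)). \<phi> x \<in> V}"
  proof (cases "\<phi> None \<in> V")
    case False
    then have "{x \<in> topspace (sphere_of TYPE('a)). \<phi> x \<in> V} = Some ` {z. \<phi> (Some z) \<in> V}"
      by auto
    then show ?thesis using op by simp
  next
    case True
    then have "eventually (\<lambda>z. \<phi> (Some z) \<in> V) at_infinity"
      using lim V topological_tendstoD by blast
    then obtain b where b: "\<And>z. b \<le> norm z \<Longrightarrow> \<phi> (Some z) \<in> V" by (auto simp: eventually_at_infinity)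
    define K where "K = - {z. \<phi> (Some z) \<in> V}"
    have "K \<subseteq> cball 0 b" unfolding K_def using b by (auto simp: not_le[symmetric])
    then have "compact K" using op unfolding K_def
      by (meson bounded_cball bounded_subset closed_Compl compact_eq_bounded_closed)
    moreover have "{x \<in> topspace (sphere_of TYPE('a)). \<phi> x \<in> V} = insert None (Some ` (UNIV - K))"
      using True unfolding K_def by (auto simp: image_iff)
    ultimately show ?thesis unfolding openin_Alexandroff_compactification
      by (auto simp: compact_imp_closed)
  qed
qed simp

definition plane_reflection :: "plane \<Rightarrow> plane" where
  "plane_reflection z = vector [- z $ 1, z $ 2]"

text \<open>Inverse stereographic projection, with infinity sent to the pole where coordinate 2
  equals 1. The points of \<open>nsphere 2\<close> are sequences supported on 0, 1, 2, and the first
  coordinate of the plane becomes coordinate 0, the one that the standard reflection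
  negates.\<close>

definition stereographic :: "plane option \<Rightarrow> nat \<Rightarrow> real" where
  "stereographic w = (case w of
     None \<Rightarrow> (\<lambda>i. if i = 2 then 1 else 0)
   | Some z \<Rightarrow> (\<lambda>i. if i = 0 then 2 * z $ 1 / (1 + (norm z)\<^sup>2) else if i = 1 then 2 * z $ 2 / (1 + (norm z)\<^sup>2)
                     else if i = 2 then 1 - 2 / (1 + (norm z)\<^sup>2) else 0))"

lemma norm_plane: "(norm (z :: plane))\<^sup>2 = (z $ 1)\<^sup>2 + (z $ 2)\<^sup>2"
  unfolding power2_norm_eq_inner by (simp add: inner_vec_def sum_2 power2_eq_square)

lemma topspace_nsphere_2: "topspace (nsphere 2) = {x. (x 0)\<^sup>2 + (x 1)\<^sup>2 + (x 2)\<^sup>2 = 1 \<and> (\<forall>i>2. x i = 0)}"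
  by (auto simp: nsphere numeral_2_eq_2)

text \<open>A continuous bijection from a compact space to a Hausdorff space. It is continuous at
  infinity because each coordinate eventually differs from that of the pole by at most
  \<open>2 * inverse (norm z)\<close>.\<close>

lemma homeomorphic_map_stereographic:
  "homeomorphic_map (sphere_of TYPE(plane)) (nsphere 2) stereographic"
proof (rule continuous_imp_homeomorphic_map)
  have pos: "1 + (norm z)\<^sup>2 > 0" for z :: plane by (simp add: add_pos_nonneg)
  have lim0: "((\<lambda>z::plane. 2 / (1 + (norm z)\<^sup>2)) \<longlongrightarrow> 0) at_infinity"
  proof (rule Lim_null_comparison)
    have "norm (2 / (1 + (norm z)\<^sup>2)) \<le> 2 * inverse (norm z)" if "norm z \<ge> 1" for z :: plane
    proof -
      have "norm z \<le> 1 + (norm z)\<^sup>2" using that by (smt (verit) power2_eq_square mult_le_cancel_left1 one_power2)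
      moreover have "norm z > 0" using that by linarith
      ultimately show ?thesis using pos[of z] by (simp add: divide_simps)
    qed
    then show "\<forall>\<^sub>F z::plane in at_infinity. norm (2 / (1 + (norm z)\<^sup>2)) \<le> 2 * inverse (norm z)"
      by (auto simp: eventually_at_infinity)
    have "((\<lambda>z::plane. inverse (norm z)) \<longlongrightarrow> 0) at_infinity"
      by (rule tendsto_inverse_0_at_top[OF filterlim_at_infinity_imp_norm_at_top[OF filterlim_ident]])
    then show "((\<lambda>z::plane. 2 * inverse (norm z)) \<longlongrightarrow> 0) at_infinity"
      using tendsto_mult_right_zero by blast
  qed
  have limc: "((\<lambda>z::plane. 2 * z $ i / (1 + (norm z)\<^sup>2)) \<longlongrightarrow> 0) at_infinity" for i
  proof (rule Lim_null_comparison)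
    have "norm (2 * z $ i / (1 + (norm z)\<^sup>2)) \<le> 2 * inverse (norm z)" if "norm z \<ge> 1" for z :: plane
    proof -
      have "\<bar>z $ i\<bar> * norm z \<le> norm z * norm z" by (intro mult_right_mono component_le_norm_cart) auto
      then have "\<bar>z $ i\<bar> * norm z \<le> 1 + (norm z)\<^sup>2" by (simp add: power2_eq_square)
      moreover have "norm z > 0" using that by linarith
      ultimately show ?thesis using pos[of z] by (simp add: divide_simps abs_mult)
    qed
    then show "\<forall>\<^sub>F z::plane in at_infinity. norm (2 * z $ i / (1 + (norm z)\<^sup>2)) \<le> 2 * inverse (norm z)"
      by (auto simp: eventually_at_infinity)
    have "((\<lambda>z::plane. inverse (norm z)) \<longlongrightarrow> 0) at_infinity"
      by (rule tendsto_inverse_0_at_top[OF filterlim_at_infinity_imp_norm_at_top[OF filterlim_ident]])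
    then show "((\<lambda>z::plane. 2 * inverse (norm z)) \<longlongrightarrow> 0) at_infinity"
      using tendsto_mult_right_zero by blast
  qed
  have cont: "continuous_on UNIV (\<lambda>z::plane. 2 * z $ i / (1 + (norm z)\<^sup>2))"
       "continuous_on UNIV (\<lambda>z::plane. 1 - 2 / (1 + (norm z)\<^sup>2))" for i
    using pos by (auto intro!: continuous_intros simp: less_imp_neq[symmetric])
  have im: "stereographic w \<in> topspace (nsphere 2)" for w
  proof (cases w)
    case None
    then show ?thesis by (simp add: topspace_nsphere_2 stereographic_def)
  next
    case (Some z)
    define N where "N = 1 + (norm z)\<^sup>2"
    have "N > 0" using pos N_def by simp
    have eq: "(z $ 1)\<^sup>2 + (z $ 2)\<^sup>2 = N - 1" by (simp add: N_def norm_plane)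
    have "(2 * z $ 1 / N)\<^sup>2 + (2 * z $ 2 / N)\<^sup>2 + (1 - 2 / N)\<^sup>2 = (4 * ((z $ 1)\<^sup>2 + (z $ 2)\<^sup>2) + (N - 2)\<^sup>2) / N\<^sup>2"
      using \<open>N > 0\<close> by (simp add: field_simps power2_eq_square)
    also have "\<dots> = 1" unfolding eq using \<open>N > 0\<close> by (simp add: field_simps power2_eq_square)
    finally show ?thesis using Some by (simp add: topspace_nsphere_2 stereographic_def N_def)
  qed
  have "continuous_map (sphere_of TYPE(plane)) euclideanreal (\<lambda>w. stereographic w i)" for i
  proof (rule continuous_map_Alexandroff_real)
    show "continuous_on UNIV (\<lambda>z. stereographic (Some z) i)"
      by (cases "i = 0"; cases "i = 1"; cases "i = 2") (auto simp: stereographic_def cont)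
    have "((\<lambda>z::plane. 1 - 2 / (1 + (norm z)\<^sup>2)) \<longlongrightarrow> 1 - 0) at_infinity"
      by (intro tendsto_diff lim0 tendsto_const)
    then show "((\<lambda>z. stereographic (Some z) i) \<longlongrightarrow> stereographic None i) at_infinity"
      by (cases "i = 0"; cases "i = 1"; cases "i = 2") (auto simp: stereographic_def limc)
  qed
  then show "continuous_map (sphere_of TYPE(plane)) (nsphere 2) stereographic"
    using im unfolding nsphere continuous_map_in_subtopology continuous_map_componentwise_UNIV
    by (auto simp: nsphere)
  show "compact_space (sphere_of TYPE(plane))" by simp
  show "Hausdorff_space (nsphere 2)" 
    unfolding nsphere by (intro Hausdorff_space_subtopology) (simp add: Hausdorff_space_product_topology)
  \<comment> \<open>Projection from the pole back to the plane; on the sphere \<open>x 2 = 1\<close>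
    holds at the pole only.\<close>
  define \<tau> :: "(nat \<Rightarrow> real) \<Rightarrow> plane option" where
    "\<tau> = (\<lambda>x. if x 2 = 1 then None else Some (vector [x 0 / (1 - x 2), x 1 / (1 - x 2)]))"
  have \<tau>\<sigma>: "\<tau> (stereographic w) = w" for w
  proof (cases w)
    case (Some z)
    have "vector [z $ 1, z $ 2] = z" by (simp add: vec_eq_iff forall_2 vector_2)
    then show ?thesis using Some pos[of z] by (simp add: \<tau>_def stereographic_def)
  qed (simp add: \<tau>_def stereographic_def)
  then show "inj_on stereographic (topspace (sphere_of TYPE(plane)))" by (metis inj_onI)
  have \<sigma>\<tau>: "stereographic (\<tau> x) = x" if "x \<in> topspace (nsphere 2)" for x
  proof (cases "x 2 = 1")
    case True
    then have x01: "x 0 = 0" "x 1 = 0" using that by (auto simp: topspace_nsphere_2 sum_power2_eq_zero_iff)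
    show ?thesis
    proof (intro ext)
      fix i :: nat
      consider "i = 0" | "i = 1" | "i = 2" | "i > 2" by linarith
      then show "stereographic (\<tau> x) i = x i"
        using True that x01
        by cases (auto simp: \<tau>_def stereographic_def topspace_nsphere_2)
    qed
  next
    case False
    define s where "s = 1 - x 2"
    have s: "s \<noteq> 0" using False by (simp add: s_def)
    have "(x 0)\<^sup>2 + (x 1)\<^sup>2 = 1 - (1 - s)\<^sup>2" using that by (simp add: topspace_nsphere_2 s_def)
    also have "\<dots> = s * (2 - s)" by (simp add: power2_eq_square algebra_simps)
    finally have *: "(x 0 / s)\<^sup>2 + (x 1 / s)\<^sup>2 = s * (2 - s) / s\<^sup>2" by (simp add: power_divide add_divide_distrib[symmetric])
    have "(norm (vector [x 0 / s, x 1 / s] :: plane))\<^sup>2 = (x 0 / s)\<^sup>2 + (x 1 / s)\<^sup>2"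
      unfolding norm_plane by (simp only: vector_2)
    moreover have "1 + s * (2 - s) / s\<^sup>2 = 2 / s" using s by (simp add: field_simps power2_eq_square)
    ultimately have N: "1 + (norm (vector [x 0 / s, x 1 / s] :: plane))\<^sup>2 = 2 / s"
      using * by metis
    have "stereographic (\<tau> x) i = x i" for i
    proof -
      consider "i = 0" | "i = 1" | "i = 2" | "i > 2" by linarith
      then show ?thesis
      proof cases
        case 1 then show ?thesis using False N s by (simp add: \<tau>_def stereographic_def s_def[symmetric])
      next
        case 2 then show ?thesis using False N s by (simp add: \<tau>_def stereographic_def s_def[symmetric])
      next
        case 3 then show ?thesis using False N s by (simp add: \<tau>_def stereographic_def s_def[symmetric]) (simp add: s_def)
      next
        case 4 then show ?thesis using False that by (simp add: \<tau>_def stereographic_def topspace_nsphere_2)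
      qed
    qed
    then show ?thesis by blast
  qed
  show "stereographic ` topspace (sphere_of TYPE(plane)) = topspace (nsphere 2)"
  proof
    show "topspace (nsphere 2) \<subseteq> stereographic ` topspace (sphere_of TYPE(plane))"
      using \<sigma>\<tau> by (metis UNIV_I UNIV_option_conv image_iff rangeI subsetI topspace_Alexandroff_compactification topspace_euclidean)
  qed (use im in blast)
qed

text \<open>\<open>stereographic\<close> conjugates the reflection of the plane to the reflection of
  the sphere in coordinate 0, whose Brouwer degree is -1. If it acted as the identity on homology,
  that degree would be 1.\<close>

lemma plane_reflection_not_homology_identity:
  "\<exists>c \<in> carrier (homology_group 2 (sphere_of TYPE(plane))).
     hom_induced 2 (sphere_of TYPE(plane)) {} (sphere_of TYPE(plane)) {} (map_option plane_reflection) c \<noteq> c"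
proof (rule ccontr)
  let ?S = "sphere_of TYPE(plane)"
  let ?N = "nsphere 2"
  let ?m = "map_option plane_reflection"
  let ?r = "\<lambda>(x::nat\<Rightarrow>real) i. if i = 0 then - x i else x i"
  assume "\<not> ?thesis"
  then have id: "hom_induced 2 ?S {} ?S {} ?m c = c" if "c \<in> carrier (homology_group 2 ?S)" for c
    using that by blast
  obtain g where g: "homeomorphic_maps ?S ?N stereographic g"
    using homeomorphic_map_stereographic homeomorphic_map_maps by blast
  then have cs: "continuous_map ?S ?N stereographic" and cg: "continuous_map ?N ?S g"
    by (auto simp: homeomorphic_maps_def)
  have norm_refl: "norm (plane_reflection z) = norm z" for z
  proof -
    have "(norm (plane_reflection z))\<^sup>2 = (norm z)\<^sup>2" by (simp add: norm_plane plane_reflection_def)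
    then show ?thesis by simp
  qed
  \<comment> \<open>A homotopy that is constant in time: it is used for the continuity of its ends
    on the compactification.\<close>
  have "homotopic_with (\<lambda>_. True) ?S ?S (map_option (\<lambda>z. plane_reflection (snd (0::real, z)))) (map_option (\<lambda>z. plane_reflection (snd (1::real, z))))"
  proof (rule Alexandroff_homotopy)
    have "plane_reflection = (\<lambda>z. \<chi> i. if i = 1 then - z $ i else z $ i)"
      by (auto simp: plane_reflection_def vec_eq_iff forall_2 vector_2)
    moreover have "linear (\<lambda>z::plane. \<chi> i. if i = 1 then - z $ i else z $ i)"
      by (rule linearI) (auto simp: vec_eq_iff)
    ultimately have "linear plane_reflection" by simp
    then have "continuous_on UNIV plane_reflection"
      by (simp add: linear_continuous_on linear_linear)
    then show "continuous_on ({0..1} \<times> UNIV) (\<lambda>z. plane_reflection (snd z))"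
      by (rule continuous_on_compose2) (auto intro: continuous_intros)
  qed (auto simp: norm_refl)
  then have cm: "continuous_map ?S ?S ?m" using homotopic_with_imp_continuous_maps by fastforce
  have rs: "?r (stereographic w) = stereographic (?m w)" for w
  proof (cases w)
    case (Some z)
    have "plane_reflection z $ 1 = - z $ 1" "plane_reflection z $ 2 = z $ 2"
      by (simp_all add: plane_reflection_def)
    then show ?thesis using Some by (simp add: stereographic_def norm_refl fun_eq_iff)
  qed (simp add: stereographic_def fun_eq_iff)
  have "Brouwer_degree2 2 ?r = 1"
  proof (rule Brouwer_degree2_unique)
    show "continuous_map ?N ?N ?r" by (rule continuous_map_nsphere_reflection)
    \<comment> \<open>The Brouwer degree is taken in reduced homology, whose elements also belong to
      the unreduced group.\<close>
    fix x assume "x \<in> carrier (reduced_homology_group (int 2) ?N)"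
    then have x: "x \<in> carrier (homology_group 2 ?N)" "x \<in> carrier (reduced_homology_group 2 ?N)"
      using carrier_reduced_homology_group_subset by fastforce+
    have gx: "hom_induced 2 ?N {} ?S {} g x \<in> carrier (homology_group 2 ?S)"
      using hom_induced_carrier by blast
    have "hom_induced 2 ?N {} ?N {} ?r x = hom_induced 2 ?N {} ?N {} (stereographic \<circ> (?m \<circ> g)) x"
    proof (rule hom_induced_eq[THEN fun_cong])
      show "?r y = (stereographic \<circ> (?m \<circ> g)) y" if "y \<in> topspace ?N" for y
      proof -
        have "stereographic (g y) = y" using g that by (simp add: homeomorphic_maps_def)
        then show ?thesis using rs[of "g y"] by (simp only: o_apply)
      qed
    qed
    also have "\<dots> = hom_induced 2 ?S {} ?N {} stereographic (hom_induced 2 ?S {} ?S {} ?m (hom_induced 2 ?N {} ?S {} g x))"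
      using hom_induced_compose_empty[OF continuous_map_compose[OF cg cm] cs] hom_induced_compose_empty[OF cg cm]
      by simp
    also have "\<dots> = hom_induced 2 ?S {} ?N {} stereographic (hom_induced 2 ?N {} ?S {} g x)"
      using id[OF gx] by simp
    also have "\<dots> = hom_induced 2 ?N {} ?N {} (stereographic \<circ> g) x"
      using hom_induced_compose_empty[OF cg cs] by simp
    also have "\<dots> = hom_induced 2 ?N {} ?N {} id x"
      by (rule hom_induced_eq[THEN fun_cong]) (use g in \<open>simp add: homeomorphic_maps_def\<close>)
    also have "\<dots> = x" using hom_induced_id[OF x(1)] by simp
    finally show "hom_induced (int 2) ?N {} ?N {} ?r x = x [^]\<^bsub>reduced_homology_group (int 2) ?N\<^esub> (1::int)"
      using x by (simp add: group.int_pow_1)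
  qed
  then show False using Brouwer_degree2_reflection[of 2] by simp
qed

section \<open>Orientation preserving homeomorphisms of the plane\<close>

text \<open>The image of the circle is a Jordan curve with \<open>h p\<close> inside, and a simple
  closed curve winds once, in one of two directions, around its inside.\<close>

lemma homeomorphism_local_degree:
  fixes h :: "complex \<Rightarrow> complex"
  assumes h: "homeomorphism UNIV UNIV h h'" and r: "r > 0"
  shows "winding_number (h \<circ> circlepath p r) (h p) \<in> {1, -1}"
proof -
  have cont: "continuous_on S h" "continuous_on S h'" for S
    using h continuous_on_subset unfolding homeomorphism_def by blast+
  have inv: "h' (h z) = z" "h (h' z) = z" for z using h by (auto simp: homeomorphism_def)
  have inj: "inj_on h S" for S by (metis inj_onI inv(1))
  let ?S = "h ` sphere p r"
  have sp: "simple_path (h \<circ> circlepath p r)"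
    using r by (intro simple_path_continuous_image cont inj) (simp add: simple_path_circlepath)
  have pim: "path_image (h \<circ> circlepath p r) = ?S"
    using r by (simp add: path_image_compose)
  have "h p \<in> inside ?S"
  proof -
    have hp: "h p \<notin> ?S"
    proof
      assume "h p \<in> ?S"
      then obtain z where "z \<in> sphere p r" "h z = h p" by auto
      then show False using inv(1) r by (metis dist_self less_irrefl mem_sphere)
    qed
    \<comment> \<open>The preimage of this component is connected, contains \<open>p\<close> and
      misses the circle, so it is confined to the ball; hence the component is bounded.\<close>
    define C where "C = connected_component_set (- ?S) (h p)"
    have "connected (h' ` C)" unfolding C_def
      using cont connected_continuous_image connected_connected_component by blast
    moreover have "p \<in> h' ` C" unfolding C_def using hp inv
      by (metis ComplI connected_component_refl image_eqI mem_Collect_eq)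
    moreover have "h' ` C \<inter> sphere p r = {}"
    proof -
      have "C \<subseteq> - ?S" unfolding C_def by (rule connected_component_subset)
      then have "h' w \<notin> sphere p r" if "w \<in> C" for w
        using that inv(2)[of w] by (metis ComplD image_eqI subsetD)
      then show ?thesis by blast
    qed
    moreover have "p \<in> ball p r" using r by simp
    ultimately have "h' ` C \<subseteq> ball p r"
      using connected_Int_frontier[of "h' ` C" "ball p r"] frontier_ball[OF r, of p] by blast
    then have "C \<subseteq> h ` cball p r" using inv(2) ball_subset_cball by (metis image_subset_iff subset_iff rev_image_eqI)
    moreover have "bounded (h ` cball p r)"
      using cont compact_continuous_image compact_imp_bounded compact_cball by blast
    ultimately have "bounded C" using bounded_subset by blast
    then show ?thesis using hp unfolding inside_def C_def by simp
  qed
  then show ?thesis using simple_closed_path_winding_number_inside[OF sp] pim by (metis insertCI)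
qed

lemma exp_scaled_bounds:
  assumes "t \<in> {0..1}"
  shows "exp (t * x) \<le> max 1 (exp x)" "min 1 (exp x) \<le> exp (t * x :: real)"
proof -
  have "t * x \<le> max 0 x" "min 0 x \<le> t * x"
    using assms mult_left_le_one_le[of x t] mult_left_le_one_le[of "- x" t]
    by (cases "x \<ge> 0"; auto simp: mult_nonneg_nonpos)+
  then show "exp (t * x) \<le> max 1 (exp x)" "min 1 (exp x) \<le> exp (t * x)"
    by (metis exp_le_cancel_iff exp_zero max_def, metis exp_le_cancel_iff exp_zero min_def)
qed

text \<open>Composed with conjugation, \<open>h\<close> has degree 1, so for its lift
  \<open>Q\<close> the difference \<open>Q \<zeta> - \<zeta>\<close> is periodic and descends to a
  function \<phi> with \<open>cnj (h z) - cnj (h p) = (z - p) * exp (\<phi> z)\<close>. Multiplying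
  \<phi> by a time from 0 to 1 deforms \<open>z - p\<close> into the left side.\<close>

lemma orientation_reversing_homotopic_to_cnj:
  fixes h :: "complex \<Rightarrow> complex"
  assumes h: "homeomorphism UNIV UNIV h h'" and r: "r > 0"
    and deg: "winding_number (h \<circ> circlepath p r) (h p) = -1"
  obtains H :: "real \<times> complex \<Rightarrow> complex" where "continuous_on ({0..1} \<times> UNIV) H" "\<And>z. H (0, z) = cnj z" "\<And>z. H (1, z) = h z"
    "\<And>B. \<exists>R. \<forall>t\<in>{0..1}. \<forall>z. norm z > R \<longrightarrow> norm (H (t, z)) > B"
proof -
  have cont: "continuous_on S h" "continuous_on S h'" for S
    using h continuous_on_subset unfolding homeomorphism_def by blast+
  have inv: "h' (h z) = z" "h (h' z) = z" for z using h by (auto simp: homeomorphism_def)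
  have "path (h \<circ> circlepath p r)" by (intro path_continuous_image cont) simp
  moreover have "h p \<notin> path_image (h \<circ> circlepath p r)"
  proof
    assume "h p \<in> path_image (h \<circ> circlepath p r)"
    then obtain z where "z \<in> sphere p r" "h z = h p"
      using r by (auto simp: path_image_compose)
    then show False using inv(1) r by (metis dist_self less_irrefl mem_sphere)
  qed
  ultimately have deg': "winding_number ((cnj \<circ> h) \<circ> circlepath p r) ((cnj \<circ> h) p) = 1"
    using winding_number_cnj deg by (simp add: comp_assoc)
  have h1: "continuous_on ((\<lambda>\<zeta>. p + exp \<zeta>) ` UNIV) (cnj \<circ> h)"
    using cont by (intro continuous_on_compose continuous_intros)
  have h2: "(cnj \<circ> h) (p + exp \<zeta>) \<noteq> (cnj \<circ> h) p" for \<zeta>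
    using inv(1)[of p] inv(1)[of "p + exp \<zeta>"] by (auto simp: complex_cnj_cancel_iff)
  obtain Q m where Q: "continuous_on UNIV Q" "\<And>\<zeta>. (cnj \<circ> h) (p + exp \<zeta>) = (cnj \<circ> h) p + exp (Q \<zeta>)"
    "\<And>\<zeta> k. Q (\<zeta> + 2 * of_real pi * \<i> * of_int k) = Q \<zeta> + 2 * of_real pi * \<i> * of_int (k * m)"
    "\<And>r. r > 0 \<Longrightarrow> winding_number ((cnj \<circ> h) \<circ> circlepath p r) ((cnj \<circ> h) p) = of_int m"
    using punctured_lift[OF convex_UNIV UNIV_I h1 h2] by (metis UNIV_I)
  have "m = 1" using Q(4)[OF r] deg' by (metis of_int_1 of_int_eq_iff)
  \<comment> \<open>Every logarithm of \<open>z - p\<close> gives the same value, as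
    \<open>\<phi>_eq\<close> shows, so the cut of \<open>Ln\<close> does no harm.\<close>
  define \<phi> where "\<phi> = (\<lambda>z. Q (Ln (z - p)) - Ln (z - p))"
  have \<phi>_eq: "\<phi> z = Q \<zeta> - \<zeta>" if "exp \<zeta> = z - p" for z \<zeta>
  proof -
    have "z - p \<noteq> 0" using that by (metis exp_not_eq_zero)
    then have "exp \<zeta> = exp (Ln (z - p))" using that by simp
    then obtain n :: int where "\<zeta> = Ln (z - p) + (of_int (2 * n) * pi) * \<i>" using exp_eq by blast
    then have "\<zeta> = Ln (z - p) + 2 * of_real pi * \<i> * of_int n" by simp
    then show ?thesis using Q(3)[of "Ln (z - p)" n] \<open>m = 1\<close> by (simp add: \<phi>_def)
  qed
  have cont_\<phi>: "continuous_on (- {p}) \<phi>"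
  proof (rule continuous_at_imp_continuous_on, intro ballI)
    fix z0 assume "z0 \<in> - {p}"
    then have z0: "z0 \<noteq> p" by simp
    let ?B = "ball z0 (norm (z0 - p))"
    \<comment> \<open>A continuous branch of the logarithm of \<open>z - p\<close> on the ball about
      \<open>z0\<close>: division by \<open>z0 - p\<close> moves the ball into the right half-plane,
      away from the cut.\<close>
    define \<zeta> where "\<zeta> = (\<lambda>z. Ln (z0 - p) + Ln ((z - p) / (z0 - p)))"
    have B: "(z - p) / (z0 - p) \<notin> \<real>\<^sub>\<le>\<^sub>0" "z \<noteq> p" if "z \<in> ?B" for z
    proof -
      have "norm ((z - p) / (z0 - p) - 1) < 1"
      proof -
        have "(z - p) / (z0 - p) - 1 = (z - z0) / (z0 - p)" using z0 by (simp add: field_simps)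
        then show ?thesis using that z0 by (simp add: norm_divide dist_norm norm_minus_commute)
      qed
      then have "\<bar>Re ((z - p) / (z0 - p) - 1)\<bar> < 1" using abs_Re_le_cmod order_le_less_trans by blast
      then have "Re ((z - p) / (z0 - p)) > 0" by simp
      then show "(z - p) / (z0 - p) \<notin> \<real>\<^sub>\<le>\<^sub>0" by (simp add: complex_nonpos_Reals_iff)
      then show "z \<noteq> p" by auto
    qed
    have "continuous_on ?B \<zeta>" unfolding \<zeta>_def
      using B z0 by (intro continuous_intros) auto
    then have "continuous_on ?B (\<lambda>z. Q (\<zeta> z) - \<zeta> z)"
      by (intro continuous_intros continuous_on_compose2[OF Q(1)]) auto
    moreover have "Q (\<zeta> z) - \<zeta> z = \<phi> z" if "z \<in> ?B" for z
    proof -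
      have "exp (\<zeta> z) = z - p" unfolding \<zeta>_def exp_add using z0 B[OF that] by simp
      then show ?thesis using \<phi>_eq by simp
    qed
    ultimately have "continuous_on ?B \<phi>" by (metis (no_types, lifting) continuous_on_cong)
    then show "isCont \<phi> z0" using z0 continuous_on_eq_continuous_at by (metis centre_in_ball open_ball zero_less_norm_iff right_minus_eq)
  qed
  define M where "M = (\<lambda>(t::real, z). (z - p) * exp (of_real t * \<phi> z))"
  have M1: "M (1, z) = cnj (h z) - cnj (h p)" for z
  proof (cases "z = p")
    case False
    then have e: "exp (Ln (z - p)) = z - p" by simp
    then have "(z - p) * exp (\<phi> z) = exp (Q (Ln (z - p)))"
      unfolding \<phi>_def exp_diff using False by simp
    then show ?thesis using Q(2)[of "Ln (z - p)"] e by (simp add: M_def)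
  qed (simp add: M_def)
  have normM: "norm (M (t, z)) = norm (z - p) * exp (t * Re (\<phi> z))" for t z
    by (simp add: M_def norm_mult)
  have norm1: "norm (z - p) * exp (Re (\<phi> z)) = norm (h z - h p)" for z
    using normM[of 1 z] M1[of z] by (metis complex_cnj_diff complex_mod_cnj mult_1)
  \<comment> \<open>The exponential factor lies between 1 and its value at time 1, so the norm of
    \<open>M\<close> lies between the norms at its two ends. The upper bound gives continuity at
    \<open>p\<close>, where \<phi> is not controlled; the lower bound gives properness.\<close>
  have Mle: "norm (M (t, z)) \<le> max (norm (z - p)) (norm (h z - h p))" if "t \<in> {0..1}" for t z
  proof -
    have "norm (M (t, z)) \<le> norm (z - p) * max 1 (exp (Re (\<phi> z)))"
      unfolding normM using exp_scaled_bounds(1)[OF that] by (intro mult_left_mono) auto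
    also have "\<dots> = max (norm (z - p)) (norm (h z - h p))"
      by (simp add: max_mult_distrib_left norm1)
    finally show ?thesis .
  qed
  have Mge: "min (norm (z - p)) (norm (h z - h p)) \<le> norm (M (t, z))" if "t \<in> {0..1}" for t z
  proof -
    have "norm (z - p) * min 1 (exp (Re (\<phi> z))) \<le> norm (M (t, z))"
      unfolding normM using exp_scaled_bounds(2)[OF that] by (intro mult_left_mono) auto
    moreover have "norm (z - p) * min 1 (exp (Re (\<phi> z))) = min (norm (z - p)) (norm (h z - h p))"
      by (simp add: min_mult_distrib_left norm1)
    ultimately show ?thesis by simp
  qed
  have contM: "continuous_on ({0..1} \<times> UNIV) M"
    unfolding continuous_on_eq_continuous_within
  proof
    fix x :: "real \<times> complex" assume x: "x \<in> {0..1} \<times> UNIV"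
    obtain t0 z0 where tz: "x = (t0, z0)" by fastforce
    show "continuous (at x within {0..1} \<times> UNIV) M"
    proof (cases "z0 = p")
      case False
      have "continuous_on ({0..1} \<times> (- {p})) M"
        unfolding M_def case_prod_unfold
        by (intro continuous_intros continuous_on_compose2[OF cont_\<phi>]) auto
      then have "continuous (at x within {0..1} \<times> (- {p})) M"
        using x tz False by (auto simp: continuous_on_eq_continuous_within)
      moreover have "at x within {0..1} \<times> UNIV = at x within {0..1} \<times> (- {p})"
      proof (rule at_within_nhd[of x "UNIV \<times> (- {p})"])
        show "open (UNIV \<times> (- {p}) :: (real \<times> complex) set)" by (intro open_Times) auto
      qed (use tz False in auto)
      ultimately show ?thesis by (simp add: continuous_within)
    next
      case True
      have "((\<lambda>y. max (norm (snd y - p)) (norm (h (snd y) - h p))) \<longlongrightarrow> max (norm (p - p)) (norm (h p - h p))) (at x within {0..1} \<times> UNIV)"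
      proof -
        have s: "(snd \<longlongrightarrow> p) (at x within {0..1} \<times> UNIV)"
          using tz True tendsto_snd[OF tendsto_ident_at, of x] by (simp add: prod.case_eq_if)
        have "isCont h p" using cont(1)[of UNIV] by (simp add: continuous_on_eq_continuous_at)
        then have "((\<lambda>y. h (snd y)) \<longlongrightarrow> h p) (at x within {0..1} \<times> UNIV)"
          using s isCont_tendsto_compose by blast
        then show ?thesis using s by (intro tendsto_intros)
      qed
      moreover have "\<forall>\<^sub>F y in at x within {0..1} \<times> UNIV. norm (M y) \<le> max (norm (snd y - p)) (norm (h (snd y) - h p))"
        unfolding eventually_at_filter
        by (intro always_eventually allI impI) (metis Mle SigmaD1 prod.collapse mem_Times_iff)
      ultimately have "(M \<longlongrightarrow> 0) (at x within {0..1} \<times> UNIV)"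
        by (intro Lim_null_comparison[of M]) auto
      moreover have "M x = 0" using tz True by (simp add: M_def)
      ultimately show ?thesis by (simp add: continuous_within)
    qed
  qed
  \<comment> \<open>The added term moves from \<open>p\<close> to \<open>cnj (h p)\<close>, so that
    the outer conjugation yields \<open>cnj z\<close> at time 0 and \<open>h z\<close> at time
    1.\<close>
  define H where "H = (\<lambda>y. cnj ((1 - of_real (fst y)) * p + of_real (fst y) * cnj (h p) + M y))"
  show ?thesis
  proof
    show "continuous_on ({0..1} \<times> UNIV) H" unfolding H_def by (intro continuous_intros contM)
    show "H (0, z) = cnj z" for z by (simp add: H_def M_def)
    show "H (1, z) = h z" for z by (simp add: H_def M1)
    fix B :: real
    \<comment> \<open>\<open>c\<close> bounds the norm of the moving term, and beyond the chosen
      radius both ends of \<open>M\<close> have norm above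
      \<open>\<bar>B\<bar> + c + 1\<close>.\<close>
    define c where "c = norm p + norm (h p)"
    define B' where "B' = \<bar>B\<bar> + c + 1 + norm (h p)"
    have "compact (h' ` cball 0 B')" using cont compact_continuous_image compact_cball by blast
    then obtain R1 where R1: "\<And>z. z \<in> h' ` cball 0 B' \<Longrightarrow> norm z \<le> R1"
      using compact_imp_bounded bounded_iff by metis
    show "\<exists>R. \<forall>t\<in>{0..1}. \<forall>z. norm z > R \<longrightarrow> norm (H (t, z)) > B"
    proof (intro exI[of _ "max R1 (\<bar>B\<bar> + c + 1 + norm p)"] ballI allI impI)
      fix t :: real and z :: complex
      assume t: "t \<in> {0..1}" and z: "max R1 (\<bar>B\<bar> + c + 1 + norm p) < norm z"
      have "h z \<notin> cball 0 B'" using R1[of z] z inv(1) by (metis image_eqI max_less_iff_conj not_le)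
      then have "norm (h z) > B'" by simp
      then have "norm (h z - h p) > \<bar>B\<bar> + c + 1" using norm_triangle_ineq2[of "h z" "h p"] unfolding B'_def by linarith
      moreover have "norm (z - p) > \<bar>B\<bar> + c + 1" using norm_triangle_ineq2[of z p] z by linarith
      ultimately have "norm (M (t, z)) > \<bar>B\<bar> + c" using Mge[OF t, of z] by linarith
      moreover have "norm ((1 - of_real t) * p + of_real t * cnj (h p)) \<le> c"
      proof -
        have "norm ((1 - of_real t) * p + of_real t * cnj (h p)) \<le> norm ((1 - of_real t :: complex) * p) + norm (of_real t * cnj (h p))"
          by (rule norm_triangle_ineq)
        also have "\<dots> = (1 - t) * norm p + t * norm (h p)"
        proof -
          have "norm (1 - of_real t :: complex) = 1 - t" using t by (metis abs_of_nonneg atLeastAtMost_iff diff_ge_0_iff_ge norm_of_real of_real_1 of_real_diff)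
          then show ?thesis using t by (simp add: norm_mult)
        qed
        also have "\<dots> \<le> c" unfolding c_def using t by (intro add_mono mult_left_le_one_le) auto
        finally show ?thesis .
      qed
      moreover have "norm (H (t, z)) = norm (((1 - of_real t) * p + of_real t * cnj (h p)) + M (t, z))"
        by (simp add: H_def del: complex_cnj_add complex_cnj_mult)
      ultimately show "B < norm (H (t, z))"
        using norm_diff_ineq[of "M (t, z)" "(1 - of_real t) * p + of_real t * cnj (h p)"] by (smt (verit) add.commute)
    qed
  qed
qed

text \<open>The coordinates are swapped so that complex conjugation becomes \<open>plane_reflection\<close>, which changes the
  sign of the first coordinate as in \<open>Brouwer_degree2_reflection\<close>.\<close>

definition to_complex :: "plane \<Rightarrow> complex" where
  "to_complex z = Complex (z $ 2) (z $ 1)"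

definition of_complex :: "complex \<Rightarrow> plane" where
  "of_complex w = vector [Im w, Re w]"

lemma to_complex_of_complex [simp]: "to_complex (of_complex w) = w"
  by (simp add: to_complex_def of_complex_def complex_eq_iff)

lemma of_complex_to_complex [simp]: "of_complex (to_complex z) = z"
  by (simp add: to_complex_def of_complex_def vec_eq_iff forall_2)

lemma norm_to_complex [simp]: "norm (to_complex z) = norm z"
proof -
  have "(norm (to_complex z))\<^sup>2 = (norm z)\<^sup>2"
    unfolding norm_plane by (simp add: to_complex_def cmod_power2 add.commute)
  then show ?thesis by simp
qed

lemma norm_of_complex [simp]: "norm (of_complex w) = norm w"
  by (metis norm_to_complex to_complex_of_complex)

lemma linear_to_complex: "linear to_complex"
  by (rule linearI) (auto simp: to_complex_def complex_eq_iff)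

lemma linear_of_complex: "linear of_complex"
  by (rule linearI) (auto simp: of_complex_def vec_eq_iff forall_2)

lemma continuous_on_to_complex: "continuous_on S to_complex"
  by (simp add: linear_continuous_on linear_linear linear_to_complex)

lemma continuous_on_of_complex: "continuous_on S of_complex"
  by (simp add: linear_continuous_on linear_linear linear_of_complex)

lemma homeomorphism_to_complex: "homeomorphism UNIV UNIV to_complex of_complex"
  unfolding homeomorphism_def
  by (auto simp: continuous_on_to_complex continuous_on_of_complex image_iff)
    (metis to_complex_of_complex, metis of_complex_to_complex)

lemma of_complex_cnj: "of_complex (cnj (to_complex z)) = plane_reflection z"
  by (simp add: of_complex_def to_complex_def plane_reflection_def vec_eq_iff forall_2)

text \<open>The degree is 1 or -1. In the second case the homotopy to conjugation extends over
  infinity, and \<open>h\<close> would act on homology as the reflection does.\<close>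

lemma orientation_preserving_homeo_degree:
  assumes h: "orientation_preserving_homeo h" and r: "r > 0"
  shows "winding_number ((to_complex \<circ> h \<circ> of_complex) \<circ> circlepath p r) ((to_complex \<circ> h \<circ> of_complex) p) = 1"
proof (rule ccontr)
  let ?k = "to_complex \<circ> h \<circ> of_complex"
  let ?S = "sphere_of TYPE(plane)"
  assume nt: "\<not> ?thesis"
  obtain g where g: "homeomorphism UNIV UNIV h g"
    using h unfolding orientation_preserving_homeo_def by blast
  have id: "hom_induced 2 ?S {} ?S {} (map_option h) c = c" if "c \<in> carrier (homology_group 2 ?S)" for c
    using h that unfolding orientation_preserving_homeo_def Let_def by blast
  have k: "homeomorphism UNIV UNIV ?k (to_complex \<circ> (g \<circ> of_complex))"
    using homeomorphism_compose[OF homeomorphism_compose[OF homeomorphism_symD[OF homeomorphism_to_complex] g] homeomorphism_to_complex]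
    by (simp add: comp_assoc)
  have "winding_number (?k \<circ> circlepath p r) (?k p) = -1"
    using homeomorphism_local_degree[OF k r] nt by blast
  then obtain H :: "real \<times> complex \<Rightarrow> complex" where H: "continuous_on ({0..1} \<times> UNIV) H"
    "\<And>z. H (0, z) = cnj z" "\<And>z. H (1, z) = ?k z"
    "\<And>B. \<exists>R. \<forall>t\<in>{0..1}. \<forall>z. norm z > R \<longrightarrow> norm (H (t, z)) > B"
    using orientation_reversing_homotopic_to_cnj[OF k r] by metis
  define G where "G = (\<lambda>y. of_complex (H (fst y, to_complex (snd y))))"
  have "homotopic_with (\<lambda>_. True) ?S ?S (map_option (\<lambda>z. G (0, z))) (map_option (\<lambda>z. G (1, z)))"
  proof (rule Alexandroff_homotopy)
    have c: "continuous_on ({0..1} \<times> UNIV) (\<lambda>y::real \<times> plane. (fst y, to_complex (snd y)))"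
      by (intro continuous_intros continuous_on_compose2[OF continuous_on_to_complex[of UNIV]]) auto
    have "continuous_on ({0..1} \<times> UNIV) (\<lambda>y::real \<times> plane. H (fst y, to_complex (snd y)))"
      by (rule continuous_on_compose2[OF H(1) c]) auto
    then show "continuous_on ({0..1} \<times> UNIV) G" unfolding G_def
      by (rule continuous_on_compose2[OF continuous_on_of_complex[of UNIV]]) auto
    show "\<exists>R. \<forall>t\<in>{0..1}. \<forall>z. norm z > R \<longrightarrow> norm (G (t, z)) > B" for B
      using H(4)[of B] unfolding G_def by (metis fst_conv snd_conv norm_to_complex norm_of_complex)
  qed
  moreover have "(\<lambda>z. G (0, z)) = plane_reflection" by (simp add: G_def H(2) of_complex_cnj)
  moreover have "(\<lambda>z. G (1, z)) = h" by (simp add: G_def H(3))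
  ultimately have "hom_induced 2 ?S {} ?S {} (map_option plane_reflection) = hom_induced 2 ?S {} ?S {} (map_option h)"
    using homology_homotopy_empty by metis
  then show False using plane_reflection_not_homology_identity id by metis
qed

section \<open>The two sides of an arc\<close>

text \<open>The point \<open>z\<close> may lie on \<open>g\<close> outside the stretch from
  \<open>u\<close> to \<open>w\<close>. Therefore the splitting is done on the subpath
  \<open>h\<close> alone, where \<open>s\<close> is the parameter of \<open>g v\<close>.\<close>

lemma winding_number_subpath_split:
  assumes g: "path g" and uvw: "0 \<le> u" "u \<le> v" "v \<le> w" "w \<le> 1" and z: "z \<notin> g ` {u..w}"
  shows "winding_number (subpath u w g) z = winding_number (subpath u v g) z + winding_number (subpath v w g) z"
proof (cases "u = w")
  case True
  then have "v = u" using uvw by simp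
  moreover have "z \<noteq> g u" using z uvw by auto
  then have "winding_number (subpath u u g) z = 0"
    by (simp add: subpath_refl)
  ultimately show ?thesis using True by simp
next
  case False
  then have uw: "u < w" using uvw by simp
  define h where "h = subpath u w g"
  define s where "s = (v - u) / (w - u)"
  have s: "s \<in> {0..1}" using uw uvw by (simp add: s_def)
  have "path h" unfolding h_def using g uvw by (intro path_subpath) auto
  moreover have "z \<notin> path_image h" unfolding h_def using z uvw uw by (simp add: path_image_subpath)
  ultimately have "winding_number (subpath 0 s h) z + winding_number (subpath s 1 h) z = winding_number (subpath 0 1 h) z"
    using s by (intro winding_number_subpath_combine) auto
  moreover have "subpath 0 s h = subpath u v g" "subpath s 1 h = subpath v w g"
  proof -
    have ws: "(w - u) * s = v - u" using uw by (simp add: s_def)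
    have e1: "(w - u) * (s * x) = (v - u) * x" for x by (simp add: ws[symmetric])
    have e2: "(w - u) * ((1 - s) * x + s) + u = (w - v) * x + v" for x
    proof -
      have "(w - u) * ((1 - s) * x + s) + u = (w - u) * x - ((w - u) * s) * x + (w - u) * s + u"
        by (simp add: algebra_simps)
      then show ?thesis unfolding ws by (simp add: algebra_simps)
    qed
    show "subpath 0 s h = subpath u v g" "subpath s 1 h = subpath v w g"
      unfolding h_def subpath_def by (simp_all only: e1 e2 diff_zero add_0_right)
  qed
  ultimately show ?thesis by (simp add: h_def)
qed

text \<open>Near \<open>z\<close> the values of \<open>F\<close> differ by less than 1, so integers
  among them coincide. This will be applied to differences of winding numbers whose jumps across a
  curve cancel.\<close>

lemma isCont_Ints_locally_constant:
  fixes F D :: "complex \<Rightarrow> complex"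
  assumes "isCont F z" "\<epsilon> > 0" "\<And>p. p \<in> ball z \<epsilon> - S \<Longrightarrow> D p = F p" "\<And>p. p \<in> ball z \<epsilon> - S \<Longrightarrow> D p \<in> \<int>"
  obtains \<delta> k where "\<delta> > 0" "\<And>p. p \<in> ball z \<delta> - S \<Longrightarrow> D p = k"
proof -
  obtain d where d: "d > 0" "\<And>p. dist p z < d \<Longrightarrow> dist (F p) (F z) < 1/2"
    using assms(1) unfolding continuous_at_eps_delta by (metis half_gt_zero zero_less_one)
  define \<delta> where "\<delta> = min d \<epsilon>"
  have "\<delta> > 0" using d assms by (simp add: \<delta>_def)
  have eq: "D p = D q" if "p \<in> ball z \<delta> - S" "q \<in> ball z \<delta> - S" for p q
  proof -
    have "p \<in> ball z \<epsilon> - S" "q \<in> ball z \<epsilon> - S" "dist p z < d" "dist q z < d"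
      using that by (auto simp: \<delta>_def dist_commute)
    then have "dist (D p) (D q) < 1" using d(2)[of p] d(2)[of q] assms(3)
      by (metis dist_triangle_half_l dist_commute)
    moreover obtain m n :: int where "D p = of_int m" "D q = of_int n"
      using assms(4) \<open>p \<in> ball z \<epsilon> - S\<close> \<open>q \<in> ball z \<epsilon> - S\<close> by (metis Ints_cases)
    ultimately have "norm (of_int (m - n) :: complex) < 1" by (simp add: dist_norm)
    then have "\<bar>m - n\<bar> < 1" by (metis norm_of_int of_int_less_1_iff of_int_abs)
    then show ?thesis using \<open>D p = of_int m\<close> \<open>D q = of_int n\<close> by simp
  qed
  show ?thesis
  proof (cases "ball z \<delta> - S = {}")
    case True
    show ?thesis by (rule that[of \<delta> 0]) (use \<open>\<delta> > 0\<close> True in auto)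
  next
    case False
    then obtain q where "q \<in> ball z \<delta> - S" by blast
    then show ?thesis using that[of \<delta> "D q"] \<open>\<delta> > 0\<close> eq by blast
  qed
qed

text \<open>Janiszewski's theorem: neither the curve nor the complement of the disc, enlarged by the part
  \<open>Q\<close> of the curve, separates the two points, and the two closed sets meet in the connected set \<open>Q\<close>.\<close>

lemma Jordan_local_sides:
  fixes \<gamma> :: "real \<Rightarrow> complex"
  assumes \<gamma>: "simple_path \<gamma>" "pathfinish \<gamma> = pathstart \<gamma>"
    and PQ: "path_image \<gamma> = P \<union> Q" "compact Q" "connected Q" "z \<notin> Q" "P \<subseteq> ball z \<epsilon>" and \<epsilon>: "\<epsilon> > 0"
  obtains \<delta> where "\<delta> > 0"
    "\<And>p q. \<lbrakk>p \<in> ball z \<delta>; q \<in> ball z \<delta>; p \<in> inside (path_image \<gamma>) \<and> q \<in> inside (path_image \<gamma>) \<or>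
        p \<in> outside (path_image \<gamma>) \<and> q \<in> outside (path_image \<gamma>)\<rbrakk>
      \<Longrightarrow> connected_component (ball z \<epsilon> - path_image \<gamma>) p q"
proof -
  note J = Jordan_inside_outside[OF \<gamma>]
  have "open (- Q \<inter> ball z \<epsilon>)" using PQ(2) compact_imp_closed by (intro open_Int) auto
  moreover have "z \<in> - Q \<inter> ball z \<epsilon>" using PQ(4) \<epsilon> by simp
  ultimately obtain \<delta> where \<delta>: "\<delta> > 0" "ball z \<delta> \<subseteq> - Q \<inter> ball z \<epsilon>"
    using open_contains_ball by metis
  show ?thesis
  proof (rule that[OF \<delta>(1)])
    fix p q
    assume p: "p \<in> ball z \<delta>" and q: "q \<in> ball z \<delta>"
      and side: "p \<in> inside (path_image \<gamma>) \<and> q \<in> inside (path_image \<gamma>) \<or>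
        p \<in> outside (path_image \<gamma>) \<and> q \<in> outside (path_image \<gamma>)"
    define C where "C = - ball z \<epsilon> \<union> Q"
    have "connected_component (- (path_image \<gamma> \<union> C)) p q"
    proof (rule Janiszewski)
      show "compact (path_image \<gamma>)" using \<gamma>(1) by (simp add: compact_simple_path_image)
      show "closed C" unfolding C_def using PQ(2) compact_imp_closed by (intro closed_Un) auto
      have "path_image \<gamma> \<inter> C = Q" unfolding C_def using PQ(1,5) by blast
      then show "connected (path_image \<gamma> \<inter> C)" using PQ(3) by simp
      show "connected_component (- path_image \<gamma>) p q"
        using side
      proof
        assume "p \<in> inside (path_image \<gamma>) \<and> q \<in> inside (path_image \<gamma>)"
        moreover have "inside (path_image \<gamma>) \<subseteq> - path_image \<gamma>" using inside_no_overlap by blast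
        ultimately show ?thesis using J unfolding connected_component_def by blast
      next
        assume "p \<in> outside (path_image \<gamma>) \<and> q \<in> outside (path_image \<gamma>)"
        moreover have "outside (path_image \<gamma>) \<subseteq> - path_image \<gamma>" using outside_no_overlap by blast
        ultimately show ?thesis using J unfolding connected_component_def by blast
      qed
      have "ball z \<delta> \<subseteq> - C" unfolding C_def using \<delta>(2) by blast
      then show "connected_component (- C) p q"
        using p q unfolding connected_component_def by (metis connected_ball)
    qed
    moreover have "- (path_image \<gamma> \<union> C) \<subseteq> ball z \<epsilon> - path_image \<gamma>" unfolding C_def by blast
    ultimately show "connected_component (ball z \<epsilon> - path_image \<gamma>) p q"
      by (rule connected_component_of_subset)
  qed
qed

text \<open>Two kinds of Jordan curve contain a stretch of the arc and share these lemmas: the curve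
  \<open>J\<close>, closed by the image arc, and auxiliary curves containing stretches that
  \<open>J\<close> may miss.\<close>

locale closing_arc =
  fixes g \<beta> :: "real \<Rightarrow> complex" and A B :: real
  assumes arc_g: "arc g" and AB: "0 \<le> A" "A < B" "B \<le> 1"
    and arc_\<beta>: "arc \<beta>" "pathstart \<beta> = g B" "pathfinish \<beta> = g A"
    and meet: "path_image \<beta> \<inter> g ` {A..B} \<subseteq> {g A, g B}"
begin

definition curve :: "real \<Rightarrow> complex" where
  "curve = subpath A B g +++ \<beta>"

lemma path_g: "path g" and inj_g: "inj_on g {0..1}" and cont_g: "continuous_on {0..1} g"
  using arc_g by (auto simp: arc_def path_def)

lemma simple_curve: "simple_path curve"
  unfolding curve_def
proof (rule simple_path_join_loop)
  show "arc (subpath A B g)" using arc_g AB by (intro arc_subpath_arc) auto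
  show "path_image (subpath A B g) \<inter> path_image \<beta> \<subseteq> {pathstart (subpath A B g), pathstart \<beta>}"
    using meet AB arc_\<beta> by (auto simp: path_image_subpath)
qed (use arc_\<beta> in auto)

lemma loop_curve: "pathfinish curve = pathstart curve"
  using arc_\<beta> by (simp add: curve_def)

lemma path_curve: "path curve"
  using simple_curve simple_path_imp_path by blast

lemma path_image_curve: "path_image curve = g ` {A..B} \<union> path_image \<beta>"
  unfolding curve_def using arc_\<beta> AB by (subst path_image_join) (auto simp: path_image_subpath)

lemma interior_point_notin_closing: "t \<in> {A<..<B} \<Longrightarrow> g t \<notin> path_image \<beta>"
proof
  assume t: "t \<in> {A<..<B}" and "g t \<in> path_image \<beta>"
  then have "g t \<in> {g A, g B}" using meet by force
  then show False using t AB inj_on_contraD[OF inj_g, of t A] inj_on_contraD[OF inj_g, of t B] by auto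
qed

lemma local_sides:
  assumes t: "t \<in> {A<..<B}" and \<epsilon>: "\<epsilon> > 0"
  obtains \<delta> where "\<delta> > 0"
    "\<And>p q. \<lbrakk>p \<in> ball (g t) \<delta>; q \<in> ball (g t) \<delta>; p \<in> inside (path_image curve) \<and> q \<in> inside (path_image curve) \<or>
        p \<in> outside (path_image curve) \<and> q \<in> outside (path_image curve)\<rbrakk>
      \<Longrightarrow> connected_component (ball (g t) \<epsilon> - path_image curve) p q"
proof -
  have "t \<in> {0..1}" using t AB by auto
  then obtain d where d: "d > 0" "\<And>s. s \<in> {0..1} \<Longrightarrow> dist s t < d \<Longrightarrow> dist (g s) (g t) < \<epsilon>"
    using cont_g \<epsilon> unfolding continuous_on_iff by metis
  define s where "s = min (d / 2) (min ((t - A) / 2) ((B - t) / 2))"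
  have s: "0 < s" "s < d" "A < t - s" "t + s < B"
    using d t by (auto simp: s_def min_def field_simps)
  define P where "P = g ` {t - s..t + s}"
  \<comment> \<open>The closing arc joins the two remaining stretches of \<open>g\<close>, so the
    rest of the curve is connected, as \<open>Jordan_local_sides\<close> requires.\<close>
  define Q where "Q = g ` {A..t - s} \<union> (g ` {t + s..B} \<union> path_image \<beta>)"
  have con: "continuous_on {u..v} g" if "0 \<le> u" "v \<le> 1" for u v
    using cont_g that by (auto intro: continuous_on_subset)
  have "path_image curve = P \<union> Q"
  proof -
    have "{A..B} = {t - s..t + s} \<union> ({A..t - s} \<union> {t + s..B})" using s by auto
    then show ?thesis unfolding path_image_curve P_def Q_def by auto
  qed
  moreover have "compact Q" unfolding Q_def using con AB s arc_\<beta>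
    by (intro compact_Un compact_continuous_image compact_arc_image) auto
  moreover have "connected Q"
  proof -
    have c1: "connected (g ` {t + s..B} \<union> path_image \<beta>)"
    proof (rule connected_Un)
      have "g B \<in> g ` {t + s..B}" using s by auto
      moreover have "g B \<in> path_image \<beta>" using arc_\<beta> by (metis pathstart_in_path_image)
      ultimately show "g ` {t + s..B} \<inter> path_image \<beta> \<noteq> {}" by blast
    qed (use con AB s t arc_\<beta> in \<open>auto intro!: connected_continuous_image connected_path_image arc_imp_path\<close>)
    moreover have c2: "connected (g ` {A..t - s})"
      using con AB s t by (intro connected_continuous_image) auto
    moreover have "g A \<in> g ` {A..t - s}" using s by auto
    moreover have "g A \<in> path_image \<beta>" using arc_\<beta> by (metis pathfinish_in_path_image)
    ultimately have "g ` {A..t - s} \<inter> (g ` {t + s..B} \<union> path_image \<beta>) \<noteq> {}" by blast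
    then show ?thesis unfolding Q_def by (rule connected_Un[OF c2 c1])
  qed
  moreover have "g t \<notin> Q"
  proof -
    have "g t \<noteq> g r" if "r \<in> {A..t - s} \<union> {t + s..B}" for r
      using inj_g that s AB t unfolding inj_on_def by force
    then show ?thesis unfolding Q_def using interior_point_notin_closing[OF t] by blast
  qed
  moreover have "P \<subseteq> ball (g t) \<epsilon>"
  proof
    fix x assume "x \<in> P"
    then obtain r where r: "r \<in> {t - s..t + s}" "x = g r" by (auto simp: P_def)
    then have "r \<in> {0..1}" "dist r t < d" using s AB by (auto simp: dist_real_def)
    then show "x \<in> ball (g t) \<epsilon>" using d(2) r by (simp add: dist_commute)
  qed
  ultimately show ?thesis
    using Jordan_local_sides[OF simple_curve loop_curve _ _ _ _ _ \<epsilon>] that by metis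
qed

lemma winding_number_curve:
  assumes "p \<notin> path_image curve"
  shows "winding_number curve p = winding_number (subpath A B g) p + winding_number \<beta> p"
proof -
  have "p \<notin> path_image (subpath A B g)" "p \<notin> path_image \<beta>"
    using assms AB by (auto simp: path_image_curve path_image_subpath)
  then show ?thesis unfolding curve_def
    using path_g AB arc_\<beta> by (intro winding_number_join) (auto simp: arc_imp_path path_subpath)
qed

text \<open>The curve without the stretch from \<open>s1\<close> to \<open>s2\<close> stays away
  from \<open>g t\<close>, so its contribution \<open>h\<close> is continuous there although the
  winding number of the whole curve jumps.\<close>

lemma winding_number_local:
  assumes s: "A \<le> s1" "s1 < t" "t < s2" "s2 \<le> B"
  obtains h where "isCont h (g t)"
    "\<And>p. p \<notin> path_image curve \<Longrightarrow> winding_number curve p = winding_number (subpath s1 s2 g) p + h p"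
proof -
  define h where "h = (\<lambda>p. winding_number (subpath A s1 g) p + winding_number (subpath s2 B g) p + winding_number \<beta> p)"
  have ne: "g t \<noteq> g r" if "r \<in> {A..s1} \<union> {s2..B}" for r
    using inj_g that s AB unfolding inj_on_def by force
  have "isCont h (g t)" unfolding h_def
  proof (intro continuous_intros continuous_at_winding_number)
    show "g t \<notin> path_image (subpath A s1 g)" "g t \<notin> path_image (subpath s2 B g)"
      using ne s AB by (auto simp: path_image_subpath dest!: ne[THEN notE, rotated])
    show "g t \<notin> path_image \<beta>" using interior_point_notin_closing s by simp
  qed (use path_g AB s arc_\<beta> in \<open>auto simp: arc_imp_path path_subpath\<close>)
  moreover have "winding_number curve p = winding_number (subpath s1 s2 g) p + h p" if p: "p \<notin> path_image curve" for p
  proof -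
    have "p \<notin> g ` {A..B}" using p by (simp add: path_image_curve)
    moreover have "{s1..B} \<subseteq> {A..B}" using s by auto
    ultimately have "p \<notin> g ` {A..B}" "p \<notin> g ` {s1..B}" by blast+
    then have "winding_number (subpath A B g) p = winding_number (subpath A s1 g) p +
        (winding_number (subpath s1 s2 g) p + winding_number (subpath s2 B g) p)"
      using s AB path_g winding_number_subpath_split[of g A s1 B p] winding_number_subpath_split[of g s1 s2 B p] by simp
    then show ?thesis using winding_number_curve[OF p] by (simp add: h_def)
  qed
  ultimately show ?thesis using that by blast
qed

lemma Ints_winding_number_curve: "p \<notin> path_image curve \<Longrightarrow> winding_number curve p \<in> \<int>"
  using integer_winding_number path_curve loop_curve by blast

end

text \<open>An arc does not separate the plane, so some arc joins \<open>g b\<close> to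
  \<open>g a\<close> off the stretch from \<open>a'\<close> to \<open>b'\<close>. Cut it at its
  first arrival on the stretch from \<open>a\<close> to \<open>a'\<close>, and at its last visit
  before that to the stretch from \<open>b'\<close> to \<open>b\<close>; these two points give
  \<open>A\<close> and \<open>B\<close>.\<close>

lemma exists_closing_arc:
  fixes g :: "real \<Rightarrow> complex"
  assumes g: "arc g" and ab: "0 \<le> a" "a < a'" "a' < b'" "b' < b" "b \<le> 1"
  obtains A B \<beta> where "a \<le> A" "A < a'" "b' < B" "B \<le> b" "closing_arc g \<beta> A B"
proof -
  have inj: "inj_on g {0..1}" and cont: "continuous_on {0..1} g" using g by (auto simp: arc_def path_def)
  have con: "continuous_on {u..v} g" if "0 \<le> u" "v \<le> 1" for u v
    using cont that by (auto intro: continuous_on_subset)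
  have "arc (subpath a' b' g)" using g ab by (intro arc_subpath_arc) auto
  then have "path_connected (- g ` {a'..b'})"
    using path_connected_arc_complement[of "subpath a' b' g"] ab by (simp add: path_image_subpath)
  moreover have "g b \<in> - g ` {a'..b'}" "g a \<in> - g ` {a'..b'}" "g b \<noteq> g a"
    using inj ab unfolding inj_on_def by force+
  ultimately obtain \<beta>0 where \<beta>0: "arc \<beta>0" "path_image \<beta>0 \<subseteq> - g ` {a'..b'}" "pathstart \<beta>0 = g b" "pathfinish \<beta>0 = g a"
    unfolding path_connected_arcwise by metis
  have cont\<beta>: "continuous_on {0..1} \<beta>0" using \<beta>0 by (simp add: arc_def path_def)
  have closed_pre: "closed {t \<in> {0..v}. \<beta>0 t \<in> g ` {p..q}}" if "v \<le> 1" "0 \<le> p" "q \<le> 1" for v p q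
  proof -
    have "closed (g ` {p..q})"
      using con that by (intro compact_imp_closed compact_continuous_image) auto
    moreover have "continuous_on {0..v} \<beta>0" using cont\<beta> that by (auto intro: continuous_on_subset)
    ultimately have "closed ({0..v} \<inter> \<beta>0 -` (g ` {p..q}))"
      by (intro continuous_closed_preimage) auto
    moreover have "{0..v} \<inter> \<beta>0 -` (g ` {p..q}) = {t \<in> {0..v}. \<beta>0 t \<in> g ` {p..q}}" by auto
    ultimately show ?thesis by simp
  qed
  define T1 where "T1 = {t \<in> {0..1}. \<beta>0 t \<in> g ` {a..a'}}"
  have "1 \<in> T1" using \<beta>0(4) ab by (auto simp: T1_def pathfinish_def)
  moreover have bT1: "bdd_below T1" by (auto simp: T1_def)
  moreover have "closed T1" unfolding T1_def using closed_pre ab by simp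
  ultimately have "Inf T1 \<in> T1" using closed_contains_Inf by blast
  define t1 where "t1 = Inf T1"
  have t1: "t1 \<in> {0..1}" "\<beta>0 t1 \<in> g ` {a..a'}" using \<open>Inf T1 \<in> T1\<close> by (auto simp: T1_def t1_def)
  have t1_min: "t1 \<le> t" if "t \<in> {0..1}" "\<beta>0 t \<in> g ` {a..a'}" for t
    unfolding t1_def by (rule cInf_lower[OF _ bT1]) (use that in \<open>simp add: T1_def\<close>)
  define T0 where "T0 = {t \<in> {0..t1}. \<beta>0 t \<in> g ` {b'..b}}"
  have "0 \<in> T0" using \<beta>0(3) ab t1 by (auto simp: T0_def pathstart_def)
  moreover have bT0: "bdd_above T0" by (auto simp: T0_def)
  moreover have "closed T0" unfolding T0_def using closed_pre ab t1 by simp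
  ultimately have "Sup T0 \<in> T0" using closed_contains_Sup by blast
  define t0 where "t0 = Sup T0"
  have t0: "t0 \<in> {0..t1}" "\<beta>0 t0 \<in> g ` {b'..b}" using \<open>Sup T0 \<in> T0\<close> by (auto simp: T0_def t0_def)
  have t0_max: "t \<le> t0" if "t \<in> {0..t1}" "\<beta>0 t \<in> g ` {b'..b}" for t
    unfolding t0_def by (rule cSup_upper[OF _ bT0]) (use that in \<open>simp add: T0_def\<close>)
  obtain A where A: "A \<in> {a..a'}" "\<beta>0 t1 = g A" using t1 by auto
  obtain B where B: "B \<in> {b'..b}" "\<beta>0 t0 = g B" using t0 by auto
  have avoid: "\<beta>0 t \<notin> g ` {a'..b'}" if "t \<in> {0..1}" for t
    using \<beta>0(2) that unfolding path_image_def by blast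
  have "A \<noteq> a'" using avoid[OF t1(1)] A ab by auto
  have "B \<noteq> b'" using avoid[of t0] t0 t1 B ab by auto
  have "g A \<noteq> g B" using inj A B ab unfolding inj_on_def by force
  then have "t0 \<noteq> t1" using A B by metis
  then have "t0 < t1" using t0 by simp
  have "closing_arc g (subpath t0 t1 \<beta>0) A B"
  proof
    show "arc g" by fact
    show "0 \<le> A" "A < B" "B \<le> 1" using A B ab by auto
    show "arc (subpath t0 t1 \<beta>0)" using \<beta>0 t0 t1 \<open>t0 \<noteq> t1\<close> by (intro arc_subpath_arc) auto
    show "pathstart (subpath t0 t1 \<beta>0) = g B" "pathfinish (subpath t0 t1 \<beta>0) = g A" using A B by auto
    show "path_image (subpath t0 t1 \<beta>0) \<inter> g ` {A..B} \<subseteq> {g A, g B}"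
    proof
      fix x assume "x \<in> path_image (subpath t0 t1 \<beta>0) \<inter> g ` {A..B}"
      then obtain t r where tr: "t \<in> {t0..t1}" "x = \<beta>0 t" "r \<in> {A..B}" "x = g r"
        using \<open>t0 < t1\<close> by (auto simp: path_image_subpath)
      have t01: "t \<in> {0..1}" using tr t0 t1 by auto
      consider "r \<in> {a..a'}" | "r \<in> {a'..b'}" | "r \<in> {b'..b}" using tr A B by fastforce
      then show "x \<in> {g A, g B}"
      proof cases
        case 1
        then have "\<beta>0 t \<in> g ` {a..a'}" using tr by (metis imageI)
        then have "t = t1" using t1_min[OF t01] tr by simp
        then show ?thesis using A tr by simp
      next
        case 2
        then have "\<beta>0 t \<in> g ` {a'..b'}" using tr by (metis imageI)
        then show ?thesis using avoid[OF t01] by blast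
      next
        case 3
        then have "\<beta>0 t \<in> g ` {b'..b}" using tr by (metis imageI)
        then have "t = t0" using t0_max[of t] t0 tr by simp
        then show ?thesis using B tr by simp
      qed
    qed
  qed
  moreover have "a \<le> A" "A < a'" "b' < B" "B \<le> b" using A B \<open>A \<noteq> a'\<close> \<open>B \<noteq> b'\<close> by auto
  ultimately show ?thesis using that by blast
qed

section \<open>Outflanking arcs in the complex plane\<close>

text \<open>The new coordinate is prescribed as the inverse of \<open>G\<close> on the added
  stretch, and as \<phi> on \<open>K\<close> and the old stretch. The prescriptions overlap at most
  in \<open>G r\<close>, where they agree, and Dugundji's theorem extends them within the interval.
  The set \<open>K\<close> keeps the bounds obtained at earlier stages.\<close>

lemma arc_coordinate_extend:
  fixes G :: "real \<Rightarrow> 'a::{metric_space,second_countable_topology}"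
  assumes G: "continuous_on {c..e} G" "inj_on G {c..e}" and r: "c \<le> r" "r \<le> r'" "r' \<le> e"
    and \<phi>: "continuous_on UNIV \<phi>" "range \<phi> \<subseteq> {c..r}" "\<And>t. t \<in> {c..r} \<Longrightarrow> \<phi> (G t) = t"
    and K: "closed K" "K \<inter> G ` {r<..r'} = {}"
  obtains \<psi> :: "'a \<Rightarrow> real" where "continuous_on UNIV \<psi>" "range \<psi> \<subseteq> {c..r'}" "\<And>t. t \<in> {c..r'} \<Longrightarrow> \<psi> (G t) = t"
    "\<And>x. x \<in> K \<Longrightarrow> \<psi> x = \<phi> x"
proof -
  define S1 where "S1 = K \<union> G ` {c..r}"
  define S2 where "S2 = G ` {r..r'}"
  define co where "co = inv_into {c..e} G"
  have co: "co (G t) = t" if "t \<in> {c..e}" for t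
    unfolding co_def using inv_into_f_f[OF G(2)] that by simp
  have cont: "continuous_on {u..v} G" if "c \<le> u" "v \<le> e" for u v
    using G(1) that by (auto intro: continuous_on_subset)
  have cl: "closed (G ` {u..v})" if "c \<le> u" "v \<le> e" for u v
    using cont[OF that] by (intro compact_imp_closed compact_continuous_image) auto
  have closed: "closed S1" "closed S2" using K cl r by (auto simp: S1_def S2_def)
  have d1: "continuous_on (S2 \<union> S1) (\<lambda>x. if x \<in> S2 then co x else \<phi> x)"
  proof (rule continuous_on_cases[OF closed(2,1)])
    show "continuous_on S2 co" unfolding S2_def
      by (rule continuous_on_inv) (use cont r co in auto)
    show "continuous_on S1 \<phi>" using \<phi>(1) continuous_on_subset by blast
    have "co x = \<phi> x" if x: "x \<in> S1" "x \<in> S2" for x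
    proof -
      obtain t where t: "t \<in> {r..r'}" "x = G t" using x by (auto simp: S2_def)
      have "t = r"
        using x(1) unfolding S1_def
      proof
        assume "x \<in> K"
        then have "t \<notin> {r<..r'}" using K(2) t by blast
        then show ?thesis using t by auto
      next
        assume "x \<in> G ` {c..r}"
        then obtain t' where "t' \<in> {c..r}" "G t' = G t" using t by auto
        then have "t' = t" using inj_onD[OF G(2)] t r by auto
        then show ?thesis using \<open>t' \<in> {c..r}\<close> t by simp
      qed
      then show ?thesis using t \<phi>(3)[of r] co[of r] r by simp
    qed
    then show "\<forall>x. x \<in> S2 \<and> x \<notin> S2 \<or> x \<in> S1 \<and> x \<in> S2 \<longrightarrow> co x = \<phi> x" by blast
  qed
  have d2: "(\<lambda>x. if x \<in> S2 then co x else \<phi> x) ` (S2 \<union> S1) \<subseteq> {c..r'}"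
  proof -
    have "co x \<in> {c..r'}" if "x \<in> S2" for x
      using that co r by (auto simp: S2_def)
    moreover have "\<phi> x \<in> {c..r'}" for x
    proof -
      have "\<phi> x \<in> {c..r}" using \<phi>(2) by blast
      then show ?thesis using r by simp
    qed
    ultimately show ?thesis by auto
  qed
  have d3: "closedin (top_of_set UNIV) (S2 \<union> S1)" using closed by auto
  have d4: "{c..r'} \<noteq> {}" using r by simp
  obtain \<psi> :: "'a \<Rightarrow> real" where \<psi>: "continuous_on UNIV \<psi>" "\<psi> ` UNIV \<subseteq> {c..r'}"
    "\<And>x. x \<in> S2 \<union> S1 \<Longrightarrow> \<psi> x = (if x \<in> S2 then co x else \<phi> x)"
    by (rule Dugundji[OF convex_real_interval(5) d4 d3 d1 d2]) (rule that)
  show ?thesis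
  proof (rule that[OF \<psi>(1)])
    show "range \<psi> \<subseteq> {c..r'}" using \<psi>(2) .
    show "\<psi> (G t) = t" if t: "t \<in> {c..r'}" for t
    proof (cases "G t \<in> S2")
      case True
      then show ?thesis using \<psi>(3)[of "G t"] co[of t] t r by simp
    next
      case False
      then have "t \<notin> {r..r'}" by (auto simp: S2_def)
      then have "t \<in> {c..r}" using t by auto
      then show ?thesis using \<psi>(3)[of "G t"] \<phi>(3) False by (auto simp: S1_def)
    qed
    show "\<psi> x = \<phi> x" if x: "x \<in> K" for x
    proof (cases "x \<in> S2")
      case True
      then obtain t where t: "t \<in> {r..r'}" "x = G t" by (auto simp: S2_def)
      then have "t \<notin> {r<..r'}" using x K(2) by blast
      then have "t = r" using t by auto
      then show ?thesis using t True \<psi>(3)[of x] \<phi>(3)[of r] co[of r] r by simp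
    next
      case False
      then show ?thesis using \<psi>(3)[of x] x by (simp add: S1_def)
    qed
  qed
qed

text \<open>The complement of \<open>E\<close> is connected, unbounded and disjoint from
  \<open>J\<close>, so it lies in the outside of \<open>J\<close>.\<close>

lemma inside_subset_of_connected_complement:
  fixes E :: "'a::euclidean_space set"
  assumes "2 \<le> DIM('a)" "bounded E" "connected (- E)" "J \<subseteq> E"
  shows "inside J \<subseteq> E"
proof -
  have "\<not> bounded (- E)" using assms(2) cobounded_imp_unbounded by blast
  have "x \<in> outside J" if "x \<in> - E" for x
  proof -
    have "- E \<subseteq> connected_component_set (- J) x"
      using assms that by (intro connected_component_maximal) auto
    then have "\<not> bounded (connected_component_set (- J) x)"
      using \<open>\<not> bounded (- E)\<close> bounded_subset by blast
    then show ?thesis using that assms(4) by (auto simp: outside_def)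
  qed
  then show ?thesis using inside_Int_outside by blast
qed

text \<open>The points w, y, v, u are \<open>g a\<close>, \<open>g b\<close>, \<open>g c\<close>,
  \<open>g 1\<close>. The step structure of the arc enters through \<open>advance\<close>,
  orientation through \<open>local_degree\<close>, and the disc as a bounded set that does not
  separate the plane. Either order of \<open>a\<close> and \<open>c\<close> is possible.\<close>

locale outflanking =
  fixes E U :: "complex set" and f :: "complex \<Rightarrow> complex" and g :: "real \<Rightarrow> complex" and a b c :: real
  assumes arc_g: "arc g" and cont_f: "continuous_on E f"
    and E: "bounded E" "connected (- E)"
    and image: "g ` {0..1} \<subseteq> interior E" "f ` g ` {0..1} \<subseteq> interior E"
    and abc: "0 \<le> a" "a < b" "b \<le> 1" "0 \<le> c" "c < b"
    and advance: "\<And>t. t \<in> {0..a} \<Longrightarrow> \<exists>s\<in>{t<..1}. f (g t) = g s"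
    and fa: "f (g a) = g 1" and fb: "f (g b) = g c"
    and inj_f: "inj_on f (g ` {a..b})"
    and off: "f ` g ` {a<..<b} \<inter> g ` {0..1} = {}"
    and no_return: "f ` g ` {b..1} \<inter> g ` {b..1} = {}"
    and exclusive: "f ` (E - g ` {a<..<b}) \<inter> f ` g ` {a<..<b} = {}"
    and U: "open U" "g a \<in> U" "U \<subseteq> interior E" "inj_on f U"
    and local_degree: "\<And>p r. r > 0 \<Longrightarrow> cball p r \<subseteq> U \<Longrightarrow> winding_number (f \<circ> circlepath p r) (f p) = 1"
begin

lemma path_g: "path g" and inj_g: "inj_on g {0..1}" and cont_g: "continuous_on {0..1} g"
  using arc_g by (auto simp: arc_def path_def)

lemma cont_f_subset: "S \<subseteq> E \<Longrightarrow> continuous_on S f"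
  using cont_f continuous_on_subset by blast

lemma g_in_E: "t \<in> {0..1} \<Longrightarrow> g t \<in> interior E" "t \<in> {0..1} \<Longrightarrow> f (g t) \<in> interior E"
  using image by blast+

lemma interior_E: "z \<in> interior E \<Longrightarrow> z \<in> E"
  using interior_subset by blast

lemma isCont_f: "z \<in> interior E \<Longrightarrow> isCont f z"
  using cont_f_subset[OF interior_subset] continuous_on_eq_continuous_at[OF open_interior] by blast

lemma path_fg: "path (f \<circ> g)"
  unfolding path_def using cont_g cont_f_subset[of "g ` {0..1}"] image(1) interior_subset
  by (intro continuous_on_compose) auto

lemma subpath_fg: "f \<circ> subpath u v g = subpath u v (f \<circ> g)"
  by (simp add: subpath_def o_def)

lemma f_middle: "t \<in> {a<..<b} \<Longrightarrow> s \<in> {0..1} \<Longrightarrow> f (g t) \<noteq> g s"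
  using off by blast

text \<open>By \<open>off\<close> the image of the open stretch from \<open>a\<close> to
  \<open>b\<close> misses the whole arc; the ends \<open>a\<close> and \<open>b\<close> go to
  \<open>g 1\<close> and \<open>g c\<close>.\<close>

sublocale J: closing_arc g "f \<circ> subpath a b g" c 1
proof
  show "arc g" by (rule arc_g)
  show "0 \<le> c" "c < 1" "(1::real) \<le> 1" using abc by auto
  have sub: "arc (subpath a b g)" using arc_g abc by (intro arc_subpath_arc) auto
  have im: "path_image (subpath a b g) = g ` {a..b}" using abc by (simp add: path_image_subpath)
  have "g ` {a..b} \<subseteq> E" using abc g_in_E(1) interior_E by auto
  then have "path (f \<circ> subpath a b g)"
    using sub im by (intro path_continuous_image cont_f_subset) (auto simp: arc_imp_path)
  moreover have "inj_on (f \<circ> subpath a b g) {0..1}"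
    using sub im inj_f unfolding arc_def path_image_def by (intro comp_inj_on) auto
  ultimately show "arc (f \<circ> subpath a b g)" by (simp add: arc_def)
  show "pathstart (f \<circ> subpath a b g) = g 1" "pathfinish (f \<circ> subpath a b g) = g c"
    using fa fb by (simp_all add: pathstart_compose pathfinish_compose)
  show "path_image (f \<circ> subpath a b g) \<inter> g ` {c..1} \<subseteq> {g c, g 1}"
  proof
    fix x assume "x \<in> path_image (f \<circ> subpath a b g) \<inter> g ` {c..1}"
    then obtain t s where ts: "t \<in> {a..b}" "x = f (g t)" "s \<in> {c..1}" "x = g s"
      using im by (auto simp: path_image_compose)
    then have "t \<notin> {a<..<b}" using f_middle[of t s] abc by auto
    then have "t = a \<or> t = b" using ts by auto
    then show "x \<in> {g c, g 1}" using ts fa fb by auto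
  qed
qed

definition J :: "complex set" where
  "J = path_image J.curve"

lemma J_eq: "J = g ` {c..1} \<union> f ` g ` {a..b}"
  using abc by (simp add: J_def J.path_image_curve path_image_compose path_image_subpath)

lemma Jordan_J: "inside J \<noteq> {}" "open (inside J)" "connected (inside J)" "outside J \<noteq> {}" "open (outside J)"
    "inside J \<inter> outside J = {}" "inside J \<union> outside J = - J" "frontier (inside J) = J" "frontier (outside J) = J"
  using Jordan_inside_outside[OF J.simple_curve J.loop_curve] unfolding J_def by auto

definition \<Delta> :: "complex set" where
  "\<Delta> = J \<union> inside J"

lemma \<Delta>_interior_E: "\<Delta> \<subseteq> interior E"
proof -
  have JE: "J \<subseteq> interior E" unfolding J_eq using abc g_in_E by auto
  then have "inside J \<subseteq> E"
    using E interior_subset by (intro inside_subset_of_connected_complement) auto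
  then have "inside J \<subseteq> interior E" using Jordan_J(2) by (simp add: interior_maximal)
  then show ?thesis using JE by (simp add: \<Delta>_def)
qed

text \<open>The counterpart of \<open>winding_number_local\<close> at a point of the image arc. The
  part of \<open>J\<close> on \<open>g\<close> contributes continuously because
  \<open>f (g t)\<close> is not on it.\<close>

lemma winding_number_J_split:
  assumes s: "a \<le> s1" "s1 < t" "t < s2" "s2 \<le> b"
  obtains h where "isCont h (f (g t))"
    "\<And>q. q \<notin> J \<Longrightarrow> winding_number J.curve q = winding_number (subpath s1 s2 (f \<circ> g)) q + h q"
proof -
  define h where "h = (\<lambda>q. winding_number (subpath c 1 g) q + winding_number (subpath a s1 (f \<circ> g)) q + winding_number (subpath s2 b (f \<circ> g)) q)"
  have ne: "f (g t) \<noteq> f (g r)" if r: "r \<in> {a..s1} \<union> {s2..b}" for r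
  proof
    assume "f (g t) = f (g r)"
    moreover have "t \<in> {a..b}" "r \<in> {a..b}" "t \<noteq> r" "t \<in> {0..1}" "r \<in> {0..1}" using r s abc by auto
    ultimately show False using inj_onD[OF inj_f, of "g t" "g r"] inj_onD[OF inj_g, of t r] by blast
  qed
  have "isCont h (f (g t))" unfolding h_def
  proof (intro continuous_intros continuous_at_winding_number)
    have "t \<in> {a<..<b}" "{c..1} \<subseteq> {0..1}" using s abc by auto
    then have "f (g t) \<notin> g ` {c..1}" using f_middle by blast
    then show "f (g t) \<notin> path_image (subpath c 1 g)" using abc by (simp add: path_image_subpath)
    have "f (g t) \<notin> (f \<circ> g) ` {a..s1}" "f (g t) \<notin> (f \<circ> g) ` {s2..b}"
      using ne unfolding image_iff o_def by blast+
    then show "f (g t) \<notin> path_image (subpath a s1 (f \<circ> g))" "f (g t) \<notin> path_image (subpath s2 b (f \<circ> g))"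
      using s by (simp_all add: path_image_subpath)
  qed (use path_g path_fg abc s in \<open>auto simp: path_subpath\<close>)
  moreover have "winding_number J.curve q = winding_number (subpath s1 s2 (f \<circ> g)) q + h q" if q: "q \<notin> J" for q
  proof -
    have "q \<notin> (f \<circ> g) ` {a..b}" using q by (auto simp: J_eq)
    moreover have "{s1..b} \<subseteq> {a..b}" using s by auto
    ultimately have "q \<notin> (f \<circ> g) ` {a..b}" "q \<notin> (f \<circ> g) ` {s1..b}" by blast+
    then have "winding_number (subpath a b (f \<circ> g)) q = winding_number (subpath a s1 (f \<circ> g)) q +
        (winding_number (subpath s1 s2 (f \<circ> g)) q + winding_number (subpath s2 b (f \<circ> g)) q)"
      using s abc path_fg winding_number_subpath_split[of "f \<circ> g" a s1 b q] winding_number_subpath_split[of "f \<circ> g" s1 s2 b q]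
      by simp
    then show ?thesis using J.winding_number_curve[of q] q by (simp add: h_def J_def subpath_fg)
  qed
  ultimately show ?thesis using that by blast
qed

end

lemma frontier_meets_ball:
  fixes x :: "'a::metric_space"
  assumes "frontier S = K" "x \<in> K" "\<eta> > 0"
  obtains i where "i \<in> S" "i \<in> ball x \<eta>"
  using assms closure_approachable[of x S] by (metis DiffD1 dist_commute frontier_def mem_ball)

section \<open>Sides of the arc and sides of its image\<close>

context outflanking
begin

context
  fixes A B :: real and \<beta> :: "real \<Rightarrow> complex"
  assumes C: "closing_arc g \<beta> A B" and AB: "a < A" "B < b"
begin

interpretation C: closing_arc g \<beta> A B
  by (rule C)

text \<open>Crossing the arc changes both winding numbers by one; that their difference stays constant near a point
  of the arc says that \<open>f\<close> maps the left side of the arc to the left side of its image there.\<close>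

definition index_gap :: "complex \<Rightarrow> complex" where
  "index_gap p = winding_number C.curve p - winding_number J.curve (f p)"

definition flat_at :: "real \<Rightarrow> bool" where
  "flat_at t \<longleftrightarrow> (\<exists>\<delta>>0. \<exists>k. \<forall>p \<in> ball (g t) \<delta> - path_image C.curve. index_gap p = k)"

lemma AB_sub: "t \<in> {A<..<B} \<Longrightarrow> t \<in> {a<..<b} \<and> t \<in> {0..1}"
  using AB abc by auto

text \<open>A point near \<open>g t\<close> but off the curve is off the whole open stretch from
  \<open>a\<close> to \<open>b\<close>, so \<open>exclusive\<close> keeps its image off the image of
  that stretch. By continuity its image is also off \<open>g\<close>, since \<open>f (g t)\<close>
  is; this covers the rest of \<open>J\<close>, including the ends of the image arc.\<close>

lemma image_near_avoids_J:
  assumes t: "t \<in> {A<..<B}"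
  obtains \<epsilon> where "\<epsilon> > 0" "ball (g t) \<epsilon> \<subseteq> interior E" "\<And>p. p \<in> ball (g t) \<epsilon> - path_image C.curve \<Longrightarrow> f p \<notin> J"
proof -
  have tt: "t \<in> {a<..<b}" "t \<in> {0..1}" using AB_sub[OF t] by auto
  have con: "continuous_on {u..v} g" if "0 \<le> u" "v \<le> 1" for u v
    using cont_g that by (auto intro: continuous_on_subset)
  have cl: "closed (g ` {u..v})" if "0 \<le> u" "v \<le> 1" for u v
    using con[OF that] by (intro compact_imp_closed compact_continuous_image) auto
  define W where "W = (interior E \<inter> f -` (- g ` {0..1})) \<inter> - (g ` {0..A} \<union> g ` {B..1})"
  have "open W" unfolding W_def
    using cl[of 0 1] cl[of 0 A] cl[of B 1] AB abc C.AB
    by (intro open_Int continuous_open_preimage cont_f_subset interior_subset open_Compl closed_Un) auto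
  moreover have "g t \<in> W"
  proof -
    have "f (g t) \<notin> g ` {0..1}" using f_middle[OF tt(1)] by blast
    moreover have "g t \<noteq> g r" if "r \<in> {0..A} \<union> {B..1}" for r
      using inj_onD[OF inj_g, of t r] that t tt AB abc C.AB by auto
    ultimately show ?thesis unfolding W_def using g_in_E(1)[OF tt(2)] by blast
  qed
  ultimately obtain \<epsilon> where \<epsilon>: "\<epsilon> > 0" "ball (g t) \<epsilon> \<subseteq> W" using open_contains_ball by blast
  show ?thesis
  proof (rule that[OF \<epsilon>(1)])
    show "ball (g t) \<epsilon> \<subseteq> interior E" using \<epsilon>(2) by (auto simp: W_def)
    fix p assume p: "p \<in> ball (g t) \<epsilon> - path_image C.curve"
    then have pW: "p \<in> interior E" "f p \<notin> g ` {0..1}" "p \<notin> g ` {0..A}" "p \<notin> g ` {B..1}" "p \<notin> g ` {A..B}"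
      using \<epsilon>(2) by (auto simp: W_def C.path_image_curve)
    have "p \<notin> g ` {a<..<b}"
    proof -
      have "{a<..<b} \<subseteq> {0..A} \<union> {A..B} \<union> {B..1}" using abc by auto
      then show ?thesis using pW by blast
    qed
    then have m: "f p \<notin> f ` g ` {a<..<b}" using exclusive pW(1) interior_E by blast
    have "f p \<noteq> f (g r)" if r: "r \<in> {a..b}" for r
    proof -
      consider "r \<in> {a<..<b}" | "r = a" | "r = b" using r by fastforce
      then show ?thesis
      proof cases
        case 1
        then show ?thesis using m by (metis imageI)
      next
        case 2
        then show ?thesis using pW(2) fa abc by (metis atLeastAtMost_iff imageI order_refl zero_le_one)
      next
        case 3
        then show ?thesis using pW(2) fb abc by (metis atLeastAtMost_iff imageI less_imp_le order_trans)
      qed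
    qed
    then have "f p \<notin> f ` g ` {a..b}" by blast
    moreover have "g ` {c..1} \<subseteq> g ` {0..1}" using abc by (intro image_mono) auto
    ultimately show "f p \<notin> J" unfolding J_eq using pW(2) by blast
  qed
qed

text \<open>Two such points are joined off the curve inside a ball in which all points off the curve
  have images off \<open>J\<close>, so neither winding number changes on the way.\<close>

lemma index_gap_side:
  assumes t: "t \<in> {A<..<B}"
  obtains \<delta> where "\<delta> > 0" "\<And>p q. \<lbrakk>p \<in> ball (g t) \<delta>; q \<in> ball (g t) \<delta>;
      p \<in> inside (path_image C.curve) \<and> q \<in> inside (path_image C.curve) \<or>
      p \<in> outside (path_image C.curve) \<and> q \<in> outside (path_image C.curve)\<rbrakk> \<Longrightarrow> index_gap p = index_gap q"
proof -
  obtain \<epsilon> where \<epsilon>: "\<epsilon> > 0" "ball (g t) \<epsilon> \<subseteq> interior E" "\<And>p. p \<in> ball (g t) \<epsilon> - path_image C.curve \<Longrightarrow> f p \<notin> J"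
    by (rule image_near_avoids_J[OF t]) (rule that)
  obtain \<delta> where \<delta>: "\<delta> > 0"
    "\<And>p q. \<lbrakk>p \<in> ball (g t) \<delta>; q \<in> ball (g t) \<delta>; p \<in> inside (path_image C.curve) \<and> q \<in> inside (path_image C.curve) \<or>
        p \<in> outside (path_image C.curve) \<and> q \<in> outside (path_image C.curve)\<rbrakk>
      \<Longrightarrow> connected_component (ball (g t) \<epsilon> - path_image C.curve) p q"
    by (rule C.local_sides[OF t \<epsilon>(1)]) (rule that)
  show ?thesis
  proof (rule that[OF \<delta>(1)])
    fix p q
    assume "p \<in> ball (g t) \<delta>" "q \<in> ball (g t) \<delta>"
      "p \<in> inside (path_image C.curve) \<and> q \<in> inside (path_image C.curve) \<or>
       p \<in> outside (path_image C.curve) \<and> q \<in> outside (path_image C.curve)"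
    then obtain T where T: "connected T" "T \<subseteq> ball (g t) \<epsilon> - path_image C.curve" "p \<in> T" "q \<in> T"
      using \<delta>(2) unfolding connected_component_def by meson
    have "winding_number C.curve p = winding_number C.curve q"
      by (rule winding_number_eq[OF C.path_curve C.loop_curve T(3,4,1)]) (use T(2) in blast)
    moreover have "winding_number J.curve (f p) = winding_number J.curve (f q)"
    proof (rule winding_number_eq[OF J.path_curve J.loop_curve, of _ "f ` T"])
      have "T \<subseteq> E" using T(2) \<epsilon>(2) interior_subset by blast
      then show "connected (f ` T)" using T(1) by (intro connected_continuous_image cont_f_subset)
      show "f ` T \<inter> path_image J.curve = {}" using T(2) \<epsilon>(3) unfolding J_def by blast
    qed (use T in auto)
    ultimately show "index_gap p = index_gap q" by (simp add: index_gap_def)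
  qed
qed

lemma Jordan_C: "inside (path_image C.curve) \<union> outside (path_image C.curve) = - path_image C.curve"
    "frontier (inside (path_image C.curve)) = path_image C.curve" "frontier (outside (path_image C.curve)) = path_image C.curve"
  using Jordan_inside_outside[OF C.simple_curve C.loop_curve] by auto

text \<open>In a small ball about a point of the arc the gap has one value on each side. Flatness at
  one arc point in the ball, which both sides approach, makes the two values equal, and this gives
  flatness at all other arc points in the ball.\<close>

lemma flat_at_propagates:
  assumes t1: "t1 \<in> {A<..<B}" and t2: "t2 \<in> {A<..<B}" and flat: "flat_at t1"
  shows "flat_at t2"
proof (rule connected_induction_simple[of "{A<..<B}" t1 t2 flat_at])
  let ?I = "inside (path_image C.curve)" and ?O = "outside (path_image C.curve)"
  fix t assume t: "t \<in> {A<..<B}"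
  obtain \<delta> where \<delta>: "\<delta> > 0" "\<And>p q. \<lbrakk>p \<in> ball (g t) \<delta>; q \<in> ball (g t) \<delta>; p \<in> ?I \<and> q \<in> ?I \<or> p \<in> ?O \<and> q \<in> ?O\<rbrakk> \<Longrightarrow> index_gap p = index_gap q"
    by (rule index_gap_side[OF t]) (rule that)
  define T where "T = {A<..<B} \<inter> g -` ball (g t) \<delta>"
  have "continuous_on {A<..<B} g" using cont_g AB_sub by (auto intro: continuous_on_subset)
  then have "openin (top_of_set {A<..<B}) T" unfolding T_def by (intro continuous_openin_preimage_gen open_ball)
  moreover have "t \<in> T" using t \<delta> by (simp add: T_def)
  moreover have "flat_at y" if x: "x \<in> T" and y: "y \<in> T" and flat_x: "flat_at x" for x y
  proof -
    obtain \<delta>' k where k: "\<delta>' > 0" "\<And>p. p \<in> ball (g x) \<delta>' - path_image C.curve \<Longrightarrow> index_gap p = k"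
      using flat_x unfolding flat_at_def by blast
    have near: "\<exists>\<eta>>0. ball (g s) \<eta> \<subseteq> ball (g t) \<delta>" if "s \<in> T" for s
      using that open_contains_ball[of "ball (g t) \<delta>"] by (auto simp: T_def)
    obtain \<eta> where \<eta>: "\<eta> > 0" "ball (g x) \<eta> \<subseteq> ball (g t) \<delta>" using near[OF x] by blast
    have gx: "g x \<in> path_image C.curve" using x by (auto simp: T_def C.path_image_curve)
    have min: "min \<eta> \<delta>' > 0" using \<eta> k by simp
    obtain i where i: "i \<in> ?I" "i \<in> ball (g x) (min \<eta> \<delta>')" by (rule frontier_meets_ball[OF Jordan_C(2) gx min])
    obtain o' where o': "o' \<in> ?O" "o' \<in> ball (g x) (min \<eta> \<delta>')" by (rule frontier_meets_ball[OF Jordan_C(3) gx min])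
    have "i \<notin> path_image C.curve" "o' \<notin> path_image C.curve" using i(1) o'(1) Jordan_C(1) by blast+
    moreover have "i \<in> ball (g x) \<delta>'" "o' \<in> ball (g x) \<delta>'" "i \<in> ball (g x) \<eta>" "o' \<in> ball (g x) \<eta>" using i o' by auto
    ultimately have io: "index_gap i = k" "index_gap o' = k" "i \<in> ball (g t) \<delta>" "o' \<in> ball (g t) \<delta>"
      using k(2) \<eta>(2) by blast+
    have all: "index_gap p = k" if "p \<in> ball (g t) \<delta> - path_image C.curve" for p
    proof -
      have "p \<in> ?I \<or> p \<in> ?O" using that Jordan_C(1) by blast
      then show ?thesis using \<delta>(2)[of p i] \<delta>(2)[of p o'] io i(1) o'(1) that by auto
    qed
    obtain \<eta>' where \<eta>': "\<eta>' > 0" "ball (g y) \<eta>' \<subseteq> ball (g t) \<delta>" using near[OF y] by blast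
    have "index_gap p = k" if "p \<in> ball (g y) \<eta>' - path_image C.curve" for p
      by (rule all) (use that \<eta>'(2) in blast)
    then show ?thesis unfolding flat_at_def using \<eta>'(1) by (intro exI[of _ \<eta>'] exI[of _ k] conjI ballI)
  qed
  ultimately show "\<exists>T. openin (top_of_set {A<..<B}) T \<and> t \<in> T \<and> (\<forall>x\<in>T. \<forall>y\<in>T. flat_at x \<longrightarrow> flat_at y)" by blast
qed (use t1 t2 flat in auto)

text \<open>Close a short stretch of the arc by a path \<kappa> inside \<open>U\<close> that avoids
  \<open>z\<close>. As the local degree is 1, the loop winds around \<open>p\<close> as often as its
  image winds around \<open>f p\<close>. This replaces the contributions of the short stretch to the
  gap, the only ones that jump at \<open>z\<close>, by those of \<kappa> and its image, which are
  continuous there.\<close>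

lemma flat_at_orientation:
  assumes t: "t \<in> {A<..<B}" and tU: "g t \<in> U"
  shows "flat_at t"
proof -
  define z where "z = g t"
  have tt: "t \<in> {a<..<b}" "t \<in> {0..1}" using AB_sub[OF t] by auto
  have zE: "z \<in> interior E" using g_in_E(1)[OF tt(2)] by (simp add: z_def)
  obtain \<rho> where \<rho>: "\<rho> > 0" "ball z \<rho> \<subseteq> U" using U(1) tU open_contains_ball unfolding z_def by blast
  obtain \<epsilon> where \<epsilon>: "\<epsilon> > 0" "\<And>p. p \<in> ball z \<epsilon> - path_image C.curve \<Longrightarrow> f p \<notin> J"
    by (rule image_near_avoids_J[OF t, folded z_def]) (rule that)
  obtain d where d: "d > 0" "\<And>s. s \<in> {0..1} \<Longrightarrow> dist s t < d \<Longrightarrow> dist (g s) (g t) < \<rho> / 2"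
    using cont_g tt(2) \<rho>(1) unfolding continuous_on_iff by (metis half_gt_zero)
  define \<sigma> where "\<sigma> = min (d / 2) (min ((t - A) / 2) ((B - t) / 2))"
  define s1 where "s1 = t - \<sigma>"
  define s2 where "s2 = t + \<sigma>"
  have \<sigma>: "0 < \<sigma>" "\<sigma> < d" "A < t - \<sigma>" "t + \<sigma> < B" using d t by (auto simp: \<sigma>_def min_def field_simps)
  then have s: "A < s1" "s1 < t" "t < s2" "s2 < B" by (auto simp: s1_def s2_def)
  have les: "A \<le> s1" "s2 \<le> B" "a \<le> s1" "s2 \<le> b" using s AB by auto
  have s01: "s1 \<in> {0..1}" "s2 \<in> {0..1}" using s C.AB by auto
  have gs: "g r \<in> ball z (\<rho> / 2)" if "r \<in> {s1..s2}" for r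
  proof -
    have "r \<in> {0..1}" "dist r t < d" using that \<sigma> s01 by (auto simp: s1_def s2_def dist_real_def)
    then show ?thesis using d(2) by (simp add: z_def dist_commute)
  qed
  obtain h1 where h1: "isCont h1 z"
    "\<And>p. p \<notin> path_image C.curve \<Longrightarrow> winding_number C.curve p = winding_number (subpath s1 s2 g) p + h1 p"
    by (rule C.winding_number_local[OF les(1) s(2,3) les(2), folded z_def]) (rule that)
  obtain h2 where h2: "isCont h2 (f z)"
    "\<And>q. q \<notin> J \<Longrightarrow> winding_number J.curve q = winding_number (subpath s1 s2 (f \<circ> g)) q + h2 q"
    by (rule winding_number_J_split[OF les(3) s(2,3) les(4), folded z_def]) (rule that)
  have ne: "g r \<noteq> z" if "r \<in> {s1, s2}" for r
    using inj_onD[OF inj_g, of r t] that s s01 tt(2) by (auto simp: z_def)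
  have "path_connected (ball z (\<rho> / 2) - {z})"
    using connected_punctured_ball[of z "\<rho> / 2"] by (intro connected_open_path_connected) auto
  moreover have "g s2 \<in> ball z (\<rho> / 2) - {z}" "g s1 \<in> ball z (\<rho> / 2) - {z}"
    using gs ne s by auto
  ultimately obtain \<kappa> where \<kappa>: "path \<kappa>" "path_image \<kappa> \<subseteq> ball z (\<rho> / 2) - {z}" "pathstart \<kappa> = g s2" "pathfinish \<kappa> = g s1"
    unfolding path_connected_def by metis
  have half: "ball z (\<rho> / 2) \<subseteq> U" using \<rho> subset_ball[of "\<rho> / 2" \<rho> z] by auto
  have UE: "U \<subseteq> E" using U(3) interior_subset by blast
  have path_f\<kappa>: "path (f \<circ> \<kappa>)"
    using \<kappa>(1,2) half UE by (intro path_continuous_image cont_f_subset) auto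
  have fz: "f z \<notin> path_image (f \<circ> \<kappa>)"
  proof
    assume "f z \<in> path_image (f \<circ> \<kappa>)"
    then obtain x where "x \<in> path_image \<kappa>" "f x = f z" by (auto simp: path_image_compose)
    moreover from this have "x \<in> U" "x \<noteq> z" using \<kappa>(2) half by blast+
    moreover have "z \<in> U" using tU by (simp add: z_def)
    ultimately show False using inj_onD[OF U(4), of x z] by blast
  qed
  define F where "F = (\<lambda>p. h1 p - h2 (f p) + winding_number (f \<circ> \<kappa>) (f p) - winding_number \<kappa> p)"
  have contF: "isCont F z" unfolding F_def
  proof (intro continuous_intros h1(1))
    show "isCont (\<lambda>p. h2 (f p)) z" by (rule isCont_o2[OF isCont_f[OF zE] h2(1)])
    show "isCont (\<lambda>p. winding_number (f \<circ> \<kappa>) (f p)) z"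
      by (rule isCont_o2[OF isCont_f[OF zE] continuous_at_winding_number[OF path_f\<kappa> fz]])
    show "isCont (winding_number \<kappa>) z" using \<kappa> by (intro continuous_at_winding_number) auto
  qed
  have "open (- path_image \<kappa>)" "z \<in> - path_image \<kappa>" using \<kappa> by (auto simp: closed_path_image open_Compl)
  then obtain \<delta>\<kappa> where \<delta>\<kappa>: "\<delta>\<kappa> > 0" "ball z \<delta>\<kappa> \<subseteq> - path_image \<kappa>" using open_contains_ball by metis
  \<comment> \<open>For \<open>p\<close> within \<open>\<rho> / 4\<close> of \<open>z\<close>, the
    loop, which stays within \<open>\<rho> / 2\<close> of \<open>z\<close>, lies in the ball of
    radius \<open>3 * \<rho> / 4\<close> about \<open>p\<close>, and that ball lies in
    \<open>U\<close>.\<close>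
  define \<epsilon>' where "\<epsilon>' = min \<epsilon> (min \<delta>\<kappa> (\<rho> / 4))"
  have \<epsilon>': "\<epsilon>' > 0" using \<epsilon> \<delta>\<kappa> \<rho> by (simp add: \<epsilon>'_def)
  have gap: "index_gap p = F p" "index_gap p \<in> \<int>" if p: "p \<in> ball z \<epsilon>' - path_image C.curve" for p
  proof -
    have p1: "p \<in> ball z \<epsilon>" "p \<in> ball z \<delta>\<kappa>" "p \<in> ball z (\<rho> / 4)" "p \<notin> path_image C.curve"
      using p by (auto simp: \<epsilon>'_def)
    have fpJ: "f p \<notin> J" using \<epsilon>(2) p1 by blast
    define \<omega> where "\<omega> = subpath s1 s2 g +++ \<kappa>"
    have sub: "path (subpath s1 s2 g)" using path_g s01 by (simp add: path_subpath)
    have imsub: "path_image (subpath s1 s2 g) = g ` {s1..s2}" using s by (simp add: path_image_subpath)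
    have "p \<notin> g ` {s1..s2}"
    proof -
      have "{s1..s2} \<subseteq> {A..B}" using s by auto
      then show ?thesis using p1(4) unfolding C.path_image_curve by blast
    qed
    moreover have p\<kappa>: "p \<notin> path_image \<kappa>" using p1(2) \<delta>\<kappa>(2) by blast
    ultimately have psub: "p \<notin> path_image (subpath s1 s2 g)" using imsub by simp
    have loop: "path \<omega>" "pathfinish \<omega> = pathstart \<omega>" using sub \<kappa> by (auto simp: \<omega>_def)
    have im\<omega>: "path_image \<omega> = g ` {s1..s2} \<union> path_image \<kappa>"
      unfolding \<omega>_def using \<kappa>(3) imsub by (simp add: path_image_join)
    have im\<omega>U: "path_image \<omega> \<subseteq> ball z (\<rho> / 2)" unfolding im\<omega> using gs \<kappa>(2) by blast
    have "path_image \<omega> \<subseteq> ball p (3 * \<rho> / 4) - {p}"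
    proof
      fix x assume x: "x \<in> path_image \<omega>"
      then have "dist z x < \<rho> / 2" "dist z p < \<rho> / 4" using im\<omega>U p1(3) by auto
      then have "dist p x < 3 * \<rho> / 4" using dist_triangle[of p x z] by (simp add: dist_commute)
      moreover have "x \<noteq> p" using x psub p\<kappa> unfolding im\<omega> imsub by blast
      ultimately show "x \<in> ball p (3 * \<rho> / 4) - {p}" by simp
    qed
    moreover have sub34: "ball p (3 * \<rho> / 4) \<subseteq> U"
    proof
      fix x assume "x \<in> ball p (3 * \<rho> / 4)"
      then have "dist z x < \<rho>" using p1(3) dist_triangle[of z x p] by auto
      then show "x \<in> U" using \<rho>(2) by auto
    qed
    moreover have "cball p (\<rho> / 2) \<subseteq> ball p (3 * \<rho> / 4)" using \<rho>(1) by auto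
    moreover have "p \<in> U" using sub34 \<rho>(1) by auto
    ultimately have comp: "winding_number (f \<circ> \<omega>) (f p) = winding_number \<omega> p"
      using \<rho>(1) loop local_degree[of "\<rho> / 2" p] UE inj_onD[OF U(4), of _ p]
      by (intro winding_number_compose_loop[of p "3 * \<rho> / 4" f "\<rho> / 2" \<omega>] cont_f_subset) (auto simp: subset_iff)
    have avoid: "f p \<notin> f ` S" if "S \<subseteq> ball z (\<rho> / 2)" "p \<notin> S" for S
      using that half inj_onD[OF U(4), of p] \<open>p \<in> U\<close> by blast
    have "f p \<notin> path_image (f \<circ> subpath s1 s2 g)" "f p \<notin> path_image (f \<circ> \<kappa>)"
      unfolding path_image_compose imsub
      using avoid[of "g ` {s1..s2}"] avoid[of "path_image \<kappa>"] psub p\<kappa> im\<omega>U unfolding imsub im\<omega> by auto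
    moreover have "path (f \<circ> subpath s1 s2 g)" unfolding subpath_fg using path_fg s01 by (simp add: path_subpath)
    moreover have "f \<circ> \<omega> = (f \<circ> subpath s1 s2 g) +++ (f \<circ> \<kappa>)" by (simp add: \<omega>_def path_compose_join)
    ultimately have "winding_number (f \<circ> \<omega>) (f p) = winding_number (f \<circ> subpath s1 s2 g) (f p) + winding_number (f \<circ> \<kappa>) (f p)"
      using path_f\<kappa> \<kappa>(3) by (simp add: winding_number_join pathfinish_compose pathstart_compose)
    moreover have "winding_number \<omega> p = winding_number (subpath s1 s2 g) p + winding_number \<kappa> p"
      unfolding \<omega>_def using sub psub \<kappa> p\<kappa> by (intro winding_number_join) auto
    ultimately show "index_gap p = F p"
      using h1(2)[OF p1(4)] h2(2)[OF fpJ] comp unfolding index_gap_def F_def subpath_fg by (simp add: algebra_simps)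
    show "index_gap p \<in> \<int>" unfolding index_gap_def
      using C.Ints_winding_number_curve[OF p1(4)] J.Ints_winding_number_curve fpJ unfolding J_def by (intro Ints_diff)
  qed
  obtain \<delta> k where \<delta>: "\<delta> > 0" "\<And>p. p \<in> ball z \<delta> - path_image C.curve \<Longrightarrow> index_gap p = k"
    by (rule isCont_Ints_locally_constant[OF contF \<epsilon>', of "path_image C.curve" index_gap])
      (erule gap(1), erule gap(2), rule that)
  show ?thesis unfolding flat_at_def z_def[symmetric]
    using \<delta> by (intro exI[of _ \<delta>] exI[of _ k] conjI ballI)
qed

text \<open>For \<open>c < t\<close> the auxiliary curve and \<open>J\<close> coincide near
  \<open>g t\<close>, and the jumps of their winding numbers cancel. Flatness then says that the
  winding number of \<open>J\<close> at \<open>f p\<close> is that at \<open>p\<close> minus a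
  constant \<open>k\<close>, and \<open>k\<close> vanishes because points on both sides of
  \<open>J\<close> are available.\<close>

lemma flat_at_imp_inward:
  assumes t: "t \<in> {A<..<B}" "c < t" and flat: "flat_at t"
  shows "\<exists>\<delta>>0. \<forall>p \<in> ball (g t) \<delta> \<inter> \<Delta>. f p \<in> \<Delta>"
proof -
  define z where "z = g t"
  define m where "m = max A c"
  have tt: "t \<in> {a<..<b}" "t \<in> {0..1}" using AB_sub[OF t(1)] by auto
  have m: "A \<le> m" "c \<le> m" "m < t" "0 \<le> m" using t abc by (auto simp: m_def)
  have con: "continuous_on {u..v} g" if "0 \<le> u" "v \<le> 1" for u v
    using cont_g that by (auto intro: continuous_on_subset)
  have cl: "closed (g ` {u..v})" if "0 \<le> u" "v \<le> 1" for u v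
    using con[OF that] by (intro compact_imp_closed compact_continuous_image) auto
  have z_ne: "z \<noteq> g r" if "r \<in> {0..m} \<union> {B..1}" for r
    using inj_onD[OF inj_g, of t r] that t tt m C.AB by (auto simp: z_def)
  \<comment> \<open>It contains all of both curves except a common stretch of \<open>g\<close>
    around \<open>t\<close>.\<close>
  define K where "K = (g ` {0..m} \<union> g ` {B..1}) \<union> (path_image \<beta> \<union> path_image (f \<circ> subpath a b g))"
  have "closed K" unfolding K_def
    using cl[of 0 m] cl[of B 1] m tt C.AB C.arc_\<beta>(1) J.arc_\<beta>(1)
    by (intro closed_Un closed_arc_image) auto
  then have "open (- K)" by auto
  moreover have "z \<in> - K"
  proof -
    have "z \<notin> path_image \<beta>" using C.interior_point_notin_closing[OF t(1)] by (simp add: z_def)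
    moreover have "t \<in> {c<..<1}" using t(2) tt abc by auto
    then have "z \<notin> path_image (f \<circ> subpath a b g)" using J.interior_point_notin_closing by (simp add: z_def)
    ultimately show ?thesis using z_ne unfolding K_def by blast
  qed
  ultimately obtain \<eta> where \<eta>: "\<eta> > 0" "ball z \<eta> \<subseteq> - K" using open_contains_ball by metis
  have near: "p \<in> path_image C.curve \<longleftrightarrow> p \<in> J" "p \<in> J \<Longrightarrow> p \<in> g ` {a..b}" if p: "p \<in> ball z \<eta>" for p
  proof -
    have pK: "p \<notin> g ` {0..m}" "p \<notin> g ` {B..1}" "p \<notin> path_image \<beta>" "p \<notin> path_image (f \<circ> subpath a b g)"
      using p \<eta>(2) unfolding K_def by blast+
    have "{A..B} \<subseteq> {0..m} \<union> {m<..<B} \<union> {B..1}" "{c..1} \<subseteq> {0..m} \<union> {m<..<B} \<union> {B..1}"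
      "{m<..<B} \<subseteq> {A..B}" "{m<..<B} \<subseteq> {c..1}" "{m<..<B} \<subseteq> {a..b}"
      using m AB C.AB abc by auto
    then have "p \<in> g ` {A..B} \<longleftrightarrow> p \<in> g ` {m<..<B}" "p \<in> g ` {c..1} \<longleftrightarrow> p \<in> g ` {m<..<B}"
      "p \<in> g ` {m<..<B} \<Longrightarrow> p \<in> g ` {a..b}"
      using pK(1,2) by blast+
    then show "p \<in> path_image C.curve \<longleftrightarrow> p \<in> J" "p \<in> J \<Longrightarrow> p \<in> g ` {a..b}"
      unfolding C.path_image_curve J_def J.path_image_curve using pK(3,4) by blast+
  qed
  obtain \<epsilon> where \<epsilon>: "\<epsilon> > 0" "\<And>p. p \<in> ball z \<epsilon> - path_image C.curve \<Longrightarrow> f p \<notin> J"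
    by (rule image_near_avoids_J[OF t(1), folded z_def]) (rule that)
  define s1 where "s1 = (m + t) / 2"
  define s2 where "s2 = (t + B) / 2"
  have s: "A \<le> s1" "c \<le> s1" "s1 < t" "t < s2" "s2 \<le> B" "s2 \<le> 1" using m t C.AB by (auto simp: s1_def s2_def)
  obtain h1 where h1: "isCont h1 z"
    "\<And>p. p \<notin> path_image C.curve \<Longrightarrow> winding_number C.curve p = winding_number (subpath s1 s2 g) p + h1 p"
    by (rule C.winding_number_local[OF s(1,3,4,5), folded z_def]) (rule that)
  obtain h0 where h0: "isCont h0 z"
    "\<And>p. p \<notin> J \<Longrightarrow> winding_number J.curve p = winding_number (subpath s1 s2 g) p + h0 p"
    by (rule J.winding_number_local[OF s(2,3,4,6), folded z_def J_def]) (rule that)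
  define D where "D = (\<lambda>p. winding_number C.curve p - winding_number J.curve p)"
  have contF: "isCont (\<lambda>p. h1 p - h0 p) z" using h1(1) h0(1) by (intro continuous_intros)
  have D: "D p = h1 p - h0 p" "D p \<in> \<int>" if p: "p \<in> ball z \<eta> - J" for p
  proof -
    have pC: "p \<notin> path_image C.curve" "p \<notin> J" using near(1) p by blast+
    show "D p = h1 p - h0 p" using h1(2)[OF pC(1)] h0(2)[OF pC(2)] by (simp add: D_def)
    show "D p \<in> \<int>" unfolding D_def
      using C.Ints_winding_number_curve[OF pC(1)] J.Ints_winding_number_curve pC(2) unfolding J_def by (intro Ints_diff)
  qed
  obtain \<delta>0 k0 where k0: "\<delta>0 > 0" "\<And>p. p \<in> ball z \<delta>0 - J \<Longrightarrow> D p = k0"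
    by (rule isCont_Ints_locally_constant[OF contF \<eta>(1), of J D]) (erule D(1), erule D(2), rule that)
  obtain \<delta>1 k1 where k1: "\<delta>1 > 0" "\<And>p. p \<in> ball z \<delta>1 - path_image C.curve \<Longrightarrow> index_gap p = k1"
    using flat unfolding flat_at_def z_def[symmetric] by blast
  define \<delta> where "\<delta> = min (min \<eta> \<epsilon>) (min \<delta>0 \<delta>1)"
  have \<delta>: "\<delta> > 0" using \<eta> \<epsilon> k0 k1 by (simp add: \<delta>_def)
  define k where "k = k1 - k0"
  have small: "winding_number J.curve (f p) = winding_number J.curve p - k" "f p \<notin> J" if p: "p \<in> ball z \<delta>" "p \<notin> J" for p
  proof -
    have pb: "p \<in> ball z \<eta>" "p \<in> ball z \<epsilon>" "p \<in> ball z \<delta>0" "p \<in> ball z \<delta>1" using p(1) by (auto simp: \<delta>_def)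
    have "p \<notin> path_image C.curve" using near(1)[OF pb(1)] p(2) by blast
    then have "index_gap p = k1" "D p = k0" "f p \<notin> J" using k0(2)[of p] k1(2)[of p] \<epsilon>(2)[of p] pb p(2) by blast+
    then show "winding_number J.curve (f p) = winding_number J.curve p - k" "f p \<notin> J"
      unfolding index_gap_def D_def k_def by (auto simp: algebra_simps)
  qed
  obtain s :: complex where s1: "s \<noteq> 0" and s_in: "\<And>p. p \<in> inside J \<Longrightarrow> winding_number J.curve p = s"
    using simple_closed_path_winding_number_inside[OF J.simple_curve] unfolding J_def[symmetric]
    by (metis neg_equal_0_iff_equal zero_neq_one)
  have s_out: "winding_number J.curve p = 0" if "p \<in> outside J" for p
    using winding_number_zero_in_outside[OF J.path_curve J.loop_curve] that unfolding J_def by blast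
  have s_cases: "winding_number J.curve p \<in> {0, s}" if "p \<notin> J" for p
    using s_in s_out that Jordan_J(7) by blast
  have zJ: "z \<in> J" using t(2) tt unfolding z_def J_eq by auto
  obtain i where i: "i \<in> inside J" "i \<in> ball z \<delta>" by (rule frontier_meets_ball[OF Jordan_J(8) zJ \<delta>])
  obtain o' where o': "o' \<in> outside J" "o' \<in> ball z \<delta>" by (rule frontier_meets_ball[OF Jordan_J(9) zJ \<delta>])
  have iJ: "i \<notin> J" "o' \<notin> J" using i(1) o'(1) Jordan_J(7) by blast+
  have "s - k \<in> {0, s}" using small[OF i(2) iJ(1)] s_cases s_in[OF i(1)] by metis
  moreover have "- k \<in> {0, s}" using small[OF o'(2) iJ(2)] s_cases s_out[OF o'(1)] by (metis diff_0)
  \<comment> \<open>An inside point leaves \<open>k = 0\<close> or \<open>k = s\<close>, an outside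
    point leaves \<open>k = 0\<close> or \<open>k = - s\<close>, and \<open>s\<close> is not
    0.\<close>
  ultimately have "k = 0" using s1 by (auto simp: eq_neg_iff_add_eq_0)
  show ?thesis unfolding z_def[symmetric]
  proof (intro exI[of _ \<delta>] conjI ballI \<delta>)
    fix p assume p: "p \<in> ball z \<delta> \<inter> \<Delta>"
    show "f p \<in> \<Delta>"
    proof (cases "p \<in> J")
      case True
      have "p \<in> ball z \<eta>" using p by (auto simp: \<delta>_def)
      then have "p \<in> g ` {a..b}" using near(2) True by blast
      then show ?thesis unfolding \<Delta>_def J_eq by blast
    next
      case False
      then have "p \<in> inside J" using p by (auto simp: \<Delta>_def)
      then have "winding_number J.curve (f p) = s" "f p \<notin> J"
        using small[of p] p False s_in \<open>k = 0\<close> by auto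
      then have "f p \<notin> outside J" using s_out s1 by metis
      then show ?thesis using \<open>f p \<notin> J\<close> Jordan_J(7) unfolding \<Delta>_def by blast
    qed
  qed
qed

end

text \<open>Orientation is known around \<open>g a\<close>, an end of the open stretch, so flatness
  is started at \<open>t0\<close> slightly after \<open>a\<close> and carried to \<open>t\<close>
  along a curve containing both points. In general \<open>J\<close> cannot be that curve, as
  \<open>t0\<close> may come before \<open>c\<close>.\<close>

lemma image_inward:
  assumes t: "t \<in> {a<..<b}" "c < t"
  shows "\<exists>\<delta>>0. \<forall>p \<in> ball (g t) \<delta> \<inter> \<Delta>. f p \<in> \<Delta>"
proof -
  have a01: "a \<in> {0..1}" using abc by auto
  obtain \<rho> where \<rho>: "\<rho> > 0" "ball (g a) \<rho> \<subseteq> U" using U open_contains_ball by blast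
  obtain d where d: "d > 0" "\<And>s. s \<in> {0..1} \<Longrightarrow> dist s a < d \<Longrightarrow> dist (g s) (g a) < \<rho>"
    using cont_g a01 \<rho>(1) unfolding continuous_on_iff by metis
  define t0 where "t0 = min (a + d / 2) ((a + t) / 2)"
  have t0: "a < t0" "t0 < t" "t0 < a + d" using d t by (auto simp: t0_def min_def field_simps)
  have "t0 \<in> {0..1}" "dist t0 a < d" using t0 t abc by (auto simp: dist_real_def)
  then have "g t0 \<in> ball (g a) \<rho>" using d(2)[of t0] by (simp add: dist_commute)
  then have "g t0 \<in> U" using \<rho>(2) by blast
  \<comment> \<open>The margins are the middle thirds of the intervals from \<open>a\<close> to
    \<open>t0\<close> and from \<open>t\<close> to \<open>b\<close>.\<close>
  obtain A B \<beta> where AB: "(2 * a + t0) / 3 \<le> A" "A < (a + 2 * t0) / 3" "(2 * t + b) / 3 < B" "B \<le> (t + 2 * b) / 3"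
      and C: "closing_arc g \<beta> A B"
    using exists_closing_arc[OF arc_g, of "(2 * a + t0) / 3" "(a + 2 * t0) / 3" "(2 * t + b) / 3" "(t + 2 * b) / 3"]
      t0 t abc by (auto simp: field_simps)
  have ab: "a < A" "B < b" "t0 \<in> {A<..<B}" "t \<in> {A<..<B}" using AB t0 t by (auto simp: field_simps)
  have "flat_at A B \<beta> t0" using flat_at_orientation[OF C ab(1,2,3) \<open>g t0 \<in> U\<close>] .
  then have "flat_at A B \<beta> t" using flat_at_propagates[OF C ab] by blast
  then show ?thesis using flat_at_imp_inward[OF C ab(1,2,4) t(2)] by blast
qed

section \<open>Collapse onto a boundary arc, and the fixed point\<close>

definition turn :: real where
  "turn = max a c"

text \<open>If \<open>a < c\<close>, the image of the stretch from \<open>a\<close> to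
  \<open>c\<close> lies on \<open>J\<close>, but \<open>image_inward\<close> is silent about that
  stretch. The arc of the collapse is then prolonged beyond \<open>g 1\<close> along this image,
  with shifted parameters; if \<open>c \<le> a\<close> it ends at \<open>g 1\<close>.\<close>

definition long_arc :: "real \<Rightarrow> complex" where
  "long_arc t = (if t \<le> 1 then g t else f (g (t - 1 + a)))"

lemma turn: "a \<le> turn" "c \<le> turn" "turn < b" "0 \<le> turn"
  using abc by (auto simp: turn_def)

lemma long_arc_continuous: "continuous_on {c..1 + turn - a} long_arc"
proof -
  have eq: "{c..1 + turn - a} = {c..1} \<union> {1..1 + turn - a}" using turn abc by auto
  have sub: "(\<lambda>t. t - 1 + a) ` {1..1 + turn - a} \<subseteq> {0..1}" using turn abc by auto
  have "continuous_on {1..1 + turn - a} (\<lambda>t. t - 1 + a)" by (intro continuous_intros)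
  then have "continuous_on {1..1 + turn - a} (\<lambda>t. (f \<circ> g) (t - 1 + a))"
    using continuous_on_compose2[OF path_fg[unfolded path_def] _ sub] by blast
  moreover have "continuous_on {c..1} g" using cont_g abc by (auto intro: continuous_on_subset)
  ultimately show ?thesis unfolding eq long_arc_def
    by (intro continuous_on_cases) (auto simp: fa)
qed

lemma long_arc_tail: "t \<in> {1<..1 + turn - a} \<Longrightarrow> \<exists>s\<in>{a<..<b}. long_arc t = f (g s)"
  using turn by (intro bexI[of _ "t - 1 + a"]) (auto simp: long_arc_def)

lemma long_arc_inj: "inj_on long_arc {c..1 + turn - a}"
proof (rule linorder_inj_onI)
  fix s t assume st: "s < t" "s \<in> {c..1 + turn - a}" "t \<in> {c..1 + turn - a}"
  consider "t \<le> 1" | "s \<le> 1" "1 < t" | "1 < s" by linarith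
  then show "long_arc s \<noteq> long_arc t"
  proof cases
    case 1
    then show ?thesis using st abc inj_onD[OF inj_g, of s t] by (auto simp: long_arc_def)
  next
    case 2
    then obtain r where "r \<in> {a<..<b}" "long_arc t = f (g r)" using long_arc_tail[of t] st by auto
    then show ?thesis using f_middle[of r s] 2 st abc by (auto simp: long_arc_def)
  next
    case 3
    have st': "s - 1 + a \<in> {a..b}" "t - 1 + a \<in> {a..b}" "s - 1 + a \<in> {0..1}" "t - 1 + a \<in> {0..1}"
      using 3 st turn abc by auto
    have "g (s - 1 + a) \<noteq> g (t - 1 + a)" using inj_onD[OF inj_g, of "s - 1 + a" "t - 1 + a"] st' st(1) by auto
    then have "f (g (s - 1 + a)) \<noteq> f (g (t - 1 + a))" using inj_onD[OF inj_f] st'(1,2) by blast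
    then show ?thesis using 3 st by (simp add: long_arc_def)
  qed
qed auto

lemma long_arc_in_J: "t \<in> {c..1 + turn - a} \<Longrightarrow> long_arc t \<in> J"
proof (cases "t \<le> 1")
  case False
  assume "t \<in> {c..1 + turn - a}"
  then obtain s where "s \<in> {a<..<b}" "long_arc t = f (g s)" using long_arc_tail[of t] False by auto
  then show ?thesis by (auto simp: J_eq)
qed (auto simp: J_eq long_arc_def)

lemma long_arc_in_E: "t \<in> {c..1 + turn - a} \<Longrightarrow> long_arc t \<in> E"
  using long_arc_in_J \<Delta>_interior_E interior_E unfolding \<Delta>_def by blast

text \<open>The second alternative is the part of \<open>J\<close> where \<open>image_inward\<close>
  applies to the preimage.\<close>

lemma J_cases:
  assumes "x \<in> J"
  obtains t where "t \<in> {c..1 + turn - a}" "x = long_arc t" | t where "t \<in> {turn<..<b}" "x = f (g t)"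
proof -
  have "x \<in> g ` {c..1} \<or> x \<in> f ` g ` {a..b}" using assms J_eq by blast
  then show thesis
  proof
    assume "x \<in> g ` {c..1}"
    then obtain t where "t \<in> {c..1}" "x = g t" by blast
    then show thesis using that(1)[of t] turn by (auto simp: long_arc_def)
  next
    assume "x \<in> f ` g ` {a..b}"
    then obtain t where t: "t \<in> {a..b}" "x = f (g t)" by blast
    consider "t = a" | "t \<in> {a<..turn}" | "t \<in> {turn<..<b}" | "t = b" using t by fastforce
    then show thesis
    proof cases
      case 1
      then show thesis using that(1)[of 1] t fa turn abc by (auto simp: long_arc_def)
    next
      case 2
      then show thesis using that(1)[of "t + 1 - a"] t abc by (auto simp: long_arc_def)
    next
      case 3
      then show thesis using that(2) t by blast
    next
      case 4
      then show thesis using that(1)[of c] t fb turn abc by (auto simp: long_arc_def)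
    qed
  qed
qed

text \<open>The outside of the Jordan domain \<open>\<Delta>\<close> is collapsed onto the arc \<open>long_arc\<close> of its boundary by a
  coordinate \<open>\<phi>\<close> that is too small, on the images of the final part of the arc, to create a new fixed point.\<close>

lemma coordinate:
  obtains \<phi> where "continuous_on UNIV \<phi>" "range \<phi> \<subseteq> {c..1 + turn - a}" "\<And>t. t \<in> {c..1 + turn - a} \<Longrightarrow> \<phi> (long_arc t) = t"
    "\<And>t. t \<in> {b..1} \<Longrightarrow> \<phi> (f (g t)) \<le> b" "\<And>t. t \<in> {1..1 + turn - a} \<Longrightarrow> \<phi> (f (long_arc t)) \<le> 1"
proof -
  let ?e = "1 + turn - a"
  note arc = long_arc_continuous long_arc_inj
  \<comment> \<open>The images of the stretch from y to u and of the prolongation: on these two sets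
    a bound on the coordinate is wanted.\<close>
  define K1 where "K1 = f ` g ` {b..1}"
  define K2 where "K2 = f ` long_arc ` {1..?e}"
  have cp1: "compact (g ` {b..1})" using cont_g abc by (intro compact_continuous_image) (auto intro: continuous_on_subset)
  have "g ` {b..1} \<subseteq> E" using g_in_E(1) interior_E abc by auto
  then have cl1: "closed K1" unfolding K1_def
    by (intro compact_imp_closed compact_continuous_image[OF _ cp1] cont_f_subset)
  have cp2: "compact (long_arc ` {1..?e})"
    using long_arc_continuous abc by (intro compact_continuous_image) (auto intro: continuous_on_subset)
  have "long_arc ` {1..?e} \<subseteq> E" using long_arc_in_E abc by auto
  then have cl2: "closed K2" unfolding K2_def
    by (intro compact_imp_closed compact_continuous_image[OF _ cp2] cont_f_subset)
  \<comment> \<open>The bound \<open>b\<close> is possible on \<open>K1\<close> because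
    \<open>no_return\<close> keeps \<open>K1\<close> off the stretch after \<open>b\<close>, where
    larger values are forced.\<close>
  have disj1: "K1 \<inter> long_arc ` {b<..1} = {}"
  proof -
    have "long_arc ` {b<..1} \<subseteq> g ` {b..1}" by (auto simp: long_arc_def)
    then show ?thesis using no_return unfolding K1_def by blast
  qed
  \<comment> \<open>Beyond parameter 1, \<open>long_arc\<close> consists of images of the open
    stretch from \<open>a\<close> to \<open>b\<close>, so by exclusiveness no point off that stretch
    is mapped there.\<close>
  have excl: "f x \<noteq> long_arc t" if x: "x \<in> E" "x \<notin> g ` {a<..<b}" and t: "t \<in> {1<..?e}" for x t
  proof -
    obtain s where s: "s \<in> {a<..<b}" "long_arc t = f (g s)" using long_arc_tail[OF t] by blast
    have "f x \<in> f ` (E - g ` {a<..<b})" using x by (intro imageI) simp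
    moreover have "f (g s) \<in> f ` g ` {a<..<b}" using s(1) by (intro imageI)
    ultimately show ?thesis using exclusive s(2) by (metis disjoint_iff)
  qed
  have disj2: "(K1 \<union> K2) \<inter> long_arc ` {1<..?e} = {}"
  proof -
    have "f (g s) \<noteq> long_arc t" if s: "s \<in> {b..1}" and t: "t \<in> {1<..?e}" for s t
    proof (rule excl[OF _ _ t])
      show "g s \<in> E" using g_in_E(1)[of s] interior_E s abc by auto
      show "g s \<notin> g ` {a<..<b}"
      proof
        assume "g s \<in> g ` {a<..<b}"
        then obtain r where "r \<in> {a<..<b}" "g s = g r" by blast
        then show False using inj_onD[OF inj_g, of s r] s abc by auto
      qed
    qed
    moreover have "f (long_arc s) \<noteq> long_arc t" if s: "s \<in> {1..?e}" and t: "t \<in> {1<..?e}" for s t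
    proof (rule excl[OF _ _ t])
      show "long_arc s \<in> E" using long_arc_in_E s abc by auto
      show "long_arc s \<notin> g ` {a<..<b}"
      proof
        assume "long_arc s \<in> g ` {a<..<b}"
        then obtain r where r: "r \<in> {a<..<b}" "long_arc s = g r" by blast
        show False
        proof (cases "s = 1")
          case True
          then have "g 1 = g r" using r by (simp add: long_arc_def)
          then show False using inj_onD[OF inj_g, of 1 r] r abc by auto
        next
          case False
          then obtain q where "q \<in> {a<..<b}" "long_arc s = f (g q)" using long_arc_tail[of s] s by auto
          then show False using f_middle[of q r] r abc by auto
        qed
      qed
    qed
    ultimately show ?thesis unfolding K1_def K2_def by blast
  qed
  \<comment> \<open>The coordinate grows from the constant \<open>c\<close> in three stages: up to
    \<open>b\<close>, then up to 1 without change on \<open>K1\<close>, then up to \<open>?e\<close>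
    without change on \<open>K1\<close> and \<open>K2\<close>. So the bounds \<open>b\<close> and 1
    survive on these sets.\<close>
  have c0: "continuous_on UNIV (\<lambda>_::complex. c)" "range (\<lambda>_::complex. c) \<subseteq> {c..c}" by auto
  have c1: "c = t" if "t \<in> {c..c}" for t using that by simp
  have r: "c \<le> c" "c \<le> b" "b \<le> ?e" "b \<le> 1" "1 \<le> ?e" "?e \<le> ?e" "c \<le> 1" using abc turn by auto
  obtain \<phi>1 where \<phi>1: "continuous_on UNIV \<phi>1" "range \<phi>1 \<subseteq> {c..b}" "\<And>t. t \<in> {c..b} \<Longrightarrow> \<phi>1 (long_arc t) = t"
    by (rule arc_coordinate_extend[OF arc r(1,2,3) c0 c1 closed_empty Int_empty_left]) (assumption, rule that)
  obtain \<phi>2 where \<phi>2: "continuous_on UNIV \<phi>2" "range \<phi>2 \<subseteq> {c..1}" "\<And>t. t \<in> {c..1} \<Longrightarrow> \<phi>2 (long_arc t) = t"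
    "\<And>x. x \<in> K1 \<Longrightarrow> \<phi>2 x = \<phi>1 x"
    by (rule arc_coordinate_extend[OF arc r(2,4,5) \<phi>1 cl1 disj1]) (assumption, rule that)
  obtain \<phi>3 where \<phi>3: "continuous_on UNIV \<phi>3" "range \<phi>3 \<subseteq> {c..?e}" "\<And>t. t \<in> {c..?e} \<Longrightarrow> \<phi>3 (long_arc t) = t"
    "\<And>x. x \<in> K1 \<union> K2 \<Longrightarrow> \<phi>3 x = \<phi>2 x"
    by (rule arc_coordinate_extend[OF arc r(7,5,6) \<phi>2(1,2,3) closed_Un[OF cl1 cl2] disj2]) (assumption, rule that)
  show ?thesis
  proof (rule that[OF \<phi>3(1,2,3)])
    show "\<phi>3 (f (g t)) \<le> b" if "t \<in> {b..1}" for t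
    proof -
      have "f (g t) \<in> K1" using that by (auto simp: K1_def)
      then have "\<phi>3 (f (g t)) = \<phi>1 (f (g t))" using \<phi>3(4) \<phi>2(4) by simp
      then show ?thesis using \<phi>1(2) by (metis atLeastAtMost_iff rangeI subsetD)
    qed
    show "\<phi>3 (f (long_arc t)) \<le> 1" if "t \<in> {1..?e}" for t
    proof -
      have "f (long_arc t) \<in> K2" using that by (auto simp: K2_def)
      then have "\<phi>3 (f (long_arc t)) = \<phi>2 (f (long_arc t))" using \<phi>3(4) by simp
      then show ?thesis using \<phi>2(2) by (metis atLeastAtMost_iff rangeI subsetD)
    qed
  qed
qed

text \<open>Continuity of \<open>F\<close> is in question where \<open>f z\<close> is on
  \<open>J\<close>. If \<open>f z\<close> is on \<open>long_arc\<close>, the two formulas agree at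
  \<open>z\<close>; otherwise exclusiveness puts \<open>z\<close> itself on the arc, where
  \<open>image_inward\<close> makes \<open>F\<close> equal to \<open>f\<close> nearby.\<close>

lemma fixed_point: "\<exists>p \<in> interior E. f p = p"
proof -
  let ?e = "1 + turn - a"
  obtain \<phi> where \<phi>: "continuous_on UNIV \<phi>" "range \<phi> \<subseteq> {c..?e}" "\<And>t. t \<in> {c..?e} \<Longrightarrow> \<phi> (long_arc t) = t"
    "\<And>t. t \<in> {b..1} \<Longrightarrow> \<phi> (f (g t)) \<le> b" "\<And>t. t \<in> {1..?e} \<Longrightarrow> \<phi> (f (long_arc t)) \<le> 1"
    by (rule coordinate) (rule that)
  define F2 where "F2 = (\<lambda>z. long_arc (\<phi> (f z)))"
  define F where "F = (\<lambda>z. if f z \<in> \<Delta> then f z else F2 z)"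
  have \<phi>_range: "\<phi> x \<in> {c..?e}" for x using \<phi>(2) by blast
  have \<Delta>E: "\<Delta> \<subseteq> E" using \<Delta>_interior_E interior_subset by blast
  have contf: "continuous_on \<Delta> f" using cont_f_subset[OF \<Delta>E] .
  have contF2: "continuous_on \<Delta> F2" unfolding F2_def
    by (intro continuous_on_compose2[OF long_arc_continuous] continuous_on_compose2[OF \<phi>(1)] contf) (use \<phi>_range in auto)
  have "closed J" unfolding J_def using J.path_curve by (rule closed_path_image)
  have "J \<union> inside J = - outside J" using Jordan_J(6,7) by blast
  then have "open (- \<Delta>)" unfolding \<Delta>_def using Jordan_J(5) by simp
  have JD: "J \<subseteq> \<Delta>" by (simp add: \<Delta>_def)
  have imF: "F ` \<Delta> \<subseteq> \<Delta>" using long_arc_in_J \<phi>_range JD by (auto simp: F_def F2_def)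
  have contF: "continuous_on \<Delta> F"
    unfolding continuous_on_eq_continuous_within
  proof
    fix z assume z: "z \<in> \<Delta>"
    have cf: "continuous (at z within \<Delta>) f" and cF2: "continuous (at z within \<Delta>) F2"
      using contf contF2 z by (auto simp: continuous_on_eq_continuous_within)
    have nbhd: "\<exists>\<delta>>0. \<forall>y\<in>\<Delta>. dist y z < \<delta> \<longrightarrow> f y \<in> V" if V: "open V" "f z \<in> V" for V
    proof -
      obtain \<epsilon> where \<epsilon>: "\<epsilon> > 0" "ball (f z) \<epsilon> \<subseteq> V" using V open_contains_ball by blast
      then obtain \<delta> where "\<delta> > 0" "\<forall>y\<in>\<Delta>. dist y z < \<delta> \<longrightarrow> dist (f y) (f z) < \<epsilon>"
        using cf unfolding continuous_within_eps_delta by blast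
      then show ?thesis using \<epsilon>(2) by (intro exI[of _ \<delta>]) (auto simp: dist_commute subset_iff)
    qed
    have by_f: "continuous (at z within \<Delta>) F" if "\<delta> > 0" "\<And>y. y \<in> \<Delta> \<Longrightarrow> dist y z < \<delta> \<Longrightarrow> f y \<in> \<Delta>" for \<delta>
      by (rule continuous_transform_within[OF cf that(1) z]) (use that(2) in \<open>simp add: F_def\<close>)
    consider (out) "f z \<notin> \<Delta>" | (ins) "f z \<in> inside J" | (bd) "f z \<in> J" using \<Delta>_def by blast
    then show "continuous (at z within \<Delta>) F"
    proof cases
      case out
      then obtain \<delta> where \<delta>: "\<delta> > 0" "\<forall>y\<in>\<Delta>. dist y z < \<delta> \<longrightarrow> f y \<in> - \<Delta>"
        using nbhd[OF \<open>open (- \<Delta>)\<close>] by auto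
      show ?thesis by (rule continuous_transform_within[OF cF2 \<delta>(1) z]) (use \<delta>(2) in \<open>simp add: F_def\<close>)
    next
      case ins
      then obtain \<delta> where \<delta>: "\<delta> > 0" "\<forall>y\<in>\<Delta>. dist y z < \<delta> \<longrightarrow> f y \<in> inside J"
        using nbhd[OF Jordan_J(2)] by auto
      show ?thesis by (rule by_f[OF \<delta>(1)]) (use \<delta>(2) in \<open>simp add: \<Delta>_def\<close>)
    next
      case bd
      from bd show ?thesis
      proof (cases rule: J_cases)
        case (1 t)
        then have eq: "F2 z = f z" using \<phi>(3) by (simp add: F2_def)
        show ?thesis unfolding continuous_within_eps_delta
        proof (intro allI impI)
          fix \<epsilon> :: real assume "\<epsilon> > 0"
          then obtain \<delta>1 \<delta>2 where \<delta>: "\<delta>1 > 0" "\<forall>y\<in>\<Delta>. dist y z < \<delta>1 \<longrightarrow> dist (f y) (f z) < \<epsilon>"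
              "\<delta>2 > 0" "\<forall>y\<in>\<Delta>. dist y z < \<delta>2 \<longrightarrow> dist (F2 y) (F2 z) < \<epsilon>"
            using cf cF2 unfolding continuous_within_eps_delta by metis
          have "F z = f z" using eq by (simp add: F_def)
          then show "\<exists>\<delta>>0. \<forall>y\<in>\<Delta>. dist y z < \<delta> \<longrightarrow> dist (F y) (F z) < \<epsilon>"
            using \<delta> eq by (intro exI[of _ "min \<delta>1 \<delta>2"]) (simp add: F_def)
        qed
      next
        case (2 t)
        have t: "t \<in> {a<..<b}" "c < t" using 2 turn by auto
        have "z \<in> g ` {a<..<b}"
        proof (rule ccontr)
          assume "z \<notin> g ` {a<..<b}"
          then have "f z \<in> f ` (E - g ` {a<..<b})" using z \<Delta>E by (intro imageI) auto
          moreover have "f (g t) \<in> f ` g ` {a<..<b}" using t(1) by (intro imageI)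
          ultimately show False using exclusive 2(2) by (metis disjoint_iff)
        qed
        then obtain s where s: "s \<in> {a<..<b}" "z = g s" by blast
        have "g s = g t" using inj_onD[OF inj_f, of "g s" "g t"] s t 2(2) by auto
        then obtain \<delta> where "\<delta> > 0" "\<forall>p \<in> ball z \<delta> \<inter> \<Delta>. f p \<in> \<Delta>"
          using image_inward[OF t] s(2) by auto
        then show ?thesis by (intro by_f[of \<delta>]) (auto simp: dist_commute)
      qed
    qed
  qed
  obtain z where z: "z \<in> \<Delta>" "F z = z"
    by (rule brouwer_Jordan_domain[OF J.simple_curve J.loop_curve, folded J_def, folded \<Delta>_def, OF contF imF])
  have "f z \<in> \<Delta>"
  proof (rule ccontr)
    assume out: "f z \<notin> \<Delta>"
    define t where "t = \<phi> (f z)"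
    have t: "t \<in> {c..?e}" "z = long_arc t" using z out \<phi>_range by (auto simp: F_def F2_def t_def)
    \<comment> \<open>Up to \<open>b\<close> the point is mapped into \<open>J\<close>, by
      \<open>advance\<close> or because the image of the stretch from \<open>a\<close> to
      \<open>b\<close> belongs to \<open>J\<close>. Beyond \<open>b\<close> and beyond 1 the bounds
      on \<phi> make \<open>\<phi> (f z)\<close> smaller than \<open>t\<close>, although both are
      equal.\<close>
    consider "t \<le> a" | "a \<le> t" "t \<le> b" | "b < t" "t \<le> 1" | "1 < t" by linarith
    then show False
    proof cases
      case 1
      then obtain s where "s \<in> {t<..1}" "f (g t) = g s" using advance[of t] t abc by auto
      then have "f z \<in> J" using 1 t abc by (auto simp: J_eq long_arc_def)
      then show False using out JD by blast
    next
      case 2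
      then have "z = g t" using t abc by (simp add: long_arc_def)
      moreover have "g t \<in> g ` {a..b}" using 2 by simp
      ultimately have "f z \<in> J" unfolding J_eq by blast
      then show False using out JD by blast
    next
      case 3
      then have "z = g t" using t by (simp add: long_arc_def)
      moreover have "\<phi> (f (g t)) \<le> b" using 3 by (intro \<phi>(4)) auto
      ultimately have "t \<le> b" by (metis t_def)
      then show False using 3 by simp
    next
      case 4
      then have "\<phi> (f (long_arc t)) \<le> 1" using t(1) by (intro \<phi>(5)) auto
      then have "t \<le> 1" using t(2) by (metis t_def)
      then show False using 4 by simp
    qed
  qed
  then have "f z = z" using z by (simp add: F_def)
  then show ?thesis using z \<Delta>_interior_E by blast
qed

end

section \<open>Transport to the real plane\<close>

text \<open>\<open>l\<close> maps any competing connected set to a connected set of reals containing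
  \<open>s\<close> and \<open>t\<close>, hence the interval between them.\<close>

lemma arc_cc_eq:
  assumes lk: "homeomorphism A {0..1::real} l k" and st: "0 \<le> s" "s \<le> t" "t \<le> 1"
  shows "arc_cc A (k s) (k t) = k ` {s..t}"
  unfolding arc_cc_def
proof (rule Least_equality)
  have k: "continuous_on {0..1} k" "k ` {0..1} = A" and l: "continuous_on A l" "\<And>r. r \<in> {0..1} \<Longrightarrow> l (k r) = r"
    and kl: "\<And>x. x \<in> A \<Longrightarrow> k (l x) = x"
    using lk by (auto simp: homeomorphism_def)
  have "connected (k ` {s..t})"
    by (intro connected_continuous_image) (use k(1) st in \<open>auto intro: continuous_on_subset\<close>)
  moreover have "k ` {s..t} \<subseteq> A" using k(2) st by force
  ultimately show "connected (k ` {s..t}) \<and> k ` {s..t} \<subseteq> A \<and> {k s, k t} \<subseteq> k ` {s..t}"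
    using st by auto
  fix C assume C: "connected C \<and> C \<subseteq> A \<and> {k s, k t} \<subseteq> C"
  then have "connected (l ` C)" by (intro connected_continuous_image continuous_on_subset[OF l(1)]) auto
  moreover have "l (k s) \<in> l ` C" "l (k t) \<in> l ` C" using C by blast+
  then have "s \<in> l ` C" "t \<in> l ` C" using l(2)[of s] l(2)[of t] st by simp_all
  ultimately have "{s..t} \<subseteq> l ` C" by (metis connected_contains_Icc)
  then have "k ` {s..t} \<subseteq> k ` l ` C" by (rule image_mono)
  moreover have "k ` l ` C \<subseteq> C" using C kl by auto
  ultimately show "k ` {s..t} \<le> C" by (rule order_trans)
qed

lemma arc_ends_param:
  assumes "homeomorphism A {0..1::real} l k"
  shows "k 0 \<in> arc_ends A" "k 1 \<in> arc_ends A"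
  using homeomorphism_symD[OF assms] unfolding arc_ends_def by blast+

lemma arc_ends_subset: "arc_ends A \<subseteq> A"
  unfolding arc_ends_def homeomorphism_def by auto

text \<open>For \<open>n \<ge> 2\<close> the natural order already puts \<open>x\<close> first:
  \<open>x\<close> precedes its image, so it cannot be the last point of the arc. For
  \<open>n = 1\<close> no order is given, and the parametrisation may be reversed.\<close>

lemma n_steps_arc_param:
  assumes A: "n_steps_arc Y f n A x u"
  obtains l k where "homeomorphism A {0..1::real} l k" "k 0 = x" "k 1 = u"
    "n \<ge> 2 \<Longrightarrow> \<forall>i<n. l ((f ^^ i) x) < l ((f ^^ Suc i) x)"
proof -
  have ends: "arc_ends A = {x, u}" using A by (simp add: n_steps_arc_def)
  have two: "k 0 = x \<and> k 1 = u \<or> k 0 = u \<and> k 1 = x" if lk: "homeomorphism A {0..1::real} l k" for l k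
  proof -
    have "l (k 0) = 0" "l (k 1) = 1" using lk by (auto simp: homeomorphism_def)
    then have "k 0 \<noteq> k 1" by auto
    then show ?thesis using arc_ends_param[OF lk] ends by auto
  qed
  have n: "n = 1 \<or> n \<ge> 2" using A by (auto simp: n_steps_arc_def)
  show ?thesis
  proof (cases "n \<ge> 2")
    case True
    then obtain prec where prec: "natural_order A prec" "\<forall>i<n. prec ((f ^^ i) x) ((f ^^ Suc i) x)"
      and un: "u = (f ^^ n) x" and mid: "\<forall>i\<in>{1..n - 1}. (f ^^ i) x \<in> A"
      using A by (auto simp: n_steps_arc_def)
    obtain l k where lk: "homeomorphism A {0..1::real} l k" and lt: "\<forall>a\<in>A. \<forall>b\<in>A. prec a b \<longleftrightarrow> l a < l b"
      using prec(1) by (auto simp: natural_order_def)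
    have uA: "(f ^^ i) x \<in> A" if "i \<le> n" for i
    proof -
      consider "i = 0" | "i \<in> {1..n - 1}" | "i = n" using \<open>i \<le> n\<close> by fastforce
      then show ?thesis using mid un ends arc_ends_subset[of A] by cases auto
    qed
    have less: "\<forall>i<n. l ((f ^^ i) x) < l ((f ^^ Suc i) x)"
      using prec(2) lt uA by (metis Suc_leI less_imp_le)
    have "l x < 1"
    proof -
      have "l x < l ((f ^^ Suc 0) x)" using less True by force
      moreover have "l ((f ^^ Suc 0) x) \<le> 1" using uA[of "Suc 0"] True lk by (auto simp: homeomorphism_def)
      ultimately show ?thesis by simp
    qed
    then have "k 1 \<noteq> x" using lk by (auto simp: homeomorphism_def)
    then show ?thesis using that[OF lk] two[OF lk] less by blast
  next
    case False
    obtain l k where lk: "homeomorphism A {0..1::real} l k"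
      using A by (auto simp: n_steps_arc_def is_arc_def homeomorphic_def)
    from two[OF lk] show ?thesis
    proof
      assume "k 0 = x \<and> k 1 = u"
      then show ?thesis using that[OF lk] False by blast
    next
      assume rev: "k 0 = u \<and> k 1 = x"
      have "homeomorphism {0..1::real} {0..1} (\<lambda>t. 1 - t) (\<lambda>t. 1 - t)"
        unfolding homeomorphism_def by (auto intro!: continuous_intros)
      then have "homeomorphism A {0..1::real} ((\<lambda>t. 1 - t) \<circ> l) (k \<circ> (\<lambda>t. 1 - t))"
        using homeomorphism_compose[OF lk] by blast
      then show ?thesis using that False rev by (metis (no_types, lifting) comp_apply diff_self diff_zero)
    qed
  qed
qed

text \<open>The stretch between consecutive iterates is mapped onto the next one. Choosing the
  stretch whose upper end strictly exceeds \<open>t\<close> makes the parameter of the image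
  strictly larger.\<close>

lemma n_steps_arc_advance:
  assumes A: "n_steps_arc Y f n A x u" and lk: "homeomorphism A {0..1::real} l k" "k 0 = x" "k 1 = u"
    and less: "n \<ge> 2 \<Longrightarrow> \<forall>i<n. l ((f ^^ i) x) < l ((f ^^ Suc i) x)"
    and t: "t \<in> {0..l ((f ^^ (n - 1)) x)}"
  shows "\<exists>s\<in>{t<..1}. f (k t) = k s"
proof -
  have lk': "l (k r) = r" if "r \<in> {0..1}" for r using lk(1) that by (simp add: homeomorphism_def)
  have kl: "k (l z) = z" if "z \<in> A" for z using lk(1) that by (simp add: homeomorphism_def)
  have l01: "l z \<in> {0..1}" if "z \<in> A" for z using lk(1) that by (auto simp: homeomorphism_def)
  have l0: "l x = 0" using lk'[of 0] lk(2) by simp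
  consider "n = 1" "u = f x" | "n \<ge> 2" using A by (auto simp: n_steps_arc_def)
  then show ?thesis
  proof cases
    case 1
    then have "t = 0" using t l0 by simp
    then show ?thesis using 1 lk by (intro bexI[of _ 1]) auto
  next
    case 2
    define \<tau> where "\<tau> = (\<lambda>i. l ((f ^^ i) x))"
    have un: "u = (f ^^ n) x" and mid: "\<forall>i\<in>{1..n - 1}. (f ^^ i) x \<in> A" and ends: "arc_ends A = {x, u}"
      and step: "\<And>i. i \<in> {1..n - 1} \<Longrightarrow> f ` arc_cc A ((f ^^ (i - 1)) x) ((f ^^ i) x) = arc_cc A ((f ^^ i) x) ((f ^^ (i + 1)) x)"
      using A 2 by (auto simp: n_steps_arc_def)
    have uA: "(f ^^ i) x \<in> A" if "i \<le> n" for i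
    proof -
      consider "i = 0" | "i \<in> {1..n - 1}" | "i = n" using \<open>i \<le> n\<close> by fastforce
      then show ?thesis using mid un ends arc_ends_subset[of A] by cases auto
    qed
    have inc: "\<tau> i < \<tau> (Suc i)" if "i < n" for i using less[OF 2] that by (simp add: \<tau>_def)
    have \<tau>01: "\<tau> i \<in> {0..1}" if "i \<le> n" for i using l01[OF uA[OF that]] by (simp add: \<tau>_def)
    have k\<tau>: "k (\<tau> i) = (f ^^ i) x" if "i \<le> n" for i using kl[OF uA[OF that]] by (simp add: \<tau>_def)
    show ?thesis
    proof (cases "t = \<tau> (n - 1)")
      case True
      \<comment> \<open>The last parameter is below no \<open>\<tau> j\<close> with
        \<open>j \<le> n - 1\<close>; its point is mapped to the end \<open>u\<close> of the
        arc.\<close>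
      have "f (k t) = (f ^^ Suc (n - 1)) x" using True k\<tau>[of "n - 1"] by simp
      then have "f (k t) = k 1" using 2 un lk(3) by simp
      moreover have "t < 1" using True inc[of "n - 1"] \<tau>01[of n] 2 by simp
      ultimately show ?thesis by (intro bexI[of _ 1]) auto
    next
      case False
      then have tlt: "t < \<tau> (n - 1)" using t by (simp add: \<tau>_def)
      define j where "j = (LEAST j. t < \<tau> j)"
      have j: "t < \<tau> j" unfolding j_def by (rule LeastI[of _ "n - 1"]) (rule tlt)
      have jle: "j \<le> n - 1" unfolding j_def by (rule Least_le) (rule tlt)
      have "j \<noteq> 0" using j t l0 by (auto simp: \<tau>_def intro: Nat.gr0I)
      then have jj: "j \<in> {1..n - 1}" using jle by simp
      have "\<not> t < \<tau> (j - 1)" using not_less_Least[of "j - 1" "\<lambda>j. t < \<tau> j"] \<open>j \<noteq> 0\<close> unfolding j_def[symmetric] by simp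
      then have "t \<in> {\<tau> (j - 1)..\<tau> j}" using j by simp
      have le: "j - 1 \<le> n" "j \<le> n" "j + 1 \<le> n" using jle 2 by auto
      have "\<tau> (j - 1) \<le> \<tau> j" "\<tau> j \<le> \<tau> (j + 1)" 
      proof -
        have "j - 1 < n" "j < n" using \<open>j \<noteq> 0\<close> jle 2 by linarith+
        then show "\<tau> (j - 1) \<le> \<tau> j" "\<tau> j \<le> \<tau> (j + 1)"
          using inc[of "j - 1"] inc[of j] \<open>j \<noteq> 0\<close> by (auto intro: less_imp_le)
      qed
      then have "arc_cc A ((f ^^ (j - 1)) x) ((f ^^ j) x) = k ` {\<tau> (j - 1)..\<tau> j}"
          "arc_cc A ((f ^^ j) x) ((f ^^ (j + 1)) x) = k ` {\<tau> j..\<tau> (j + 1)}"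
        using arc_cc_eq[OF lk(1), of "\<tau> (j - 1)" "\<tau> j"] arc_cc_eq[OF lk(1), of "\<tau> j" "\<tau> (j + 1)"]
          k\<tau>[OF le(1)] k\<tau>[OF le(2)] k\<tau>[OF le(3)] \<tau>01[OF le(1)] \<tau>01[OF le(2)] \<tau>01[OF le(3)] by auto
      then have "f ` k ` {\<tau> (j - 1)..\<tau> j} = k ` {\<tau> j..\<tau> (j + 1)}" using step[OF jj] by simp
      then have "f (k t) \<in> k ` {\<tau> j..\<tau> (j + 1)}" using \<open>t \<in> {\<tau> (j - 1)..\<tau> j}\<close> by blast
      then obtain s where "s \<in> {\<tau> j..\<tau> (j + 1)}" "f (k t) = k s" by blast
      then show ?thesis using j \<tau>01[OF le(3)] by (intro bexI[of _ s]) auto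
    qed
  qed
qed

section \<open>Complex coordinates and orientation\<close>

lemma inj_to_complex: "inj to_complex" and inj_of_complex: "inj of_complex"
  by (rule inj_on_inverseI, rule of_complex_to_complex) (rule inj_on_inverseI, rule to_complex_of_complex)

lemma bij_to_complex: "bij to_complex"
proof (rule bijI[OF inj_to_complex])
  show "surj to_complex" by (metis surjI to_complex_of_complex)
qed

lemma to_complex_image_interior: "interior (to_complex ` S) = to_complex ` interior S"
  by (rule interior_bijective_linear_image[OF linear_to_complex bij_to_complex])

lemma dist_to_complex [simp]: "dist (to_complex x) (to_complex y) = dist x y"
  by (metis dist_norm linear_diff linear_to_complex norm_to_complex)

text \<open>By invariance of domain the image of the open unit disc is open in the plane.\<close>

lemma disc_contains_cball:
  assumes "is_disc D"
  obtains p r where "r > 0" "cball p r \<subseteq> D"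
proof -
  obtain h k where hk: "homeomorphism D (cball (0::plane) 1) h k"
    using assms by (auto simp: is_disc_def homeomorphic_def)
  then have k: "continuous_on (cball 0 1) k" "inj_on k (cball 0 1)" "k ` cball 0 1 = D"
    by (auto simp: homeomorphism_def intro: inj_on_inverseI)
  have "open (k ` ball 0 1)"
    by (rule invariance_of_domain) (use k(1,2) in \<open>auto intro: continuous_on_subset inj_on_subset\<close>)
  then obtain r where "r > 0" "cball (k 0) r \<subseteq> k ` ball 0 1"
    using open_contains_cball by (metis centre_in_ball imageI zero_less_one)
  then show ?thesis using that k(3) ball_subset_cball by blast
qed

text \<open>On a small ball inside \<open>D\<close> the map coincides with an orientation preserving
  homeomorphism, which has degree 1; \<open>local_degree_constant\<close> carries this to every
  point of \<open>U\<close>.\<close>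

lemma orientation_preserving_on_open_degree:
  assumes f: "orientation_preserving_on_open U f" "open U" "connected U" "continuous_on U f" "inj_on f U"
    and pr: "r > 0" "cball p r \<subseteq> to_complex ` U"
  defines "F \<equiv> to_complex \<circ> f \<circ> of_complex"
  shows "winding_number (F \<circ> circlepath p r) (F p) = 1"
proof -
  obtain D h where D: "is_disc D" "D \<subseteq> U" "\<forall>z\<in>D. h z = f z" "orientation_preserving_homeo h"
    using f(1) by (auto simp: orientation_preserving_on_open_def orientation_preserving_on_disc_def)
  obtain q s where qs: "s > 0" "cball q s \<subseteq> D" using disc_contains_cball[OF D(1)] .
  define H where "H = to_complex \<circ> h \<circ> of_complex"
  have FH: "F z = H z" if "z \<in> cball (to_complex q) s" for z
  proof -
    have "dist q (of_complex z) \<le> s" using that dist_to_complex[of q "of_complex z"] by simp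
    then have "of_complex z \<in> D" using qs by auto
    then show ?thesis using D(3) by (simp add: F_def H_def)
  qed
  have "winding_number (F \<circ> circlepath (to_complex q) s) (F (to_complex q)) = winding_number (H \<circ> circlepath (to_complex q) s) (H (to_complex q))"
  proof -
    have "(F \<circ> circlepath (to_complex q) s) t = (H \<circ> circlepath (to_complex q) s) t" for t
      using FH[of "circlepath (to_complex q) s t"] qs(1) by (simp add: circlepath dist_norm norm_mult)
    then have "F \<circ> circlepath (to_complex q) s = H \<circ> circlepath (to_complex q) s" by blast
    then show ?thesis using FH[of "to_complex q"] qs(1) by simp
  qed
  also have "\<dots> = 1" unfolding H_def by (rule orientation_preserving_homeo_degree[OF D(4) qs(1)])
  finally have deg: "winding_number (F \<circ> circlepath (to_complex q) s) (F (to_complex q)) = 1" .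
  have ofU: "of_complex ` to_complex ` U = U" by (simp add: image_image)
  show ?thesis
  proof (rule local_degree_constant[OF _ _ _ _ qs(1) _ pr deg])
    show "continuous_on (to_complex ` U) F" unfolding F_def
      using f(4) ofU by (intro continuous_on_compose continuous_on_to_complex continuous_on_of_complex) auto
    show "inj_on F (to_complex ` U)" unfolding F_def
      using f(5) ofU inj_to_complex inj_of_complex by (intro comp_inj_on) (auto intro: inj_on_subset)
    show "open (to_complex ` U)"
      using to_complex_image_interior[of U] f(2) by (metis interior_open open_interior)
    show "connected (to_complex ` U)" using f(3) continuous_on_to_complex connected_continuous_image by blast
    show "cball (to_complex q) s \<subseteq> to_complex ` U"
    proof
      fix z assume "z \<in> cball (to_complex q) s"
      then have "dist q (of_complex z) \<le> s" using dist_to_complex[of q "of_complex z"] by simp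
      then have "of_complex z \<in> U" using qs D(2) by auto
      then show "z \<in> to_complex ` U" by (metis image_eqI to_complex_of_complex)
    qed
  qed
qed

theorem theorem4p4:
  fixes Y A E U :: "plane set"
    and f :: "plane \<Rightarrow> plane"
    and n :: nat
    and x u y :: plane
  assumes "continuous_on Y f"
    and "n \<ge> 1"
    and "A \<subseteq> Y" and "outflanking_arc Y f n A x u"
    and "is_disc E" and "E \<subseteq> Y" and "A \<union> f ` A \<subseteq> interior E"
    and "outflanking_point Y f n A x u y"
    and "open U" and "connected U" and "(f ^^ (n - 1)) x \<in> U" and "U \<subseteq> interior E"
    and "inj_on f U" and "orientation_preserving_on_open U f"
    and "exclusive_in f (arc_oo A ((f ^^ (n - 1)) x) y) E"
  shows "\<exists>p \<in> interior E. f p = p"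
proof -
  obtain v where op: "outflanking_points Y f n A x u y v"
    using assms(8) by (auto simp: outflanking_point_def)
  define w where "w = (f ^^ (n - 1)) x"
  have nA: "n_steps_arc Y f n A x u" and y: "y \<in> arc_oc A w u" and v: "v \<in> arc_co A x y" "v = f y"
    and inj_wy: "inj_on f (arc_cc A w y)" and off_wy: "f ` arc_oo A w y \<inter> A = {}"
    and back_yu: "f ` arc_cc A y u \<inter> arc_cc A y u = {}"
    using op unfolding outflanking_points_def Let_def w_def by auto
  obtain l k where lk: "homeomorphism A {0..1::real} l k" and k01: "k 0 = x" "k 1 = u"
    and less: "n \<ge> 2 \<Longrightarrow> \<forall>i<n. l ((f ^^ i) x) < l ((f ^^ Suc i) x)"
    using n_steps_arc_param[OF nA] by blast
  have lk': "l (k r) = r" if "r \<in> {0..1}" for r using lk that by (simp add: homeomorphism_def)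
  have kl: "k (l z) = z" if "z \<in> A" for z using lk that by (simp add: homeomorphism_def)
  have l01: "0 \<le> l z" "l z \<le> 1" if "z \<in> A" for z using lk that by (auto simp: homeomorphism_def)
  have kA: "k ` {0..1} = A" and contk: "continuous_on {0..1} k" using lk by (auto simp: homeomorphism_def)
  have injk: "inj_on k {0..1}" using lk' by (rule inj_on_inverseI)
  have wA: "w \<in> A"
  proof (cases "n = 1")
    case True
    then show ?thesis using kA k01 unfolding w_def by force
  next
    case False
    then have "n - 1 \<in> {1..n - 1}" "n \<noteq> 1" using assms(2) by auto
    then show ?thesis using nA unfolding n_steps_arc_def w_def by blast
  qed
  define a where "a = l w"
  define b where "b = l y"
  define c where "c = l v"
  have a: "0 \<le> a" "a \<le> 1" "k a = w" using l01[OF wA] kl[OF wA] by (auto simp: a_def)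
  have cc_wu: "arc_cc A w u = k ` {a..1}" using arc_cc_eq[OF lk a(1,2)] a(3) k01 by simp
  have "y \<in> k ` {a..1}" "y \<noteq> w" using y cc_wu by (auto simp: arc_oc_def)
  then obtain b' where b': "b' \<in> {a..1}" "y = k b'" by blast
  then have "b = b'" using lk'[of b'] a by (simp add: b_def)
  then have b: "a < b" "b \<le> 1" "k b = y" using b' \<open>y \<noteq> w\<close> a(3) by (auto simp: less_le)
  have cc_xy: "arc_cc A x y = k ` {0..b}" using arc_cc_eq[OF lk, of 0 b] b a k01 by simp
  have "v \<in> k ` {0..b}" "v \<noteq> y" using v(1) cc_xy by (auto simp: arc_co_def)
  then obtain c' where c': "c' \<in> {0..b}" "v = k c'" by blast
  then have "c = c'" using lk'[of c'] b by (simp add: c_def)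
  then have c: "0 \<le> c" "c < b" "k c = v" using c' \<open>v \<noteq> y\<close> b(3) by (auto simp: less_le)
  have cc_wy: "arc_cc A w y = k ` {a..b}" using arc_cc_eq[OF lk, of a b] a b by simp
  have cc_yu: "arc_cc A y u = k ` {b..1}" using arc_cc_eq[OF lk, of b 1] a b k01 by simp
  have oo_wy: "arc_oo A w y = k ` {a<..<b}"
  proof -
    have "k t \<noteq> w" "k t \<noteq> y" if "t \<in> {a<..<b}" for t
      using inj_onD[OF injk, of t a] inj_onD[OF injk, of t b] that a b by auto
    moreover have "{a..b} = {a<..<b} \<union> {a, b}" using b by auto
    ultimately show ?thesis unfolding arc_oo_def cc_wy using a(3) b(3) by auto
  qed
  have fw: "f w = u"
  proof -
    have "f w = (f ^^ Suc (n - 1)) x" by (simp add: w_def)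
    then have "f w = (f ^^ n) x" using assms(2) by simp
    then show ?thesis using nA by (auto simp: n_steps_arc_def)
  qed
  define F where "F = to_complex \<circ> f \<circ> of_complex"
  define g where "g = to_complex \<circ> k"
  have gS: "g ` S = to_complex ` k ` S" for S by (simp add: g_def image_comp)
  have FS: "F ` to_complex ` S = to_complex ` f ` S" for S by (simp add: F_def image_image)
  have Fg: "F (g t) = to_complex (f (k t))" for t by (simp add: F_def g_def)
  have disj: "to_complex ` S \<inter> to_complex ` T = {}" if "S \<inter> T = {}" for S T
    using image_Int[OF inj_to_complex, of S T] that by simp
  have injF: "inj_on F (to_complex ` S)" if "inj_on f S" for S
    unfolding F_def using that inj_to_complex inj_of_complex
    by (intro comp_inj_on) (auto simp: image_image intro: inj_on_subset)
  have contF: "continuous_on (to_complex ` S) F" if "continuous_on S f" for S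
    unfolding F_def using that
    by (intro continuous_on_compose continuous_on_to_complex continuous_on_of_complex) (simp add: image_image)
  have contE: "continuous_on E f" using assms(1,6) continuous_on_subset by blast
  have homE: "(to_complex ` E) homeomorphic cball (0::plane) 1"
  proof -
    have "to_complex ` E homeomorphic E"
      using homeomorphic_sym homeomorphic_def homeomorphism_of_subsets[OF homeomorphism_to_complex, of E "to_complex ` E"]
      by (metis image_image image_ident of_complex_to_complex subset_UNIV)
    then show ?thesis using assms(5) homeomorphic_trans unfolding is_disc_def by blast
  qed
  interpret outflanking "to_complex ` E" "to_complex ` U" F g a b c
  proof
    have "continuous_on {0..1} g" unfolding g_def
      by (intro continuous_on_compose contk continuous_on_to_complex)
    moreover have "inj_on g {0..1}" unfolding g_def
      by (intro comp_inj_on injk inj_on_subset[OF inj_to_complex]) auto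
    ultimately show "arc g" by (simp add: arc_def path_def)
    show "continuous_on (to_complex ` E) F" by (rule contF[OF contE])
    show "bounded (to_complex ` E)"
      by (rule compact_imp_bounded) (simp add: homeomorphic_compactness[OF homE])
    show "connected (- to_complex ` E)"
      by (rule connected_complement_homeomorphic_convex_compact[OF homE]) auto
    show "g ` {0..1} \<subseteq> interior (to_complex ` E)" "F ` g ` {0..1} \<subseteq> interior (to_complex ` E)"
      unfolding gS FS kA to_complex_image_interior using assms(7) by blast+
    show "0 \<le> a" "a < b" "b \<le> 1" "0 \<le> c" "c < b" using a b c by auto
    show "\<exists>s\<in>{t<..1}. F (g t) = g s" if "t \<in> {0..a}" for t
      using n_steps_arc_advance[OF nA lk k01 less, of t] that unfolding Fg a_def w_def by (auto simp: g_def)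
    show "F (g a) = g 1" unfolding Fg by (simp add: g_def a(3) fw k01(2))
    show "F (g b) = g c" unfolding Fg by (simp add: g_def b(3) c(3) v(2)[symmetric])
    show "inj_on F (g ` {a..b})" unfolding gS using injF inj_wy cc_wy by simp
    show "F ` g ` {a<..<b} \<inter> g ` {0..1} = {}" unfolding gS FS kA using off_wy oo_wy by (intro disj) simp
    show "F ` g ` {b..1} \<inter> g ` {b..1} = {}" unfolding gS FS using back_yu cc_yu by (intro disj) simp
    have "f ` (E - k ` {a<..<b}) \<inter> f ` k ` {a<..<b} = {}"
      using assms(15) oo_wy by (simp add: exclusive_in_def w_def)
    then have "F ` to_complex ` (E - k ` {a<..<b}) \<inter> F ` to_complex ` k ` {a<..<b} = {}"
      unfolding FS by (rule disj)
    then show "F ` (to_complex ` E - g ` {a<..<b}) \<inter> F ` g ` {a<..<b} = {}"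
      unfolding gS by (simp add: image_set_diff[OF inj_to_complex])
    show "open (to_complex ` U)"
      using to_complex_image_interior[of U] assms(9) by (metis interior_open open_interior)
    show "g a \<in> to_complex ` U" using a(3) assms(11) by (simp add: g_def w_def)
    show "to_complex ` U \<subseteq> interior (to_complex ` E)"
      unfolding to_complex_image_interior using assms(12) by blast
    show "inj_on F (to_complex ` U)" by (rule injF[OF assms(13)])
    have "U \<subseteq> E" using assms(12) interior_subset by blast
    then have "continuous_on U f" using contE continuous_on_subset by blast
    then show "winding_number (F \<circ> circlepath p r) (F p) = 1" if "r > 0" "cball p r \<subseteq> to_complex ` U" for p r
      unfolding F_def by (rule orientation_preserving_on_open_degree[OF assms(14,9,10) _ assms(13) that])
  qed
  obtain p where p: "p \<in> interior (to_complex ` E)" "F p = p" using fixed_point by blast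
  then obtain q where q: "q \<in> interior E" "p = to_complex q" unfolding to_complex_image_interior by blast
  have "to_complex (f q) = to_complex q" using p(2) q(2) by (simp add: F_def)
  then have "f q = q" using inj_to_complex by (simp add: inj_eq)
  then show ?thesis using q(1) by blast
qed

end
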